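(* Let $\Omega\subset\mathbb{R}^n$ be a bounded $C^2$ domain and let $0<\alpha<1$. Let $f\in C^{0,\alpha}(\Omega)$ satisfy $\int_\Omega f=0$. Then there exists a vector field $\mathbf{u}$ (a single $\mathbf u$, not depending on $\beta$) such that for every $0<\beta<\alpha$ one has $\mathbf{u}\in C^{1,\beta}(\Omega)^n$, $$\operatorname{div}\mathbf{u}=f\quad\text{in }\Omega,\qquad \mathbf{u}=0\quad\text{on }\partial\Omega,$$ and $$\|\mathbf{u}\|_{C^{1,\beta}(\Omega)}\le C\,\|f\|_{C^{0,\alpha}(\Omega)},$$ where the constant $C$ depends only on $\Omega$, $n$, $\alpha$ and $\beta$ (in particular not on $f$).
   Context: For a bounded domain $\Omega\subset\mathbb{R}^n$ and $0<\alpha<1$, $C^{0,\alpha}(\Omega)$ is the space of $f\in C(\overline\Omega)$ with $[f]_{C^{0,\alpha}(\Omega)}:=\sup_{x\ne y\in\Omega}\frac{|f(x)-f(y)|}{|x-y|^\alpha}<\infty$, normed by $\|f\|_{C^{0,\alpha}(\Omega)}=\|f\|_{L^\infty(\Omega)}+[f]_{C^{0,\alpha}(\Omega)}$. For $k\in\mathbb{N}$, $f\in C^{k,\alpha}(\Omega)$ means that $f\in C^k(\Omega)$, all derivatives $D^\gamma f$ with $|\gamma|\le k$ extend continuously to $\overline\Omega$, and $D^\gamma f\in C^{0,\alpha}(\Omega)$ for all $|\gamma|=k$; the norm is $\|f\|_{C^{k,\alpha}(\Omega)}=\sum_{|\gamma|\le k}\|D^\gamma f\|_{L^\infty(\Omega)}+\sum_{|\gamma|=k}[D^\gamma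 f]_{C^{0,\alpha}(\Omega)}$. A vector field $\mathbf u$ with values in $\mathbb{R}^m$ belongs to $C^{k,\alpha}(\Omega)^m$ if each component belongs to $C^{k,\alpha}(\Omega)$. Boundary values are those of the continuous extension to $\overline\Omega$. *)

theory Defs
  imports "HOL-Probability.Essential_Supremum"
begin

text \<open>
  Functions on \<open>\<Omega>\<close> are total functions on \<open>real ^ 'n\<close>; for open \<open>\<Omega>\<close> every notion below depends
  only on the values on \<open>\<Omega>\<close>.  Norms and seminorms take values in \<open>ennreal\<close>, so that an
  infinite supremum really is \<open>\<infinity>\<close>.
\<close>

definition partial_deriv :: "'n \<Rightarrow> (real ^ 'n \<Rightarrow> real) \<Rightarrow> real ^ 'n \<Rightarrow> real" where
  "partial_deriv i f x = deriv (\<lambda>t. f (x + t *\<^sub>R axis i 1)) 0"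

primrec Ck_on :: "nat \<Rightarrow> (real ^ 'n) set \<Rightarrow> (real ^ 'n \<Rightarrow> real) \<Rightarrow> bool" where
  "Ck_on 0 \<Omega> f \<longleftrightarrow> continuous_on \<Omega> f"
| "Ck_on (Suc k) \<Omega> f \<longleftrightarrow> continuous_on \<Omega> f \<and>
     (\<forall>i. (\<forall>x\<in>\<Omega>. (\<lambda>t. f (x + t *\<^sub>R axis i 1)) differentiable (at 0)) \<and>
          Ck_on k \<Omega> (partial_deriv i f))"

text \<open>
  A multi-index is a function \<open>\<gamma> :: 'n \<Rightarrow> nat\<close>.  Since \<open>'n\<close> carries no order, the sequence in which
  the partial derivatives are taken is left to choice; for functions of class \<open>C^k\<close> with
  \<open>k = |\<gamma>|\<close> the order is irrelevant.
\<close>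

definition mi_order :: "('n::finite \<Rightarrow> nat) \<Rightarrow> nat" where
  "mi_order \<gamma> = (\<Sum>i\<in>UNIV. \<gamma> i)"

definition mi_deriv :: "('n \<Rightarrow> nat) \<Rightarrow> (real ^ 'n \<Rightarrow> real) \<Rightarrow> real ^ 'n \<Rightarrow> real" where
  "mi_deriv \<gamma> f = foldr partial_deriv (SOME xs. \<forall>i. count_list xs i = \<gamma> i) f"

definition continuous_extension ::
    "'a::topological_space set \<Rightarrow> ('a \<Rightarrow> 'b::topological_space) \<Rightarrow> ('a \<Rightarrow> 'b) \<Rightarrow> bool" where
  "continuous_extension \<Omega> f g \<longleftrightarrow> continuous_on (closure \<Omega>) g \<and> (\<forall>x\<in>\<Omega>. g x = f x)"

definition Linf_norm :: "(real ^ 'n) set \<Rightarrow> (real ^ 'n \<Rightarrow> real) \<Rightarrow> ennreal" where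
  "Linf_norm \<Omega> f = esssup (lebesgue_on \<Omega>) (\<lambda>x. ennreal \<bar>f x\<bar>)"

definition holder_seminorm :: "real \<Rightarrow> (real ^ 'n) set \<Rightarrow> (real ^ 'n \<Rightarrow> real) \<Rightarrow> ennreal" where
  "holder_seminorm \<alpha> \<Omega> f =
     (SUP (x, y) \<in> {(x, y). x \<in> \<Omega> \<and> y \<in> \<Omega> \<and> x \<noteq> y}. ennreal (\<bar>f x - f y\<bar> / norm (x - y) powr \<alpha>))"

definition holder_space :: "nat \<Rightarrow> real \<Rightarrow> (real ^ 'n) set \<Rightarrow> (real ^ 'n \<Rightarrow> real) set" where
  "holder_space k \<alpha> \<Omega> = {f. Ck_on k \<Omega> f \<and>
     (\<forall>\<gamma>. mi_order \<gamma> \<le> k \<longrightarrow> (\<exists>g. continuous_extension \<Omega> (mi_deriv \<gamma> f) g)) \<and>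
     (\<forall>\<gamma>. mi_order \<gamma> = k \<longrightarrow> holder_seminorm \<alpha> \<Omega> (mi_deriv \<gamma> f) < \<infinity>)}"

definition holder_norm :: "nat \<Rightarrow> real \<Rightarrow> (real ^ 'n) set \<Rightarrow> (real ^ 'n \<Rightarrow> real) \<Rightarrow> ennreal" where
  "holder_norm k \<alpha> \<Omega> f =
     (\<Sum>\<gamma> | mi_order \<gamma> \<le> k. Linf_norm \<Omega> (mi_deriv \<gamma> f)) +
     (\<Sum>\<gamma> | mi_order \<gamma> = k. holder_seminorm \<alpha> \<Omega> (mi_deriv \<gamma> f))"

definition holder_space_vec ::
    "nat \<Rightarrow> real \<Rightarrow> (real ^ 'n) set \<Rightarrow> (real ^ 'n \<Rightarrow> real ^ 'm) set" where
  "holder_space_vec k \<alpha> \<Omega> = {u. \<forall>j. (\<lambda>x. u x $ j) \<in> holder_space k \<alpha> \<Omega>}"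

text \<open>The norm of a vector field is taken to be the sum of the norms of its components.\<close>

definition holder_norm_vec ::
    "nat \<Rightarrow> real \<Rightarrow> (real ^ 'n) set \<Rightarrow> (real ^ 'n \<Rightarrow> real ^ 'm) \<Rightarrow> ennreal" where
  "holder_norm_vec k \<alpha> \<Omega> u = (\<Sum>j\<in>UNIV. holder_norm k \<alpha> \<Omega> (\<lambda>x. u x $ j))"

definition divergence :: "(real ^ 'n \<Rightarrow> real ^ 'n) \<Rightarrow> real ^ 'n \<Rightarrow> real" where
  "divergence u x = (\<Sum>i\<in>UNIV. partial_deriv i (\<lambda>y. u y $ i) x)"

definition zero_on_boundary :: "(real ^ 'n) set \<Rightarrow> (real ^ 'n \<Rightarrow> real ^ 'm) \<Rightarrow> bool" where
  "zero_on_boundary \<Omega> u \<longleftrightarrow> (\<exists>g. continuous_extension \<Omega> u g \<and> (\<forall>x\<in>frontier \<Omega>. g x = 0))"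

text \<open>
  Near each boundary point, after an orthogonal change of coordinates \<open>T\<close>, the set lies strictly
  above the graph of a \<open>C^k\<close> function \<open>h\<close> of the coordinates other than the \<open>i\<close>-th.  A function on
  \<open>\<real>^(n-1)\<close> is encoded as a function on \<open>real ^ 'n\<close> that does not depend on the \<open>i\<close>-th coordinate.
\<close>

definition Ck_boundary :: "nat \<Rightarrow> (real ^ 'n) set \<Rightarrow> bool" where
  "Ck_boundary k \<Omega> \<longleftrightarrow> (\<forall>x0\<in>frontier \<Omega>. \<exists>r>0. \<exists>(T :: real ^ 'n \<Rightarrow> real ^ 'n) i h.
     orthogonal_transformation T \<and> Ck_on k UNIV h \<and>
     (\<forall>x y. (\<forall>j. j \<noteq> i \<longrightarrow> x $ j = y $ j) \<longrightarrow> h x = h y) \<and>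
     \<Omega> \<inter> ball x0 r = {x \<in> ball x0 r. T x $ i > h (T x)})"

definition bounded_Ck_domain :: "nat \<Rightarrow> (real ^ 'n) set \<Rightarrow> bool" where
  "bounded_Ck_domain k \<Omega> \<longleftrightarrow>
     open \<Omega> \<and> connected \<Omega> \<and> \<Omega> \<noteq> {} \<and> bounded \<Omega> \<and> Ck_boundary k \<Omega>"

end

theory Submission
  imports Defs
begin

text \<open>
  Extend \<open>f\<close> to \<open>\<real>\<^sup>n\<close> by McShane's formula.  Near a boundary point let \<open>\<rho>\<close> be a defining function of
  \<open>\<Omega>\<close> that grows at unit speed in a direction \<open>e\<close>.  The field \<open>\<rho> F\<^sub>\<rho> e\<close>, with \<open>F\<^sub>\<rho>\<close> the mollification of
  \<open>f\<close> at the variable scale \<open>\<rho>\<close>, is \<open>C\<^sup>1\<close> with Hoelder derivatives, vanishes on the boundary, and its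
  divergence there is \<open>f\<close>.  Subtracting a finite combination of such fields leaves data \<open>g\<close> that are
  Hoelder on all of \<open>\<real>\<^sup>n\<close> and vanish off \<open>\<Omega>\<close>.

  Such data are cut into small pieces.  Moving the mass of a piece by \<open>y \<mapsto> y + s w\<close>, with \<open>w\<close> distributed
  according to a bump \<open>\<omega>\<close> placed so that the paths stay in \<open>\<Omega>\<close>, gives the flux
  \<open>\<integral>\<^sub>0\<^sup>1 \<integral> g(x - s w) w \<omega>(w) dw ds\<close>, whose divergence is \<open>g - g * \<omega>\<close>.  Differentiating it costs \<open>1/s\<close>, which
  is compensated by \<open>s\<^sup>\<alpha>\<close> because derivatives of kernels have mean zero; the loss from \<open>\<alpha>\<close> to \<open>\<beta> < \<alpha>\<close>
  makes the Hoelder estimate of the derivative an interpolation.  The smooth remainder is contracted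
  to a multiple of a fixed bump, and all bumps in the connected set \<open>\<Omega>\<close> are joined by further solutions;
  the multiples add up to zero.
\<close>

subsection \<open>Bounded Hoelder functions\<close>

text \<open>The boundary is the obstacle: transport needs data that are Hoelder on the whole space,
  and extending \<open>f\<close> by zero creates a jump wherever \<open>f\<close> is nonzero on the
  frontier. The correction removing these boundary values must respect the condition on the
  integral. It does: each corrector vanishes off \<Omega> and its divergence is a derivative in the
  single direction \<open>e\<close>, so translation invariance makes the integral zero. Second
  derivatives of the boundary enter through the Lipschitz bound for the gradient of \<rho>, a factor
  in the corrector's derivative. For \<beta> < \<alpha> the differentiated flux is at worst as
  singular as \<open>s powr (a - b - 1)\<close>, hence all integrals converge absolutely, with a
  constant containing \<open>1 / (a - b)\<close>. The exponent \<open>b\<close> occurs in estimates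
  only, never in the construction of a field; this is why one \<open>u\<close> serves every \<beta>.
  Stopping the transport at time 1 leaves a mollified remainder with a \<open>C^1\<close> kernel,
  whose contraction is free of singularities. In \<open>holder_bd\<close> one number
  \<open>M\<close> bounds both the supremum and the Hoelder seminorm.\<close>

definition holder_bd :: "real \<Rightarrow> real \<Rightarrow> 'a::real_normed_vector set \<Rightarrow> ('a \<Rightarrow> real) \<Rightarrow> bool" where
  "holder_bd a M S g \<longleftrightarrow>
     (\<forall>x\<in>S. \<bar>g x\<bar> \<le> M) \<and> (\<forall>x\<in>S. \<forall>y\<in>S. \<bar>g x - g y\<bar> \<le> M * norm (x - y) powr a)"

lemma holder_bdI:
  assumes "\<And>x. x \<in> S \<Longrightarrow> \<bar>g x\<bar> \<le> M"
    and "\<And>x y. x \<in> S \<Longrightarrow> y \<in> S \<Longrightarrow> \<bar>g x - g y\<bar> \<le> M * norm (x - y) powr a"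
  shows "holder_bd a M S g"
  using assms by (auto simp: holder_bd_def)

lemma holder_bdD:
  assumes "holder_bd a M S g"
  shows "x \<in> S \<Longrightarrow> \<bar>g x\<bar> \<le> M"
    and "x \<in> S \<Longrightarrow> y \<in> S \<Longrightarrow> \<bar>g x - g y\<bar> \<le> M * norm (x - y) powr a"
  using assms by (auto simp: holder_bd_def)

lemma holder_bd_mono:
  assumes "holder_bd a M S g" "M \<le> M'"
  shows "holder_bd a M' S g"
  using assms unfolding holder_bd_def
  by (meson mult_right_mono order_trans powr_ge_zero)

lemma holder_bd_subset: "holder_bd a M S g \<Longrightarrow> T \<subseteq> S \<Longrightarrow> holder_bd a M T g"
  by (auto simp: holder_bd_def)

lemma holder_bd_cong:
  "holder_bd a M S g \<Longrightarrow> (\<And>x. x \<in> S \<Longrightarrow> f x = g x) \<Longrightarrow> holder_bd a M S f"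
  by (auto simp: holder_bd_def)

lemma holder_bd_zero: "0 \<le> M \<Longrightarrow> holder_bd a M S (\<lambda>x. 0)"
  by (auto simp: holder_bd_def)

lemma holder_bd_const: "\<bar>c\<bar> \<le> M \<Longrightarrow> holder_bd a M S (\<lambda>x. c)"
  by (auto simp: holder_bd_def)

lemma holder_bd_add:
  assumes "holder_bd a M S f" "holder_bd a N S g"
  shows "holder_bd a (M + N) S (\<lambda>x. f x + g x)"
proof (rule holder_bdI)
  fix x assume "x \<in> S"
  then show "\<bar>f x + g x\<bar> \<le> M + N"
    using holder_bdD(1)[OF assms(1)] holder_bdD(1)[OF assms(2)] by fastforce
next
  fix x y assume "x \<in> S" "y \<in> S"
  then have "\<bar>f x - f y\<bar> \<le> M * norm (x - y) powr a" "\<bar>g x - g y\<bar> \<le> N * norm (x - y) powr a"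
    using holder_bdD(2)[OF assms(1)] holder_bdD(2)[OF assms(2)] by auto
  then show "\<bar>f x + g x - (f y + g y)\<bar> \<le> (M + N) * norm (x - y) powr a"
    by (simp add: distrib_right)
qed

lemma holder_bd_cmult:
  assumes "holder_bd a M S f"
  shows "holder_bd a (\<bar>c\<bar> * M) S (\<lambda>x. c * f x)"
proof (rule holder_bdI)
  fix x assume "x \<in> S"
  then show "\<bar>c * f x\<bar> \<le> \<bar>c\<bar> * M"
    using holder_bdD(1)[OF assms] by (simp add: abs_mult mult_left_mono)
next
  fix x y assume "x \<in> S" "y \<in> S"
  then have "\<bar>c\<bar> * \<bar>f x - f y\<bar> \<le> \<bar>c\<bar> * (M * norm (x - y) powr a)"
    using holder_bdD(2)[OF assms] by (simp add: mult_left_mono)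
  then show "\<bar>c * f x - c * f y\<bar> \<le> \<bar>c\<bar> * M * norm (x - y) powr a"
    by (simp add: abs_mult right_diff_distrib[symmetric] mult.assoc)
qed

lemma holder_bd_minus: "holder_bd a M S f \<Longrightarrow> holder_bd a M S (\<lambda>x. - f x)"
  by (auto simp: holder_bd_def abs_minus_commute)

lemma holder_bd_diff:
  assumes "holder_bd a M S f" "holder_bd a N S g"
  shows "holder_bd a (M + N) S (\<lambda>x. f x - g x)"
  using holder_bd_add[OF assms(1) holder_bd_minus[OF assms(2)]] by simp

lemma holder_bd_sum:
  assumes "finite I" "\<And>i. i \<in> I \<Longrightarrow> holder_bd a (M i) S (f i)"
  shows "holder_bd a (\<Sum>i\<in>I. M i) S (\<lambda>x. \<Sum>i\<in>I. f i x)"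
  using assms by (induction I rule: finite_induct) (auto simp: holder_bd_zero intro: holder_bd_add)

text \<open>At a zero \<open>v\<close> of \<open>f\<close> the product changes by
  \<open>f u * g u = (f u - f v) * g u\<close>, so values of \<open>g\<close> enter only at points
  where \<open>f\<close> is nonzero. Hence a cut-off \<open>f\<close> may multiply a factor that is
  controlled only where the cut-off is nonzero.\<close>

lemma holder_bd_mult:
  assumes f: "holder_bd a M S f" and g: "holder_bd a N (S \<inter> {x. f x \<noteq> 0}) g"
    and MN: "0 \<le> M" "0 \<le> N"
  shows "holder_bd a (2 * M * N) S (\<lambda>x. f x * g x)"
proof (rule holder_bdI)
  fix x assume x: "x \<in> S"
  show "\<bar>f x * g x\<bar> \<le> 2 * M * N"
  proof (cases "f x = 0")
    case False
    then have "\<bar>f x\<bar> * \<bar>g x\<bar> \<le> M * N"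
      using x holder_bdD(1)[OF f] holder_bdD(1)[OF g] MN by (intro mult_mono) auto
    moreover have "0 \<le> M * N" using MN by simp
    ultimately show ?thesis by (simp add: abs_mult)
  qed (use MN in simp)
next
  fix x y assume x: "x \<in> S" and y: "y \<in> S"
  let ?d = "norm (x - y) powr a"
  have d: "0 \<le> ?d" by simp
  have fxy: "\<bar>f x - f y\<bar> \<le> M * ?d" using holder_bdD(2)[OF f x y] .
  have one: "\<bar>f u * g u - f v * g v\<bar> \<le> 2 * M * N * norm (u - v) powr a"
    if uv: "u \<in> S" "v \<in> S" "f u \<noteq> 0" and fuv: "\<bar>f u - f v\<bar> \<le> M * norm (u - v) powr a" for u v
  proof (cases "f v = 0")
    case True
    have "\<bar>f u\<bar> * \<bar>g u\<bar> \<le> (M * norm (u - v) powr a) * N"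
      using uv fuv True holder_bdD(1)[OF g] MN by (intro mult_mono) auto
    moreover have "0 \<le> M * N * norm (u - v) powr a" using MN by simp
    ultimately show ?thesis using True by (simp add: abs_mult mult_ac)
  next
    case False
    have "\<bar>f u * g u - f v * g v\<bar> = \<bar>(f u - f v) * g u + f v * (g u - g v)\<bar>"
      by (simp add: algebra_simps)
    also have "\<dots> \<le> \<bar>f u - f v\<bar> * \<bar>g u\<bar> + \<bar>f v\<bar> * \<bar>g u - g v\<bar>"
      by (metis abs_mult abs_triangle_ineq)
    also have "\<dots> \<le> (M * norm (u - v) powr a) * N + M * (N * norm (u - v) powr a)"
      using uv fuv False holder_bdD[OF g] holder_bdD(1)[OF f] MN
      by (intro add_mono mult_mono) auto
    finally show ?thesis by (simp add: mult_ac)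
  qed
  show "\<bar>f x * g x - f y * g y\<bar> \<le> 2 * M * N * ?d"
  proof (cases "f x = 0 \<and> f y = 0")
    case True
    then show ?thesis using MN d by simp
  next
    case False
    then consider "f x \<noteq> 0" | "f y \<noteq> 0" by auto
    then show ?thesis
    proof cases
      case 1 then show ?thesis using one[OF x y] fxy by blast
    next
      case 2 then show ?thesis using one[OF y x] fxy by (simp add: norm_minus_commute abs_minus_commute)
    qed
  qed
qed

text \<open>At distances below 1 the smaller exponent gives the larger power; beyond 1 the bound
  \<open>2 * M\<close> suffices.\<close>

lemma min_powr_interpolate:
  fixes d :: real
  assumes "v \<le> 2 * M" "v \<le> M * d powr a" "0 \<le> d" "0 \<le> M" "0 < b" "b \<le> a"
  shows "v \<le> 2 * M * d powr b"
proof (cases "d \<le> 1")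
  case True
  have "d powr a \<le> d powr b" using assms True by (intro powr_mono') auto
  then have "M * d powr a \<le> M * d powr b" using assms by (intro mult_left_mono) auto
  moreover have "0 \<le> M * d powr b" using assms by simp
  ultimately show ?thesis using assms by linarith
next
  case False
  then have "1 \<le> d powr b" using assms by (intro ge_one_powr_ge_zero) auto
  then have "2 * M * 1 \<le> 2 * M * d powr b" using assms by (intro mult_left_mono) auto
  then show ?thesis using assms by linarith
qed

lemma holder_bd_exponent_mono:
  assumes "holder_bd a M S f" "0 < b" "b \<le> a" "0 \<le> M"
  shows "holder_bd b (2 * M) S f"
proof (rule holder_bdI)
  fix x assume "x \<in> S"
  then show "\<bar>f x\<bar> \<le> 2 * M" using holder_bdD(1)[OF assms(1)] assms(4) by fastforce
next
  fix x y assume xy: "x \<in> S" "y \<in> S"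
  have "\<bar>f x - f y\<bar> \<le> 2 * M"
    using holder_bdD(1)[OF assms(1) xy(1)] holder_bdD(1)[OF assms(1) xy(2)] by linarith
  then show "\<bar>f x - f y\<bar> \<le> 2 * M * norm (x - y) powr b"
    using holder_bdD(2)[OF assms(1) xy] assms by (intro min_powr_interpolate) auto
qed

lemma holder_bd_one_iff:
  "holder_bd 1 M S f \<longleftrightarrow> (\<forall>x\<in>S. \<bar>f x\<bar> \<le> M) \<and> (\<forall>x\<in>S. \<forall>y\<in>S. \<bar>f x - f y\<bar> \<le> M * norm (x - y))"
  by (simp add: holder_bd_def)

lemma holder_bd_uniformly_continuous:
  assumes "holder_bd a M S f" "0 < a"
  shows "uniformly_continuous_on S f"
  unfolding uniformly_continuous_on_def
proof (intro allI impI)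
  fix e :: real assume e: "0 < e"
  define N where "N = \<bar>M\<bar> + 1"
  have N: "0 < N" "M \<le> N" by (auto simp: N_def)
  define d where "d = (e / N) powr (1 / a)"
  have d: "0 < d" using e N by (simp add: d_def)
  have da: "d powr a = e / N" using e N assms(2) by (simp add: d_def powr_powr)
  show "\<exists>d>0. \<forall>x\<in>S. \<forall>x'\<in>S. dist x' x < d \<longrightarrow> dist (f x') (f x) < e"
  proof (intro exI[of _ d] conjI ballI impI d)
    fix x x' assume x: "x \<in> S" "x' \<in> S" "dist x' x < d"
    have "\<bar>f x' - f x\<bar> \<le> N * norm (x' - x) powr a"
      using holder_bdD(2)[OF holder_bd_mono[OF assms(1) N(2)]] x by blast
    also have "\<dots> < N * d powr a"
      using x(3) N assms(2) by (intro mult_strict_left_mono powr_less_mono2) (auto simp: dist_norm)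
    also have "\<dots> = e" using da N by simp
    finally show "dist (f x') (f x) < e" by (simp add: dist_norm)
  qed
qed

lemma holder_bd_continuous_on:
  "holder_bd a M S f \<Longrightarrow> 0 < a \<Longrightarrow> continuous_on S f"
  by (intro uniformly_continuous_imp_continuous holder_bd_uniformly_continuous)

lemma holder_bd_inverse:
  assumes f: "holder_bd a M S f" and c: "0 < c" "\<And>x. x \<in> S \<Longrightarrow> c \<le> f x" and M: "0 \<le> M"
  shows "holder_bd a (1 / c + M / c\<^sup>2) S (\<lambda>x. 1 / f x)"
proof (rule holder_bdI)
  fix x assume x: "x \<in> S"
  have "1 / f x \<le> 1 / c" using c x by (intro divide_left_mono) (auto intro: mult_pos_pos less_le_trans)
  moreover have "0 < f x" using c x by force
  ultimately show "\<bar>1 / f x\<bar> \<le> 1 / c + M / c\<^sup>2" using M by (simp add: add_increasing2)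
next
  fix x y assume x: "x \<in> S" and y: "y \<in> S"
  have p: "0 < f x" "0 < f y" "c \<le> f x" "c \<le> f y" using c x y by force+
  have "\<bar>1 / f x - 1 / f y\<bar> = \<bar>f x - f y\<bar> / (f x * f y)"
    using p by (simp add: field_simps abs_minus_commute)
  also have "\<dots> \<le> (M * norm (x - y) powr a) / (c * c)"
    using p c holder_bdD(2)[OF f x y] M by (intro frac_le mult_mono) auto
  also have "\<dots> \<le> (1 / c + M / c\<^sup>2) * norm (x - y) powr a"
    using c by (simp add: field_simps power2_eq_square)
  finally show "\<bar>1 / f x - 1 / f y\<bar> \<le> (1 / c + M / c\<^sup>2) * norm (x - y) powr a" .
qed

section \<open>Extension of Hoelder functions, by zero and from a subset\<close>

lemma segment_meets_frontier:
  fixes x y :: "'a::real_normed_vector"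
  assumes "x \<in> S" "y \<notin> S"
  shows "\<exists>z \<in> frontier S. norm (x - z) \<le> norm (x - y)"
proof -
  have "closed_segment x y \<inter> frontier S \<noteq> {}"
    using assms by (intro connected_Int_frontier) auto
  then obtain z where z: "z \<in> closed_segment x y" "z \<in> frontier S" by blast
  then have "norm (z - x) \<le> norm (y - x)" using segment_bound(1) by blast
  then show ?thesis using z by (auto simp: norm_minus_commute)
qed

text \<open>A segment leaving \<open>S\<close> meets the frontier, where \<open>f\<close> vanishes,
  at a distance not exceeding its length; so the constant \<open>M\<close> is kept.\<close>

lemma holder_bd_zero_extension:
  assumes f: "holder_bd a M UNIV f" and a: "0 < a" and M: "0 \<le> M"
    and z: "\<And>x. x \<in> frontier S \<Longrightarrow> f x = 0"
  shows "holder_bd a M UNIV (\<lambda>x. if x \<in> S then f x else 0)"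
proof (rule holder_bdI)
  fix x y
  have one: "\<bar>f u\<bar> \<le> M * norm (u - v) powr a" if uv: "u \<in> S" "v \<notin> S" for u v
  proof -
    obtain w where w: "w \<in> frontier S" "norm (u - w) \<le> norm (u - v)"
      using segment_meets_frontier[OF uv] by blast
    have "\<bar>f u - f w\<bar> \<le> M * norm (u - w) powr a" using holder_bdD(2)[OF f] by blast
    also have "\<dots> \<le> M * norm (u - v) powr a"
      using w a M by (intro mult_left_mono powr_mono2) auto
    finally show ?thesis using z w by simp
  qed
  show "\<bar>(if x \<in> S then f x else 0) - (if y \<in> S then f y else 0)\<bar> \<le> M * norm (x - y) powr a"
    using holder_bdD(2)[OF f, of x y] one[of x y] one[of y x] M
    by (auto simp: norm_minus_commute)
qed (use holder_bdD(1)[OF f] M in auto)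

text \<open>Scaling to \<open>x + y = 1\<close> reduces subadditivity to
  \<open>t \<le> t powr a\<close> on the unit interval.\<close>

lemma powr_add_le:
  fixes x y :: real
  assumes "0 \<le> x" "0 \<le> y" "0 \<le> a" "a \<le> 1"
  shows "(x + y) powr a \<le> x powr a + y powr a"
proof (cases "x + y = 0")
  case False
  define s where "s = x + y"
  have s: "0 < s" using False assms by (simp add: s_def)
  have u: "u / s \<le> (u / s) powr a" if "0 \<le> u" "u \<le> s" for u
    using powr_mono'[of a 1 "u / s"] that s assms by simp
  have "1 = (x + y) / s" using s by (simp add: s_def)
  also have "\<dots> = x / s + y / s" by (rule add_divide_distrib)
  also have "\<dots> \<le> (x / s) powr a + (y / s) powr a"
    using assms by (intro add_mono u) (auto simp: s_def)
  also have "\<dots> = (x powr a + y powr a) / s powr a"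
    using assms s by (simp add: powr_divide add_divide_distrib)
  finally show ?thesis using s by (simp add: s_def field_simps)
qed (use assms in simp)

text \<open>McShane's extension; truncation keeps the bound.\<close>

lemma holder_bd_extension:
  fixes f :: "'a::real_normed_vector \<Rightarrow> real"
  assumes f: "holder_bd a M S f" and a: "0 < a" "a \<le> 1" and M: "0 \<le> M" and ne: "S \<noteq> {}"
  shows "\<exists>g. holder_bd a M UNIV g \<and> (\<forall>x\<in>S. g x = f x)"
proof -
  define h where "h x = (INF y\<in>S. f y + M * norm (x - y) powr a)" for x
  define g where "g x = max (- M) (min M (h x))" for x
  have bdd: "bdd_below ((\<lambda>y. f y + M * norm (x - y) powr a) ` S)" for x
  proof (rule bdd_belowI2)
    fix y assume "y \<in> S"
    then have "- M \<le> f y" using holder_bdD(1)[OF f] by fastforce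
    moreover have "0 \<le> M * norm (x - y) powr a" using M by simp
    ultimately show "- M \<le> f y + M * norm (x - y) powr a" by linarith
  qed
  have hS: "h x = f x" if x: "x \<in> S" for x
  proof (rule antisym)
    have "h x \<le> f x + M * norm (x - x) powr a"
      unfolding h_def by (rule cINF_lower[OF bdd x])
    then show "h x \<le> f x" by simp
    show "f x \<le> h x" unfolding h_def
    proof (rule cINF_greatest[OF ne])
      fix y assume "y \<in> S"
      then show "f x \<le> f y + M * norm (x - y) powr a"
        using holder_bdD(2)[OF f x, of y] by (simp add: abs_le_iff)
    qed
  qed
  \<comment> \<open>Since \<open>a \<le> 1\<close>, \<open>norm (x - y) powr a\<close> obeys the
    triangle inequality; each competitor in the infimum for \<open>y\<close> therefore bounds
    \<open>h x\<close> up to \<open>M * norm (x - y) powr a\<close>.\<close>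
  have le: "h x - M * norm (x - y) powr a \<le> h y" for x y
  proof -
    have "h x - M * norm (x - y) powr a \<le> f z + M * norm (y - z) powr a" if z: "z \<in> S" for z
    proof -
      have "h x \<le> f z + M * norm (x - z) powr a"
        unfolding h_def by (rule cINF_lower[OF bdd z])
      moreover have "norm (x - z) powr a \<le> (norm (x - y) + norm (y - z)) powr a"
        using a norm_triangle_ineq[of "x - y" "y - z"] by (intro powr_mono2) auto
      moreover have "\<dots> \<le> norm (x - y) powr a + norm (y - z) powr a"
        using a by (intro powr_add_le) auto
      ultimately have "norm (x - z) powr a \<le> norm (x - y) powr a + norm (y - z) powr a" by linarith
      then have "M * norm (x - z) powr a \<le> M * norm (x - y) powr a + M * norm (y - z) powr a"
        using M mult_left_mono by (fastforce simp: distrib_left[symmetric])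
      then show ?thesis using \<open>h x \<le> f z + M * norm (x - z) powr a\<close> by linarith
    qed
    then show ?thesis unfolding h_def[of y] by (intro cINF_greatest[OF ne]) auto
  qed
  have "holder_bd a M UNIV g"
  proof (rule holder_bdI)
    show "\<bar>g x\<bar> \<le> M" for x using M by (auto simp: g_def)
    fix x y
    have "\<bar>h x - h y\<bar> \<le> M * norm (x - y) powr a"
      using le[of x y] le[of y x] by (simp add: norm_minus_commute abs_le_iff)
    then show "\<bar>g x - g y\<bar> \<le> M * norm (x - y) powr a" by (auto simp: g_def)
  qed
  moreover have "g x = f x" if "x \<in> S" for x
    using hS[OF that] holder_bdD(1)[OF f that] by (auto simp: g_def)
  ultimately show ?thesis by blast
qed

subsection \<open>Integrals of continuous functions with compact support\<close>

lemma has_integral_compact_support: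
  fixes g :: "'a::euclidean_space \<Rightarrow> real"
  assumes "continuous_on UNIV g" "\<And>x. x \<notin> cbox a b \<Longrightarrow> g x = 0"
  shows "(g has_integral integral (cbox a b) g) UNIV"
proof (rule has_integral_on_superset)
  show "(g has_integral integral (cbox a b) g) (cbox a b)"
    using assms(1) by (intro integrable_integral integrable_continuous) (auto intro: continuous_on_subset)
qed (use assms in auto)

lemma cball_subset_symmetric_cbox: "\<exists>a::'a::euclidean_space. cball 0 B \<subseteq> cbox (-a) a"
  using bounded_subset_cbox_symmetric[OF bounded_cball] by metis

lemma integrable_compact_support:
  fixes g :: "'a::euclidean_space \<Rightarrow> real"
  assumes "continuous_on UNIV g" "\<And>x. B < norm x \<Longrightarrow> g x = 0"
  shows "g integrable_on UNIV"
proof -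
  obtain a :: 'a where "cball 0 B \<subseteq> cbox (-a) a" using cball_subset_symmetric_cbox by blast
  then have "\<And>x. x \<notin> cbox (-a) a \<Longrightarrow> g x = 0" using assms(2) by force
  then show ?thesis using has_integral_compact_support[OF assms(1)] by blast
qed

lemma integral_affine_compact_support:
  fixes g :: "'a::euclidean_space \<Rightarrow> real"
  assumes g: "continuous_on UNIV g" "\<And>x. B < norm x \<Longrightarrow> g x = 0" and m: "m \<noteq> 0"
  shows "integral UNIV (\<lambda>x. g (m *\<^sub>R x + c)) = integral UNIV g / \<bar>m\<bar> ^ DIM('a)"
proof -
  obtain a :: 'a where "cball 0 B \<subseteq> cbox (-a) a" using cball_subset_symmetric_cbox by blast
  then have z: "\<And>x. x \<notin> cbox (-a) a \<Longrightarrow> g x = 0" using g(2) by force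
  have I: "integral UNIV g = integral (cbox (-a) a) g"
    using has_integral_compact_support[OF g(1) z] by (simp add: integral_unique)
  have "(g has_integral integral UNIV g) (cbox (-a) a)"
    unfolding I using g(1) by (intro integrable_integral integrable_continuous) (auto intro: continuous_on_subset)
  from has_integral_affinity[OF this m, of c]
  have "((\<lambda>x. g (m *\<^sub>R x + c)) has_integral (1 / \<bar>m\<bar> ^ DIM('a)) *\<^sub>R integral UNIV g) UNIV"
  proof (rule has_integral_on_superset)
    fix x assume x: "x \<notin> (\<lambda>x. (1 / m) *\<^sub>R x + - ((1 / m) *\<^sub>R c)) ` cbox (- a) a"
    have "m *\<^sub>R x + c \<notin> cbox (-a) a"
    proof
      assume "m *\<^sub>R x + c \<in> cbox (-a) a"
      moreover have "x = (1 / m) *\<^sub>R (m *\<^sub>R x + c) + - ((1 / m) *\<^sub>R c)"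
        using m by (simp add: algebra_simps)
      ultimately show False using x by blast
    qed
    then show "g (m *\<^sub>R x + c) = 0" using z by blast
  qed auto
  then show ?thesis by (simp add: integral_unique)
qed

subsection \<open>Mollification at a variable scale\<close>

text \<open>The gradient \<open>dk\<close> is carried as a separate argument because derivatives of
  a mollification are again mollifications, with kernels built from \<open>dk\<close>.\<close>

definition C1_kernel :: "(real^'n \<Rightarrow> real) \<Rightarrow> (real^'n \<Rightarrow> real^'n) \<Rightarrow> real \<Rightarrow> bool" where
  "C1_kernel k dk R \<longleftrightarrow> 0 \<le> R \<and> (\<forall>w. (k has_derivative (\<lambda>v. dk w \<bullet> v)) (at w)) \<and>
     continuous_on UNIV dk \<and> (\<forall>w. R < norm w \<longrightarrow> k w = 0 \<and> dk w = 0)"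

lemma C1_kernelD:
  assumes "C1_kernel k dk R"
  shows "0 \<le> R" "(k has_derivative (\<lambda>v. dk w \<bullet> v)) (at w)" "continuous_on UNIV dk"
    "R < norm w \<Longrightarrow> k w = 0" "R < norm w \<Longrightarrow> dk w = 0" "continuous_on UNIV k"
proof -
  show d: "(k has_derivative (\<lambda>v. dk w \<bullet> v)) (at w)" for w
    using assms unfolding C1_kernel_def by blast
  show "continuous_on UNIV k"
    by (rule has_derivative_continuous_on[OF has_derivative_at_withinI[OF d]])
qed (use assms in \<open>simp_all add: C1_kernel_def\<close>)

lemma C1_kernel_coordinate_mult:
  assumes "C1_kernel k dk R"
  shows "C1_kernel (\<lambda>w. w $ i * k w) (\<lambda>w. k w *\<^sub>R axis i 1 + w $ i *\<^sub>R dk w) R"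
  unfolding C1_kernel_def
proof (intro conjI allI impI)
  fix w
  have "((\<lambda>w. w $ i * k w) has_derivative (\<lambda>v. w $ i * (dk w \<bullet> v) + v $ i * k w)) (at w)"
    by (intro has_derivative_mult C1_kernelD(2)[OF assms] bounded_linear.has_derivative[OF bounded_linear_vec_nth] has_derivative_ident)
  then show "((\<lambda>w. w $ i * k w) has_derivative (\<lambda>v. (k w *\<^sub>R axis i 1 + w $ i *\<^sub>R dk w) \<bullet> v)) (at w)"
    by (simp add: inner_add_left inner_axis' algebra_simps)
  show "continuous_on UNIV (\<lambda>w. k w *\<^sub>R axis i 1 + w $ i *\<^sub>R dk w)"
    by (intro continuous_intros C1_kernelD[OF assms])
qed (use C1_kernelD[OF assms] in auto)

text \<open>For \<open>t > 0\<close> this is convolution with the rescaled kernel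
  \<open>t^(-n) k(./t)\<close>. Written in the unscaled variable it also makes sense at
  \<open>t = 0\<close>, where it is \<open>integral UNIV k * f x\<close>; the boundary values of the
  correctors and the start of the transport are read off there.\<close>

definition moll :: "(real^'n \<Rightarrow> real) \<Rightarrow> (real^'n \<Rightarrow> real) \<Rightarrow> real^'n \<Rightarrow> real \<Rightarrow> real" where
  "moll f k x t = integral UNIV (\<lambda>w. k w * f (x - t *\<^sub>R w))"

lemma moll_integrable:
  fixes f k :: "real^'n \<Rightarrow> real"
  assumes f: "continuous_on UNIV f" and k: "continuous_on UNIV k" "\<And>w. R < norm w \<Longrightarrow> k w = 0"
  shows "(\<lambda>w. k w * f (x - t *\<^sub>R w)) integrable_on UNIV"
  by (rule integrable_compact_support[where B = R])
    (auto intro!: continuous_intros k(1) continuous_on_compose2[OF f] simp: k(2))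

lemma moll_le:
  fixes f k :: "real^'n \<Rightarrow> real"
  assumes f: "continuous_on UNIV f" and k: "continuous_on UNIV k" "\<And>w. R < norm w \<Longrightarrow> k w = 0"
    and b: "\<And>w. norm w \<le> R \<Longrightarrow> \<bar>f (x - t *\<^sub>R w)\<bar> \<le> B"
  shows "\<bar>moll f k x t\<bar> \<le> integral UNIV (\<lambda>w. \<bar>k w\<bar>) * B"
proof -
  have kb: "\<bar>k w * f (x - t *\<^sub>R w)\<bar> \<le> \<bar>k w\<bar> * B" for w
    using b[of w] k(2)[of w] by (cases "norm w \<le> R") (auto simp: abs_mult mult_left_mono)
  have ki: "(\<lambda>w. \<bar>k w\<bar>) integrable_on UNIV"
    by (rule integrable_compact_support[where B = R]) (auto intro!: continuous_intros k(1) simp: k(2))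
  have "norm (moll f k x t) \<le> integral UNIV (\<lambda>w. \<bar>k w\<bar> * B)"
    unfolding moll_def
    by (rule integral_norm_bound_integral[OF moll_integrable[OF f k] integrable_on_mult_left[OF ki]])
      (use kb in auto)
  also have "\<dots> = integral UNIV (\<lambda>w. \<bar>k w\<bar>) * B"
    by (rule integral_mult_left)
  finally show ?thesis by simp
qed

lemma moll_diff_le:
  fixes f k :: "real^'n \<Rightarrow> real"
  assumes f: "continuous_on UNIV f" and k: "continuous_on UNIV k" "\<And>w. R < norm w \<Longrightarrow> k w = 0"
    and b: "\<And>w. norm w \<le> R \<Longrightarrow> \<bar>f (x - t *\<^sub>R w) - f (y - s *\<^sub>R w)\<bar> \<le> B"
  shows "\<bar>moll f k x t - moll f k y s\<bar> \<le> integral UNIV (\<lambda>w. \<bar>k w\<bar>) * B"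
proof -
  have kb: "\<bar>k w * f (x - t *\<^sub>R w) - k w * f (y - s *\<^sub>R w)\<bar> \<le> \<bar>k w\<bar> * B" for w
    using b[of w] k(2)[of w]
    by (cases "norm w \<le> R") (auto simp: abs_mult mult_left_mono right_diff_distrib[symmetric])
  have ki: "(\<lambda>w. \<bar>k w\<bar>) integrable_on UNIV"
    by (rule integrable_compact_support[where B = R]) (auto intro!: continuous_intros k(1) simp: k(2))
  have "norm (integral UNIV (\<lambda>w. k w * f (x - t *\<^sub>R w) - k w * f (y - s *\<^sub>R w)))
      \<le> integral UNIV (\<lambda>w. \<bar>k w\<bar> * B)"
    by (rule integral_norm_bound_integral[OF integrable_diff[OF moll_integrable[OF f k] moll_integrable[OF f k]]
          integrable_on_mult_left[OF ki]])
      (use kb in auto)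
  also have "\<dots> = integral UNIV (\<lambda>w. \<bar>k w\<bar>) * B"
    by (rule integral_mult_left)
  finally show ?thesis
    unfolding moll_def by (simp add: integral_diff[OF moll_integrable[OF f k] moll_integrable[OF f k]])
qed

lemma moll_zero_scale:
  "moll f k x 0 = integral UNIV k * f x"
  unfolding moll_def by (simp add: integral_mult_left)

lemma integral_abs_nonneg: "0 \<le> integral UNIV (\<lambda>w. \<bar>k w\<bar> :: real)"
  by (cases "(\<lambda>w. \<bar>k w\<bar>) integrable_on UNIV") (auto intro: integral_nonneg simp: not_integrable_integral)

text \<open>The sampling points \<open>x - \<rho> x *\<^sub>R w\<close> with
  \<open>norm w \<le> R\<close> move by at most \<open>(1 + R * L) * norm (x - y)\<close>, and
  \<open>(1 + R * L) powr a \<le> 1 + R * L\<close> because \<open>a \<le> 1\<close>.\<close>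

lemma moll_holder:
  fixes \<rho> :: "real^'n \<Rightarrow> real"
  assumes f: "holder_bd a M UNIV f" and a: "0 < a" "a \<le> 1" and M: "0 \<le> M"
    and k: "continuous_on UNIV k" "\<And>w. R < norm w \<Longrightarrow> k w = 0" and R: "0 \<le> R"
    and L: "0 \<le> L" "\<And>x y. x \<in> S \<Longrightarrow> y \<in> S \<Longrightarrow> \<bar>\<rho> x - \<rho> y\<bar> \<le> L * norm (x - y)"
  shows "holder_bd a (integral UNIV (\<lambda>w. \<bar>k w\<bar>) * (1 + R * L) * M) S (\<lambda>x. moll f k x (\<rho> x))"
proof (rule holder_bdI)
  let ?A = "integral UNIV (\<lambda>w. \<bar>k w\<bar>)"
  have fc: "continuous_on UNIV f" using holder_bd_continuous_on[OF f a(1)] .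
  fix x assume x: "x \<in> S"
  have "\<bar>moll f k x (\<rho> x)\<bar> \<le> ?A * M"
    using holder_bdD(1)[OF f] by (intro moll_le[OF fc k]) auto
  also have "\<dots> \<le> ?A * ((1 + R * L) * M)"
    using R L M by (intro mult_left_mono integral_abs_nonneg) (simp add: algebra_simps)
  finally show "\<bar>moll f k x (\<rho> x)\<bar> \<le> ?A * (1 + R * L) * M" by (simp add: mult_ac)
next
  let ?A = "integral UNIV (\<lambda>w. \<bar>k w\<bar>)"
  have fc: "continuous_on UNIV f" using holder_bd_continuous_on[OF f a(1)] .
  fix x y assume x: "x \<in> S" and y: "y \<in> S"
  have "\<bar>f (x - \<rho> x *\<^sub>R w) - f (y - \<rho> y *\<^sub>R w)\<bar> \<le> M * ((1 + R * L) * norm (x - y) powr a)"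
    if w: "norm w \<le> R" for w
  proof -
    have "norm ((x - \<rho> x *\<^sub>R w) - (y - \<rho> y *\<^sub>R w)) = norm ((x - y) - (\<rho> x - \<rho> y) *\<^sub>R w)"
      by (simp add: algebra_simps)
    also have "\<dots> \<le> norm (x - y) + \<bar>\<rho> x - \<rho> y\<bar> * norm w"
      by (metis norm_scaleR norm_triangle_ineq4)
    also have "\<dots> \<le> norm (x - y) + (L * norm (x - y)) * R"
      using L x y w by (intro add_left_mono mult_mono) auto
    finally have n: "norm ((x - \<rho> x *\<^sub>R w) - (y - \<rho> y *\<^sub>R w)) \<le> (1 + R * L) * norm (x - y)"
      by (simp add: algebra_simps)
    have RL: "0 \<le> R * L" using R L by simp
    have "\<bar>f (x - \<rho> x *\<^sub>R w) - f (y - \<rho> y *\<^sub>R w)\<bar> \<le> M * norm ((x - \<rho> x *\<^sub>R w) - (y - \<rho> y *\<^sub>R w)) powr a"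
      using holder_bdD(2)[OF f] by blast
    also have "\<dots> \<le> M * ((1 + R * L) * norm (x - y)) powr a"
      using n a M by (intro mult_left_mono powr_mono2) auto
    also have "\<dots> = M * ((1 + R * L) powr a * norm (x - y) powr a)"
      using RL by (simp add: powr_mult)
    also have "(1 + R * L) powr a \<le> (1 + R * L) powr 1"
      using RL a by (intro powr_mono) auto
    finally show ?thesis using RL M by (simp add: mult_left_mono mult_right_mono)
  qed
  from moll_diff_le[OF fc k this]
  show "\<bar>moll f k x (\<rho> x) - moll f k y (\<rho> y)\<bar> \<le> ?A * (1 + R * L) * M * norm (x - y) powr a"
    by (simp add: mult_ac)
qed

text \<open>The substitution \<open>y = x - t *\<^sub>R w\<close> moves the dependence on
  \<open>x\<close> and \<open>t\<close> into the kernel. The box is supplied from outside so that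
  one domain of integration serves a whole range of scales, as differentiation under the integral
  requires.\<close>

lemma moll_eq_convolution:
  fixes f :: "real^'n \<Rightarrow> real"
  assumes f: "continuous_on UNIV f" and k: "continuous_on UNIV k" "\<And>w. R < norm w \<Longrightarrow> k w = 0"
    and t: "0 < t" and B: "norm x + t * R \<le> B" and R: "0 \<le> R" and a: "cball 0 B \<subseteq> cbox (-a) a"
  shows "moll f k x t = integral (cbox (-a) a) (\<lambda>y. f y * (k ((1 / t) *\<^sub>R (x - y)) / t ^ CARD('n)))"
proof -
  define g where "g y = f y * (k ((1 / t) *\<^sub>R (x - y)) / t ^ CARD('n))" for y
  have gc: "continuous_on UNIV g"
    unfolding g_def using t by (intro continuous_intros f continuous_on_compose2[OF k(1)]) auto
  have gz: "g y = 0" if "B < norm y" for y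
  proof -
    have "norm y \<le> norm x + norm (x - y)" by (metis norm_minus_commute norm_triangle_sub)
    then have "t * R < norm (x - y)" using B that by linarith
    then have "R < norm ((1 / t) *\<^sub>R (x - y))"
      unfolding norm_scaleR using t by (simp add: pos_less_divide_eq mult.commute)
    then show ?thesis using k(2) by (simp add: g_def)
  qed
  have "(\<lambda>w. k w * f (x - t *\<^sub>R w)) = (\<lambda>w. t ^ CARD('n) * g ((-t) *\<^sub>R w + x))"
    using t by (auto simp: g_def)
  then have "moll f k x t = t ^ CARD('n) * integral UNIV (\<lambda>w. g ((-t) *\<^sub>R w + x))"
    by (simp add: moll_def)
  also have "\<dots> = integral UNIV g"
    using integral_affine_compact_support[OF gc gz, where m = "-t" and c = x] t by simp
  also have "\<dots> = integral (cbox (-a) a) g"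
    using a gz by (intro integral_unique has_integral_compact_support[OF gc]) force
  finally show ?thesis unfolding g_def .
qed

text \<open>
  In the form \<open>\<integral> f(y) k((x - y)/t) t\<^sup>-\<^sup>n dy\<close> the mollification is differentiated without
  touching \<open>f\<close>.
\<close>

lemma moll_has_derivative:
  fixes f :: "real^'n \<Rightarrow> real"
  assumes f: "continuous_on UNIV f" and k: "C1_kernel k dk R" and \<delta>: "0 < \<delta>"
    and t: "\<And>\<tau>. \<bar>\<tau>\<bar> < \<delta> \<Longrightarrow> (t has_real_derivative t' \<tau>) (at \<tau>)"
    and t': "continuous_on {-\<delta><..<\<delta>} t'" and tp: "\<And>\<tau>. \<bar>\<tau>\<bar> < \<delta> \<Longrightarrow> 0 < t \<tau>"
  shows "((\<lambda>\<tau>. moll f k (x + \<tau> *\<^sub>R e) (t \<tau>)) has_real_derivative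
     (1 / t 0) * (moll f (\<lambda>w. dk w \<bullet> e) x (t 0)
        - t' 0 * moll f (\<lambda>w. real CARD('n) * k w + dk w \<bullet> w) x (t 0))) (at 0)"
proof -
  note kd = C1_kernelD[OF k]
  let ?D = "CARD('n)"
  \<comment> \<open>A compact interval around 0, on which \<open>t\<close> is bounded by some
    \<open>T\<close>; then \<open>B\<close> and the box do not depend on the parameter.\<close>
  define U where "U = {-\<delta>/2..\<delta>/2}"
  have U: "\<tau> \<in> U \<Longrightarrow> \<bar>\<tau>\<bar> < \<delta>" for \<tau> using \<delta> by (auto simp: U_def)
  have U0: "0 \<in> U" "convex U" using \<delta> by (auto simp: U_def)
  have tc: "continuous_on U t"
    by (intro continuous_at_imp_continuous_on ballI DERIV_isCont[OF t] U)
  have tc': "continuous_on U t'"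
    by (rule continuous_on_subset[OF t']) (use U in \<open>fastforce simp: abs_less_iff\<close>)
  obtain T where T: "\<And>\<tau>. \<tau> \<in> U \<Longrightarrow> t \<tau> \<le> T"
  proof -
    have "compact (t ` U)" unfolding U_def by (intro compact_continuous_image tc[unfolded U_def] compact_Icc)
    then have "bdd_above (t ` U)" by (intro bounded_imp_bdd_above compact_imp_bounded)
    then show ?thesis using that by (auto simp: bdd_above_def)
  qed
  define B where "B = norm x + \<delta> * norm e + T * R"
  obtain a :: "real^'n" where a: "cball 0 B \<subseteq> cbox (-a) a" using cball_subset_symmetric_cbox by blast
  have B: "norm (x + \<tau> *\<^sub>R e) + t \<tau> * R \<le> B" if "\<tau> \<in> U" for \<tau>
  proof -
    have "norm (x + \<tau> *\<^sub>R e) \<le> norm x + \<bar>\<tau>\<bar> * norm e" by (metis norm_scaleR norm_triangle_ineq)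
    also have "\<bar>\<tau>\<bar> * norm e \<le> \<delta> * norm e" using U[OF that] by (intro mult_right_mono) auto
    moreover have "t \<tau> * R \<le> T * R" using T[OF that] kd(1) by (intro mult_right_mono) auto
    ultimately show ?thesis unfolding B_def by linarith
  qed
  define p where "p \<tau> y = (1 / t \<tau>) *\<^sub>R (x + \<tau> *\<^sub>R e - y)" for \<tau> y
  define K where "K \<tau> y = f y * (k (p \<tau> y) / t \<tau> ^ ?D)" for \<tau> y
  \<comment> \<open>The point \<open>p \<tau> y\<close> moves with velocity
    \<open>(e - t' \<tau> *\<^sub>R p \<tau> y) / t \<tau>\<close>, and the denominator
    \<open>t \<tau> ^ n\<close> contributes \<open>n * k\<close>; together they give the kernel
    \<open>n * k w + dk w \<bullet> w\<close> of the scale derivative.\<close>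
  define K' where "K' \<tau> y = f y * ((1 / t \<tau>) * ((dk (p \<tau> y) \<bullet> e
     - t' \<tau> * (real ?D * k (p \<tau> y) + dk (p \<tau> y) \<bullet> p \<tau> y)) / t \<tau> ^ ?D))" for \<tau> y
  have main: "((\<lambda>\<tau>. integral (cbox (-a) a) (K \<tau>)) has_field_derivative integral (cbox (-a) a) (K' 0)) (at 0 within U)"
  proof (rule leibniz_rule_field_derivative[OF _ _ _ U0])
    fix \<tau> y assume \<tau>: "\<tau> \<in> U"
    then have t0: "0 < t \<tau>" and td: "(t has_real_derivative t' \<tau>) (at \<tau>)" using t tp U by auto
    define p' where "p' = (1 / t \<tau>) *\<^sub>R e - (t' \<tau> / (t \<tau>)) *\<^sub>R p \<tau> y"
    have "((\<lambda>\<tau>. p \<tau> y) has_vector_derivative p') (at \<tau>)"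
      unfolding p_def p'_def using t0
      by (auto intro!: derivative_eq_intros td simp: field_simps power2_eq_square)
        (simp add: scaleR_left_distrib[symmetric] field_simps)
    then have "((\<lambda>\<tau>. k (p \<tau> y)) has_derivative (\<lambda>h. dk (p \<tau> y) \<bullet> (h *\<^sub>R p'))) (at \<tau>)"
      using has_derivative_compose[OF _ kd(2)] unfolding has_vector_derivative_def by blast
    then have kp: "((\<lambda>\<tau>. k (p \<tau> y)) has_real_derivative dk (p \<tau> y) \<bullet> p') (at \<tau>)"
      by (simp add: has_field_derivative_def mult_commute_abs)
    have D: "real ?D * t \<tau> ^ (?D - Suc 0) = real ?D * t \<tau> ^ ?D / t \<tau>"
      using t0 by (cases ?D) auto
    have "((\<lambda>\<tau>. K \<tau> y) has_real_derivative
        f y * ((dk (p \<tau> y) \<bullet> p' * t \<tau> ^ ?D - k (p \<tau> y) * (real ?D * t \<tau> ^ (?D - Suc 0) * t' \<tau>)) / (t \<tau> ^ ?D * t \<tau> ^ ?D))) (at \<tau>)"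
      unfolding K_def using t0
      by (auto intro!: derivative_eq_intros kp td simp: algebra_simps)
    also have "f y * ((dk (p \<tau> y) \<bullet> p' * t \<tau> ^ ?D - k (p \<tau> y) * (real ?D * t \<tau> ^ (?D - Suc 0) * t' \<tau>)) / (t \<tau> ^ ?D * t \<tau> ^ ?D)) = K' \<tau> y"
      unfolding K'_def D p'_def using t0 by (simp add: inner_diff_right inner_add_right field_simps)
    finally show "((\<lambda>\<tau>. K \<tau> y) has_field_derivative K' \<tau> y) (at \<tau> within U)"
      by (rule has_field_derivative_at_within)
  next
    fix \<tau> assume \<tau>: "\<tau> \<in> U"
    then have t0: "0 < t \<tau>" using tp U by auto
    show "K \<tau> integrable_on cbox (-a) a"
      unfolding K_def p_def using t0
      by (intro integrable_continuous continuous_intros continuous_on_subset[OF f] continuous_on_compose2[OF kd(6)]) auto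
  next
    have ne: "\<And>\<tau>. \<tau> \<in> U \<Longrightarrow> t \<tau> \<noteq> 0" using tp U by force
    have t1: "continuous_on (U \<times> cbox (-a) a) (\<lambda>z. t (fst z))" "continuous_on (U \<times> cbox (-a) a) (\<lambda>z. t' (fst z))"
      by (auto intro!: continuous_on_compose2[OF tc] continuous_on_compose2[OF tc'] continuous_intros)
    have pc: "continuous_on (U \<times> cbox (-a) a) (\<lambda>z. p (fst z) (snd z))"
      unfolding p_def using ne by (intro continuous_intros t1) auto
    have "continuous_on (U \<times> cbox (-a) a) (\<lambda>z. K' (fst z) (snd z))"
      unfolding K'_def using ne
      by (intro continuous_intros t1 continuous_on_compose2[OF f] continuous_on_compose2[OF kd(6)]
          continuous_on_compose2[OF kd(3)] pc) auto
    then show "continuous_on (U \<times> cbox (-a) a) (\<lambda>(\<tau>, y). K' \<tau> y)"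
      by (simp add: case_prod_unfold)
  qed
  have at: "at 0 within U = (at 0 :: real filter)"
    unfolding U_def using \<delta> by (intro at_within_Icc_at) auto
  have eqK: "moll f k (x + \<tau> *\<^sub>R e) (t \<tau>) = integral (cbox (-a) a) (K \<tau>)" if "\<tau> \<in> U" for \<tau>
    unfolding K_def p_def
    by (rule moll_eq_convolution[OF f kd(6) kd(4) _ B kd(1) a]) (use that tp U in auto)
  have t00: "0 < t 0" using tp \<delta> by auto
  define k2 where "k2 w = (1 / t 0) * (dk w \<bullet> e - t' 0 * (real ?D * k w + dk w \<bullet> w))" for w
  have "integral (cbox (-a) a) (K' 0) = moll f k2 x (t 0)"
  proof -
    have "moll f k2 x (t 0) = integral (cbox (-a) a) (\<lambda>y. f y * (k2 ((1 / t 0) *\<^sub>R (x - y)) / t 0 ^ ?D))"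
      by (rule moll_eq_convolution[OF f _ _ t00 _ kd(1) a])
        (use B[OF U0(1)] t00 in \<open>auto simp: k2_def kd(4,5) intro!: continuous_intros kd\<close>)
    also have "\<dots> = integral (cbox (-a) a) (K' 0)"
      by (intro integral_cong) (simp add: K'_def k2_def p_def)
    finally show ?thesis by simp
  qed
  also have "moll f k2 x (t 0) = (1 / t 0) * (moll f (\<lambda>w. dk w \<bullet> e) x (t 0)
        - t' 0 * moll f (\<lambda>w. real ?D * k w + dk w \<bullet> w) x (t 0))"
  proof -
    have i1: "(\<lambda>w. (dk w \<bullet> e) * f (x - t 0 *\<^sub>R w)) integrable_on UNIV"
      by (rule moll_integrable[OF f, where R = R]) (auto intro!: continuous_intros kd simp: kd(5))
    have i2: "(\<lambda>w. (real ?D * k w + dk w \<bullet> w) * f (x - t 0 *\<^sub>R w)) integrable_on UNIV"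
      by (rule moll_integrable[OF f, where R = R]) (auto intro!: continuous_intros kd simp: kd(4,5))
    have "moll f k2 x (t 0) = integral UNIV (\<lambda>w. (1 / t 0) * ((dk w \<bullet> e) * f (x - t 0 *\<^sub>R w)
        - t' 0 * ((real ?D * k w + dk w \<bullet> w) * f (x - t 0 *\<^sub>R w))))"
      unfolding moll_def k2_def by (intro integral_cong) (simp add: algebra_simps)
    also have "\<dots> = (1 / t 0) * (moll f (\<lambda>w. dk w \<bullet> e) x (t 0)
        - t' 0 * moll f (\<lambda>w. real ?D * k w + dk w \<bullet> w) x (t 0))"
      unfolding moll_def
      by (simp only: integral_mult_right integral_diff[OF i1 integrable_on_mult_right[OF i2]])
    finally show ?thesis .
  qed
  finally have I: "integral (cbox (-a) a) (K' 0) = (1 / t 0) * (moll f (\<lambda>w. dk w \<bullet> e) x (t 0)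
        - t' 0 * moll f (\<lambda>w. real ?D * k w + dk w \<bullet> w) x (t 0))" .
  have "((\<lambda>\<tau>. moll f k (x + \<tau> *\<^sub>R e) (t \<tau>)) has_field_derivative integral (cbox (-a) a) (K' 0)) (at 0 within U)"
    by (rule has_field_derivative_transform_within[OF main, of 1]) (use U0 eqK in auto)
  then show ?thesis unfolding at I .
qed

section \<open>Kernels of mean zero\<close>

lemma moll_one: "moll (\<lambda>x. 1) k x t = integral UNIV k"
  by (simp add: moll_def)

text \<open>The mollification of the constant 1 does not depend on its centre; its derivative in the
  direction \<open>e\<close>, computed by \<open>moll_has_derivative\<close>, is this integral. This
  takes the place of an integration by parts.\<close>

lemma integral_kernel_deriv:
  fixes k :: "real^'n \<Rightarrow> real"
  assumes "C1_kernel k dk R"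
  shows "integral UNIV (\<lambda>w. dk w \<bullet> e) = 0"
proof -
  have "((\<lambda>\<tau>. moll (\<lambda>x. 1) k (0 + \<tau> *\<^sub>R e) 1) has_real_derivative
     (1 / 1) * (moll (\<lambda>x. 1) (\<lambda>w. dk w \<bullet> e) 0 1
        - 0 * moll (\<lambda>x. 1) (\<lambda>w. real CARD('n) * k w + dk w \<bullet> w) 0 1)) (at 0)"
    by (rule moll_has_derivative[OF _ assms, where \<delta> = 1 and t' = "\<lambda>_. 0"]) (auto intro!: continuous_intros)
  then have "((\<lambda>\<tau>::real. integral UNIV k) has_real_derivative integral UNIV (\<lambda>w. dk w \<bullet> e)) (at 0)"
    by (simp add: moll_one)
  then show ?thesis using DERIV_unique DERIV_const by blast
qed

text \<open>The same argument in the scale instead of the centre. The integrand is the divergence of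
  \<open>k w *\<^sub>R w\<close>.\<close>

lemma integral_kernel_euler:
  fixes k :: "real^'n \<Rightarrow> real"
  assumes "C1_kernel k dk R"
  shows "integral UNIV (\<lambda>w. real CARD('n) * k w + dk w \<bullet> w) = 0"
proof -
  have "((\<lambda>\<tau>. moll (\<lambda>x. 1) k (0 + \<tau> *\<^sub>R 0) (1 + \<tau>)) has_real_derivative
     (1 / (1 + 0)) * (moll (\<lambda>x. 1) (\<lambda>w. dk w \<bullet> 0) 0 (1 + 0)
        - 1 * moll (\<lambda>x. 1) (\<lambda>w. real CARD('n) * k w + dk w \<bullet> w) 0 (1 + 0))) (at 0)"
    by (rule moll_has_derivative[OF _ assms, where \<delta> = 1 and t' = "\<lambda>_. 1"])
      (auto intro!: continuous_intros derivative_eq_intros)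
  then have "((\<lambda>\<tau>::real. integral UNIV k) has_real_derivative - integral UNIV (\<lambda>w. real CARD('n) * k w + dk w \<bullet> w)) (at 0)"
    by (simp add: moll_one)
  then show ?thesis using DERIV_unique DERIV_const by fastforce
qed

subsection \<open>Bump functions\<close>

text \<open>The outer square makes this \<open>C^1\<close> with a Lipschitz gradient, the regularity
  that the kernels and cut-offs below have to provide; it and its gradient \<open>dbump\<close> are
  explicit.\<close>

definition bump :: "real^'n \<Rightarrow> real \<Rightarrow> real^'n \<Rightarrow> real" where
  "bump c r x = (max 0 (r\<^sup>2 - (norm (x - c))\<^sup>2))\<^sup>2"

definition dbump :: "real^'n \<Rightarrow> real \<Rightarrow> real^'n \<Rightarrow> real^'n" where
  "dbump c r x = (- 4 * max 0 (r\<^sup>2 - (norm (x - c))\<^sup>2)) *\<^sub>R (x - c)"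

lemma bump_nonneg: "0 \<le> bump c r x"
  by (simp add: bump_def)

lemma bump_pos: "norm (x - c) < r \<Longrightarrow> 0 < bump c r x"
  unfolding bump_def by (intro zero_less_power) (simp add: power_strict_mono less_max_iff_disj)

lemma bump_eq_0: "0 \<le> r \<Longrightarrow> r \<le> norm (x - c) \<Longrightarrow> bump c r x = 0"
  unfolding bump_def using power_mono[of r "norm (x - c)" 2] by (simp add: max_def)

lemma dbump_eq_0: "0 \<le> r \<Longrightarrow> r \<le> norm (x - c) \<Longrightarrow> dbump c r x = 0"
  unfolding dbump_def using power_mono[of r "norm (x - c)" 2] by (simp add: max_def)

lemma bump_translate: "bump c r (x - y) = bump (y + c) r x"
  by (simp add: bump_def algebra_simps)

lemma has_real_derivative_max0_power2:
  "((\<lambda>s::real. (max 0 s)\<^sup>2) has_real_derivative 2 * max 0 s) (at s)"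
proof -
  consider "s < 0" | "s = 0" | "0 < s" by linarith
  then show ?thesis
  proof cases
    case 1
    have "((\<lambda>s::real. 0) has_real_derivative 0) (at s)" by simp
    then have "((\<lambda>s::real. (max 0 s)\<^sup>2) has_real_derivative 0) (at s)"
      by (rule has_field_derivative_transform_within_open[where S = "{..<0}"]) (use 1 in auto)
    then show ?thesis using 1 by simp
  next
    case 2
    have "((\<lambda>h. (max 0 h)\<^sup>2 / h) \<longlongrightarrow> 0) (at (0::real))"
    proof (rule Lim_null_comparison)
      show "\<forall>\<^sub>F h in at 0. norm ((max 0 h)\<^sup>2 / h) \<le> \<bar>h\<bar>"
        by (intro always_eventually allI) (auto simp: max_def power2_eq_square)
      show "((\<lambda>h::real. \<bar>h\<bar>) \<longlongrightarrow> 0) (at 0)"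
        by (intro tendsto_rabs_zero tendsto_ident_at)
    qed
    then show ?thesis using 2 by (simp add: DERIV_def)
  next
    case 3
    have "((\<lambda>s::real. s\<^sup>2) has_real_derivative 2 * s) (at s)"
      by (auto intro!: derivative_eq_intros)
    then have "((\<lambda>s::real. (max 0 s)\<^sup>2) has_real_derivative 2 * s) (at s)"
      by (rule has_field_derivative_transform_within_open[where S = "{0<..}"]) (use 3 in auto)
    then show ?thesis using 3 by simp
  qed
qed

lemma bump_has_derivative: "(bump c r has_derivative (\<lambda>v. dbump c r x \<bullet> v)) (at x)"
proof -
  have "((\<lambda>x. r\<^sup>2 - (x - c) \<bullet> (x - c)) has_derivative (\<lambda>v. - 2 * ((x - c) \<bullet> v))) (at x)"
    by (auto intro!: derivative_eq_intros simp: inner_commute)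
  from has_derivative_compose[OF this has_real_derivative_max0_power2[unfolded has_field_derivative_def]]
  show ?thesis
    unfolding bump_def dbump_def power2_norm_eq_inner
    by (simp add: mult_ac fun_eq_iff)
qed

lemma max0_lipschitz:
  fixes a b r :: real
  assumes "0 \<le> r" and that: "0 \<le> a" "0 \<le> b"
  shows "\<bar>max 0 (r\<^sup>2 - a\<^sup>2) - max 0 (r\<^sup>2 - b\<^sup>2)\<bar> \<le> 2 * r * \<bar>a - b\<bar>"
proof -
  \<comment> \<open>Truncating the value at 0 amounts to truncating the argument at
    \<open>r\<close>, and on \<open>{0..r}\<close> the slope of the square is at most
    \<open>2 * r\<close>.\<close>
  have m: "max 0 (r\<^sup>2 - u\<^sup>2) = r\<^sup>2 - (min r u)\<^sup>2" if "0 \<le> u" for u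
  proof (cases "u \<le> r")
    case True then show ?thesis using that power_mono[of u r 2] by (simp add: min_def max_def)
  next
    case False then show ?thesis using assms power_mono[of r u 2] by (simp add: min_def max_def)
  qed
  have "\<bar>(min r b)\<^sup>2 - (min r a)\<^sup>2\<bar> = \<bar>min r b - min r a\<bar> * \<bar>min r b + min r a\<bar>"
    by (simp add: power2_eq_square abs_mult[symmetric] algebra_simps)
  also have "\<dots> \<le> \<bar>a - b\<bar> * (2 * r)"
    using that assms by (intro mult_mono) auto
  finally show ?thesis using m[OF that(1)] m[OF that(2)] by (simp add: mult_ac)
qed

lemma max0_quadratic_holder:
  fixes c :: "real^'n"
  assumes r: "0 < r"
  shows "holder_bd 1 (r\<^sup>2 + 2 * r) UNIV (\<lambda>x. max 0 (r\<^sup>2 - (norm (x - c))\<^sup>2))"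
  unfolding holder_bd_one_iff
proof (intro conjI ballI)
  let ?m = "\<lambda>x. max 0 (r\<^sup>2 - (norm (x - c))\<^sup>2)" and ?M = "r\<^sup>2 + 2 * r"
  fix x y
  have "r\<^sup>2 - (norm (x - c))\<^sup>2 \<le> ?M" "0 \<le> ?M" using r by (simp_all add: add_increasing2 diff_le_eq)
  then show "\<bar>?m x\<bar> \<le> ?M" by simp
  have "\<bar>?m x - ?m y\<bar> \<le> 2 * r * \<bar>norm (x - c) - norm (y - c)\<bar>"
    using r by (intro max0_lipschitz) auto
  also have "\<dots> \<le> 2 * r * norm (x - y)"
    using r norm_triangle_ineq3[of "x - c" "y - c"] by (intro mult_left_mono) auto
  also have "\<dots> \<le> ?M * norm (x - y)" by (intro mult_right_mono) auto
  finally show "\<bar>?m x - ?m y\<bar> \<le> ?M * norm (x - y)" .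
qed

text \<open>The factor \<open>x - c\<close> is unbounded on the whole space, but
  \<open>holder_bd_mult\<close> asks for it only where the truncated quadratic is nonzero, that is,
  inside the ball.\<close>

lemma dbump_holder:
  fixes c :: "real^'n"
  assumes r: "0 < r"
  shows "\<exists>L\<ge>0. \<forall>i. holder_bd 1 L UNIV (\<lambda>x. dbump c r x $ i)"
proof -
  define m where "m x = max 0 (r\<^sup>2 - (norm (x - c))\<^sup>2)" for x
  define M where "M = r\<^sup>2 + 2 * r"
  \<comment> \<open>Room for the bound \<open>r\<close> of the factor \<open>x - c\<close> and for
    its Lipschitz constant 1.\<close>
  define N where "N = r + 1"
  have MN: "0 \<le> M" "0 \<le> N" using r by (auto simp: M_def N_def)
  have m: "holder_bd 1 M UNIV m" unfolding m_def[abs_def] M_def by (rule max0_quadratic_holder[OF r])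
  have i: "holder_bd 1 (\<bar>-4\<bar> * (2 * M * N)) UNIV (\<lambda>x. -4 * (m x * (x - c) $ i))" for i
  proof (intro holder_bd_cmult holder_bd_mult[OF m _ MN])
    show "holder_bd 1 N (UNIV \<inter> {x. m x \<noteq> 0}) (\<lambda>x. (x - c) $ i)"
      unfolding holder_bd_one_iff
    proof (intro conjI ballI)
      fix x y assume x: "x \<in> UNIV \<inter> {x. m x \<noteq> 0}"
      then have "norm (x - c) < r"
        using r power_mono[of r "norm (x - c)" 2] by (cases "r \<le> norm (x - c)") (auto simp: m_def)
      then show "\<bar>(x - c) $ i\<bar> \<le> N" using component_le_norm_cart[of "x - c" i] by (simp add: N_def)
      have "\<bar>(x - c) $ i - (y - c) $ i\<bar> \<le> norm (x - y)"
        using component_le_norm_cart[of "x - y" i] by simp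
      also have "\<dots> \<le> N * norm (x - y)" using r by (simp add: N_def algebra_simps)
      finally show "\<bar>(x - c) $ i - (y - c) $ i\<bar> \<le> N * norm (x - y)" .
    qed
  qed
  have "holder_bd 1 (\<bar>-4\<bar> * (2 * M * N)) UNIV (\<lambda>x. dbump c r x $ i)" for i
    using i[of i] by (simp add: dbump_def m_def mult.assoc)
  moreover have "0 \<le> \<bar>-4\<bar> * (2 * M * N)" using MN by simp
  ultimately show ?thesis by blast
qed

lemma holder_bd_componentwise_continuous:
  fixes g :: "'a::real_normed_vector \<Rightarrow> real^'n"
  assumes "\<And>i. holder_bd a L S (\<lambda>x. g x $ i)" "0 < a"
  shows "continuous_on S g"
  using continuous_on_vec_lambda[of S "\<lambda>i x. g x $ i"] holder_bd_continuous_on[OF assms] by simp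

lemma continuous_on_dbump: "0 < r \<Longrightarrow> continuous_on UNIV (dbump c r)"
  using dbump_holder[of r c] by (auto intro: holder_bd_componentwise_continuous[of 1])

lemma bump_kernel:
  fixes c :: "real^'n"
  shows "0 < r \<Longrightarrow> C1_kernel (bump c r) (dbump c r) (norm c + r)"
  unfolding C1_kernel_def
proof (intro conjI allI impI bump_has_derivative continuous_on_dbump)
  fix w :: "real^'n" assume r: "0 < r" and "norm c + r < norm w"
  moreover have "norm w \<le> norm c + norm (w - c)" by (rule norm_triangle_sub)
  ultimately have "r \<le> norm (w - c)" by linarith
  then show "bump c r w = 0" "dbump c r w = 0" using r by (auto intro: bump_eq_0 dbump_eq_0)
qed auto

lemma continuous_on_bump: "continuous_on S (bump c r)"
  by (rule has_derivative_continuous_on[OF has_derivative_at_withinI[OF bump_has_derivative]])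

lemma bump_holder:
  fixes c :: "real^'n"
  assumes r: "0 < r"
  shows "\<exists>L\<ge>0. holder_bd 1 L UNIV (bump c r)"
proof -
  define m where "m x = max 0 (r\<^sup>2 - (norm (x - c))\<^sup>2)" for x
  define M where "M = r\<^sup>2 + 2 * r"
  have M: "0 \<le> M" using r by (simp add: M_def)
  have m: "holder_bd 1 M UNIV m" unfolding m_def[abs_def] M_def by (rule max0_quadratic_holder[OF r])
  have "holder_bd 1 (2 * M * M) UNIV (\<lambda>x. m x * m x)"
    by (intro holder_bd_mult M holder_bd_subset[OF m]) (use m in auto)
  then show ?thesis using M by (intro exI[of _ "2 * M * M"]) (simp add: bump_def[abs_def] m_def power2_eq_square)
qed

definition bump_mass :: "real^'n \<Rightarrow> real \<Rightarrow> real" where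
  "bump_mass c r = integral UNIV (bump c r)"

lemma bump_mass_pos:
  fixes c :: "real^'n"
  assumes "0 < r"
  shows "0 < bump_mass c r"
proof -
  note k = bump_kernel[OF assms, of c]
  obtain a :: "real^'n" where a: "cball 0 (norm c + r) \<subseteq> cbox (-a) a"
    using cball_subset_symmetric_cbox by blast
  then have z: "\<And>x. x \<notin> cbox (-a) a \<Longrightarrow> bump c r x = 0" using C1_kernelD(4)[OF k] by force
  have I: "(bump c r has_integral integral (cbox (-a) a) (bump c r)) UNIV"
    by (rule has_integral_compact_support[OF continuous_on_bump z])
  have c: "c \<in> cbox (-a) a" using a assms by force
  have ne: "box (-a) a \<noteq> {}"
  proof -
    have "ball 0 (norm c + r) \<subseteq> cbox (-a) a" using a ball_subset_cball by blast
    then have "ball 0 (norm c + r) \<subseteq> box (-a) a" using interior_maximal[OF _ open_ball] interior_cbox by blast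
    then show ?thesis using assms by (metis (no_types) add_nonneg_pos ball_eq_empty norm_ge_zero not_le subset_empty)
  qed
  have "integral (cbox (-a) a) (bump c r) \<noteq> 0"
  proof
    assume "integral (cbox (-a) a) (bump c r) = 0"
    moreover have "(bump c r has_integral integral (cbox (-a) a) (bump c r)) (cbox (-a) a)"
      by (intro integrable_integral integrable_continuous continuous_on_bump)
    ultimately have "bump c r c = 0"
      by (intro has_integral_0_cbox_imp_0[OF continuous_on_bump bump_nonneg _ ne c]) auto
    then show False using bump_pos[of c c r] assms by simp
  qed
  moreover have "0 \<le> integral (cbox (-a) a) (bump c r)"
    by (intro integral_nonneg integrable_continuous continuous_on_bump bump_nonneg)
  ultimately show ?thesis using integral_unique[OF I] by (simp add: bump_mass_def)
qed

definition nbump :: "real^'n \<Rightarrow> real \<Rightarrow> real^'n \<Rightarrow> real" where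
  "nbump c r x = bump c r x / bump_mass c r"

definition dnbump :: "real^'n \<Rightarrow> real \<Rightarrow> real^'n \<Rightarrow> real^'n" where
  "dnbump c r x = (1 / bump_mass c r) *\<^sub>R dbump c r x"

lemma nbump_kernel: "0 < r \<Longrightarrow> C1_kernel (nbump c r) (dnbump c r) (norm c + r)"
proof -
  assume r: "0 < r"
  note k = bump_kernel[OF r, of c]
  show ?thesis
    unfolding C1_kernel_def
  proof (intro conjI allI impI)
    fix w
    have "((\<lambda>w. (1 / bump_mass c r) * bump c r w) has_derivative (\<lambda>v. (1 / bump_mass c r) * (dbump c r w \<bullet> v))) (at w)"
      by (intro has_derivative_mult_right bump_has_derivative)
    then show "(nbump c r has_derivative (\<lambda>v. dnbump c r w \<bullet> v)) (at w)"
      by (simp add: nbump_def[abs_def] dnbump_def)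
    show "continuous_on UNIV (dnbump c r)"
      unfolding dnbump_def by (intro continuous_intros continuous_on_dbump r)
  qed (use C1_kernelD(1,4,5)[OF k] in \<open>auto simp: nbump_def dnbump_def\<close>)
qed

lemma integral_nbump: "0 < r \<Longrightarrow> integral UNIV (nbump c r) = 1"
  using bump_mass_pos[of r c] by (simp add: nbump_def[abs_def] bump_mass_def)

lemma nbump_eq_0: "0 < r \<Longrightarrow> r \<le> norm (x - c) \<Longrightarrow> nbump c r x = 0"
  by (simp add: nbump_def bump_eq_0)

lemma bump_mass_translate:
  fixes c y :: "real^'n"
  assumes "0 < r"
  shows "bump_mass (y + c) r = bump_mass c r"
proof -
  have "integral UNIV (\<lambda>x. bump c r (1 *\<^sub>R x + (-y))) = integral UNIV (bump c r) / \<bar>1\<bar> ^ DIM(real^'n)"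
    for c :: "real^'n"
    by (rule integral_affine_compact_support[OF continuous_on_bump, where B = "norm c + r"])
      (use C1_kernelD(4)[OF bump_kernel[OF assms]] in auto)
  from this[of c] show ?thesis by (simp add: bump_mass_def bump_translate[abs_def])
qed

lemma nbump_translate: "0 < r \<Longrightarrow> nbump c r (x - y) = nbump (y + c) r x"
  by (simp add: nbump_def bump_translate bump_mass_translate)

lemma nbump_holder:
  fixes c :: "real^'n"
  assumes r: "0 < r"
  shows "\<exists>L\<ge>0. holder_bd 1 L UNIV (nbump c r)"
proof -
  obtain L where L: "0 \<le> L" "holder_bd 1 L UNIV (bump c r)" using bump_holder[OF r] by blast
  have "holder_bd 1 (\<bar>1 / bump_mass c r\<bar> * L) UNIV (\<lambda>x. 1 / bump_mass c r * bump c r x)"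
    by (intro holder_bd_cmult L)
  then show ?thesis using L(1) by (intro exI[of _ "\<bar>1 / bump_mass c r\<bar> * L"]) (auto simp: nbump_def[abs_def])
qed

lemma dnbump_holder:
  fixes c :: "real^'n"
  assumes r: "0 < r"
  shows "\<exists>L\<ge>0. \<forall>i. holder_bd 1 L UNIV (\<lambda>x. dnbump c r x $ i)"
proof -
  obtain L where L: "0 \<le> L" "\<And>i. holder_bd 1 L UNIV (\<lambda>x. dbump c r x $ i)"
    using dbump_holder[OF r] by blast
  have "holder_bd 1 (\<bar>1 / bump_mass c r\<bar> * L) UNIV (\<lambda>x. 1 / bump_mass c r * dbump c r x $ i)" for i
    by (intro holder_bd_cmult L)
  then show ?thesis using L(1) by (intro exI[of _ "\<bar>1 / bump_mass c r\<bar> * L"]) (auto simp: dnbump_def[abs_def])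
qed

subsection \<open>Defining functions of the boundary\<close>

text \<open>\<open>Ck_on\<close> speaks of partial derivatives only, whereas composing with an
  orthogonal map calls for the total derivative. The increment is split into steps along the axes,
  each controlled by the mean value inequality.\<close>

lemma has_derivative_of_continuous_partials:
  fixes f :: "real^'n \<Rightarrow> real" and d :: "'n \<Rightarrow> real^'n \<Rightarrow> real"
  assumes der: "\<And>i x. ((\<lambda>t. f (x + t *\<^sub>R axis i 1)) has_real_derivative d i x) (at 0)"
    and cont: "\<And>i. continuous_on UNIV (d i)"
  shows "(f has_derivative (\<lambda>v. (\<chi> i. d i x) \<bullet> v)) (at x)"
  unfolding has_derivative_at_alt
proof (intro conjI allI impI)
  show "bounded_linear (\<lambda>v. (\<chi> i. d i x) \<bullet> v)" by (rule bounded_linear_inner_right)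
  fix \<epsilon> :: real assume \<epsilon>: "0 < \<epsilon>"
  \<comment> \<open>The errors of the \<open>n\<close> steps add up to at most
    \<open>e * n * norm v\<close>.\<close>
  define e where "e = \<epsilon> / real CARD('n)"
  have e: "0 < e" using \<epsilon> by (simp add: e_def)
  have "\<forall>\<^sub>F y in nhds x. \<forall>i\<in>UNIV. dist (d i y) (d i x) < e"
  proof (intro eventually_ball_finite ballI)
    fix i
    have "isCont (d i) x" using cont by (simp add: continuous_on_eq_continuous_at)
    then have "(d i \<longlongrightarrow> d i x) (nhds x)" by (simp add: isCont_def tendsto_at_iff_tendsto_nhds)
    then show "\<forall>\<^sub>F y in nhds x. dist (d i y) (d i x) < e" using e by (rule tendstoD)
  qed simp
  then obtain \<delta> where \<delta>: "0 < \<delta>" and close: "\<And>y i. dist y x < \<delta> \<Longrightarrow> \<bar>d i y - d i x\<bar> < e"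
    unfolding eventually_nhds_metric by (auto simp: dist_real_def)
  show "\<exists>\<delta>>0. \<forall>y. norm (y - x) < \<delta> \<longrightarrow> norm (f y - f x - (\<chi> i. d i x) \<bullet> (y - x)) \<le> \<epsilon> * norm (y - x)"
  proof (intro exI[of _ \<delta>] conjI \<delta> allI impI)
    fix y assume y: "norm (y - x) < \<delta>"
    define v where "v = y - x"
    \<comment> \<open>\<open>z A\<close> has the coordinates of \<open>y\<close> in \<open>A\<close>
      and those of \<open>x\<close> elsewhere. Adding one index at a time turns the usual path along
      the axes into an induction over finite sets, which suits an unordered index type.\<close>
    define z where "z A = x + (\<Sum>i\<in>A. v $ i *\<^sub>R axis i 1)" for A
    have zc: "(\<Sum>i\<in>A. v $ i *\<^sub>R axis i 1) $ k = (if k \<in> A then v $ k else 0)" for A :: "'n set" and k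
      by (simp add: axis_def if_distrib[of "\<lambda>u. _ * u"] sum.delta' cong: if_cong)
    have step: "\<bar>f (z (insert j A)) - f (z A) - d j x * v $ j\<bar> \<le> e * \<bar>v $ j\<bar>" if j: "j \<notin> A" for j A
    proof -
      let ?S = "closed_segment 0 (v $ j)"
      have zj: "z (insert j A) = z A + (v $ j) *\<^sub>R axis j 1" using j by (simp add: z_def add_ac)
      have "norm ((f (z A + (v $ j) *\<^sub>R axis j 1) - d j x * v $ j) - (f (z A + 0 *\<^sub>R axis j 1) - d j x * 0))
          \<le> e * norm (v $ j - 0)"
      proof (rule field_differentiable_bound[of ?S "\<lambda>t. f (z A + t *\<^sub>R axis j 1) - d j x * t"
            "\<lambda>t. d j (z A + t *\<^sub>R axis j 1) - d j x"])
        fix t assume t: "t \<in> ?S"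
        have "((\<lambda>s. f (z A + (s + t) *\<^sub>R axis j 1)) has_real_derivative d j (z A + t *\<^sub>R axis j 1)) (at 0)"
          using der[of "z A + t *\<^sub>R axis j 1" j] by (simp add: scaleR_left_distrib add_ac)
        then have "((\<lambda>s. f (z A + s *\<^sub>R axis j 1)) has_real_derivative d j (z A + t *\<^sub>R axis j 1)) (at t)"
          using DERIV_shift[of "\<lambda>s. f (z A + s *\<^sub>R axis j 1)" _ 0 t] by simp
        then show "((\<lambda>t. f (z A + t *\<^sub>R axis j 1) - d j x * t) has_field_derivative
            d j (z A + t *\<^sub>R axis j 1) - d j x) (at t within ?S)"
          by (auto intro!: derivative_eq_intros intro: has_field_derivative_at_within)
        have tv: "\<bar>t\<bar> \<le> \<bar>v $ j\<bar>" using t by (auto simp: closed_segment_eq_real_ivl split: if_splits)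
        have "norm (z A + t *\<^sub>R axis j 1 - x) \<le> norm v"
        proof (rule norm_le_componentwise_cart)
          fix k
          have "(z A + t *\<^sub>R axis j 1 - x) $ k = (if k \<in> A then v $ k else 0) + (if k = j then t else 0)"
            using zc[of A k] by (simp add: z_def axis_def)
          then show "norm ((z A + t *\<^sub>R axis j 1 - x) $ k) \<le> norm (v $ k)" using tv j by auto
        qed
        then show "norm (d j (z A + t *\<^sub>R axis j 1) - d j x) \<le> e"
          using close[of "z A + t *\<^sub>R axis j 1" j] y by (simp add: dist_norm v_def)
      qed auto
      then show ?thesis unfolding zj by simp
    qed
    have "\<bar>f (z A) - f x - (\<Sum>i\<in>A. d i x * v $ i)\<bar> \<le> e * (\<Sum>i\<in>A. \<bar>v $ i\<bar>)" if "finite A" for A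
      using that
    proof (induction A rule: finite_induct)
      case empty then show ?case by (simp add: z_def)
    next
      case (insert j A)
      then show ?case using step[of j A] by (simp add: algebra_simps)
    qed
    from this[of UNIV] have "\<bar>f (z UNIV) - f x - (\<Sum>i\<in>UNIV. d i x * v $ i)\<bar> \<le> e * (\<Sum>i\<in>UNIV. \<bar>v $ i\<bar>)"
      by simp
    moreover have "z UNIV = y"
    proof (rule vec_eq_iff[THEN iffD2], rule allI)
      show "z UNIV $ k = y $ k" for k
        using zc[of UNIV k] by (simp only: z_def vector_add_component) (simp add: v_def)
    qed
    moreover have "e * (\<Sum>i\<in>UNIV. \<bar>v $ i\<bar>) \<le> e * (real CARD('n) * norm v)"
      using e sum_bounded_above[of UNIV "\<lambda>i. \<bar>v $ i\<bar>" "norm v"] component_le_norm_cart[of v]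
      by (intro mult_left_mono) auto
    ultimately show "norm (f y - f x - (\<chi> i. d i x) \<bullet> (y - x)) \<le> \<epsilon> * norm (y - x)"
      by (simp add: e_def v_def inner_vec_def)
  qed
qed

lemma C1_imp_lipschitz:
  fixes g :: "real^'n \<Rightarrow> real"
  assumes d: "\<And>x. (g has_derivative (\<lambda>v. dg x \<bullet> v)) (at x)" and c: "continuous_on UNIV dg"
  shows "\<exists>L\<ge>0. holder_bd 1 L (cball x0 r) g"
proof -
  have "compact (dg ` cball x0 r)"
    by (intro compact_continuous_image continuous_on_subset[OF c]) auto
  then have "bounded (dg ` cball x0 r)" by (rule compact_imp_bounded)
  then obtain A where A: "0 < A" "\<And>x. x \<in> cball x0 r \<Longrightarrow> norm (dg x) \<le> A"
    unfolding bounded_pos by auto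
  have cg: "continuous_on UNIV g"
    by (rule has_derivative_continuous_on[OF has_derivative_at_withinI[OF d]])
  have "compact (g ` cball x0 r)"
    by (intro compact_continuous_image continuous_on_subset[OF cg]) auto
  then have "bounded (g ` cball x0 r)" by (rule compact_imp_bounded)
  then obtain B where B: "0 < B" "\<And>x. x \<in> cball x0 r \<Longrightarrow> norm (g x) \<le> B"
    unfolding bounded_pos by auto
  have "\<bar>g x - g y\<bar> \<le> A * norm (x - y)" if xy: "x \<in> cball x0 r" "y \<in> cball x0 r" for x y
  proof -
    have "norm (g x - g y) \<le> A * norm (x - y)"
    proof (rule differentiable_bound[OF convex_cball _ _ xy])
      fix z assume z: "z \<in> cball x0 r"
      show "(g has_derivative (\<lambda>v. dg z \<bullet> v)) (at z within cball x0 r)"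
        by (rule has_derivative_at_withinI[OF d])
      show "onorm (\<lambda>v. dg z \<bullet> v) \<le> A"
      proof (rule onorm_le)
        fix v
        have "norm (dg z \<bullet> v) \<le> norm (dg z) * norm v" using Cauchy_Schwarz_ineq2[of "dg z" v] by simp
        also have "\<dots> \<le> A * norm v" by (intro mult_right_mono A z) auto
        finally show "norm (dg z \<bullet> v) \<le> A * norm v" .
      qed
    qed
    then show ?thesis by simp
  qed
  moreover have "A * norm (x - y) \<le> (A + B) * norm (x - y)" for x y :: "real^'n"
    using B by (intro mult_right_mono) auto
  ultimately have lip: "\<bar>g x - g y\<bar> \<le> (A + B) * norm (x - y)" if "x \<in> cball x0 r" "y \<in> cball x0 r" for x y
    using that order_trans by blast
  have "holder_bd 1 (A + B) (cball x0 r) g"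
    unfolding holder_bd_one_iff
  proof (intro conjI ballI lip)
    fix x assume "x \<in> cball x0 r"
    then show "\<bar>g x\<bar> \<le> A + B" using B(2)[of x] A(1) by simp
  qed
  then show ?thesis using A(1) B(1) by (intro exI[of _ "A + B"]) auto
qed

lemma Ck_on_Suc_partials:
  assumes "Ck_on (Suc k) UNIV h"
  shows "((\<lambda>t. h (x + t *\<^sub>R axis i 1)) has_real_derivative partial_deriv i h x) (at 0)"
    and "Ck_on k UNIV (partial_deriv i h)"
proof -
  have "(\<lambda>t. h (x + t *\<^sub>R axis i 1)) differentiable (at 0)" using assms by simp
  then show "((\<lambda>t. h (x + t *\<^sub>R axis i 1)) has_real_derivative partial_deriv i h x) (at 0)"
    unfolding partial_deriv_def
    by (simp add: DERIV_deriv_iff_real_differentiable)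
qed (use assms in simp)

lemma Ck_on_imp_continuous: "Ck_on k S h \<Longrightarrow> continuous_on S h"
  by (cases k) auto

lemma Ck_on_imp_has_derivative:
  assumes "Ck_on (Suc k) UNIV h"
  shows "(h has_derivative (\<lambda>v. (\<chi> i. partial_deriv i h x) \<bullet> v)) (at x)"
  by (rule has_derivative_of_continuous_partials[OF Ck_on_Suc_partials(1)[OF assms]])
    (rule Ck_on_imp_continuous[OF Ck_on_Suc_partials(2)[OF assms]])

text \<open>
  The defining function \<open>\<rho>\<close> is normalised so that it grows at unit speed in the direction \<open>e\<close>,
  the vertical direction of the graph representation.
\<close>

definition boundary_chart ::
    "(real^'n) set \<Rightarrow> real^'n \<Rightarrow> real \<Rightarrow> real^'n \<Rightarrow> (real^'n \<Rightarrow> real) \<Rightarrow> (real^'n \<Rightarrow> real^'n) \<Rightarrow> real \<Rightarrow> bool" where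
  "boundary_chart \<Omega> x0 r e \<rho> d\<rho> L \<longleftrightarrow> 0 < r \<and> 0 \<le> L \<and> norm e = 1 \<and>
     (\<forall>x t. \<rho> (x + t *\<^sub>R e) = \<rho> x + t) \<and>
     (\<forall>x. (\<rho> has_derivative (\<lambda>v. d\<rho> x \<bullet> v)) (at x)) \<and> continuous_on UNIV d\<rho> \<and>
     holder_bd 1 L (ball x0 r) \<rho> \<and> (\<forall>j. holder_bd 1 L (ball x0 r) (\<lambda>x. d\<rho> x $ j)) \<and>
     \<Omega> \<inter> ball x0 r = {x \<in> ball x0 r. 0 < \<rho> x}"

text \<open>\<rho> is the height above the graph, \<open>T x $ i - h (T x)\<close>. As
  \<open>h\<close> ignores the \<open>i\<close>-th coordinate, moving along the preimage
  \<open>e\<close> of that axis changes the height at unit speed. The second derivatives of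
  \<open>h\<close> are bounded on a ball, which makes the gradient Lipschitz there.\<close>

lemma boundary_chart_exists:
  fixes \<Omega> :: "(real^'n) set"
  assumes "Ck_boundary 2 \<Omega>" and "x0 \<in> frontier \<Omega>"
  shows "\<exists>r e \<rho> d\<rho> L. boundary_chart \<Omega> x0 r e \<rho> d\<rho> L"
proof -
  obtain r and T :: "real^'n \<Rightarrow> real^'n" and i h where r: "0 < r" and T: "orthogonal_transformation T"
    and h: "Ck_on 2 UNIV h" and hi: "\<And>x y. (\<forall>j. j \<noteq> i \<longrightarrow> x $ j = y $ j) \<Longrightarrow> h x = h y"
    and \<Omega>: "\<Omega> \<inter> ball x0 r = {x \<in> ball x0 r. T x $ i > h (T x)}"
    using assms unfolding Ck_boundary_def by blast
  have h2: "Ck_on (Suc (Suc 0)) UNIV h" using h by (simp only: numeral_2_eq_2)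
  define gh where "gh x = (\<chi> k. partial_deriv k h x)" for x
  have hd: "(h has_derivative (\<lambda>v. gh x \<bullet> v)) (at x)" for x
    unfolding gh_def by (rule Ck_on_imp_has_derivative[OF h2])
  have ghc: "continuous_on UNIV gh"
    unfolding gh_def by (intro continuous_on_vec_lambda Ck_on_imp_continuous[OF Ck_on_Suc_partials(2)[OF h2]])
  have Tl: "linear T" using T by (rule orthogonal_transformation_linear)
  then have Tb: "bounded_linear T" by (simp add: linear_conv_bounded_linear)
  have TT: "T v \<bullet> T w = v \<bullet> w" for v w using T by (simp add: orthogonal_transformation_def)
  have Tn: "norm (T v) = norm v" for v using orthogonal_transformation_norm[OF T] .
  obtain e where e: "T e = axis i 1"
    using orthogonal_transformation_surj[OF T] by (metis surjD)
  have en: "norm e = 1" using Tn[of e] by (simp add: e)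
  define \<rho> where "\<rho> x = T x $ i - h (T x)" for x
  define d\<rho> where "d\<rho> x = adjoint T (axis i 1 - gh (T x))" for x
  have \<rho>d: "(\<rho> has_derivative (\<lambda>v. d\<rho> x \<bullet> v)) (at x)" for x
  proof -
    have Td: "(T has_derivative T) (at x)" by (rule bounded_linear_imp_has_derivative[OF Tb])
    have "(\<rho> has_derivative (\<lambda>v. T v $ i - gh (T x) \<bullet> T v)) (at x)"
      unfolding \<rho>_def
      by (intro has_derivative_diff bounded_linear.has_derivative[OF bounded_linear_vec_nth Td]
          has_derivative_compose[OF Td hd])
    also have "(\<lambda>v. T v $ i - gh (T x) \<bullet> T v) = (\<lambda>v. d\<rho> x \<bullet> v)"
      by (rule ext) (simp add: d\<rho>_def adjoint_clauses[OF Tl] inner_diff_left inner_axis')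
    finally show ?thesis .
  qed
  have d\<rho>j: "d\<rho> x $ j = T (axis j 1) \<bullet> (axis i 1 - gh (T x))" for x j
  proof -
    have "d\<rho> x $ j = axis j 1 \<bullet> d\<rho> x" by (simp add: inner_axis')
    also have "\<dots> = T (axis j 1) \<bullet> (axis i 1 - gh (T x))"
      unfolding d\<rho>_def by (rule adjoint_works[OF Tl])
    finally show ?thesis .
  qed
  have d\<rho>c: "continuous_on UNIV d\<rho>"
    unfolding d\<rho>_def
    by (intro linear_continuous_on_compose[OF _ adjoint_linear[OF Tl]] continuous_intros
        continuous_on_compose2[OF ghc linear_continuous_on[OF Tb]]) auto
  obtain L1 where L1: "0 \<le> L1" "holder_bd 1 L1 (cball x0 r) \<rho>"
    using C1_imp_lipschitz[OF \<rho>d d\<rho>c] by blast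
  have "\<exists>L\<ge>0. holder_bd 1 L (cball (T x0) r) (partial_deriv k h)" for k
    by (rule C1_imp_lipschitz[OF Ck_on_imp_has_derivative[OF Ck_on_Suc_partials(2)[OF h2]]])
      (intro continuous_on_vec_lambda Ck_on_imp_continuous[OF Ck_on_Suc_partials(2)[OF Ck_on_Suc_partials(2)[OF h2]]])
  then obtain L2 where L2: "\<And>k. 0 \<le> L2 k" "\<And>k. holder_bd 1 (L2 k) (cball (T x0) r) (partial_deriv k h)"
    by metis
  have TL: "holder_bd 1 (L2 k) (cball x0 r) (\<lambda>x. partial_deriv k h (T x))" for k
  proof -
    have Td: "norm (T x - T y) = norm (x - y)" for x y
      using Tn[of "x - y"] by (simp add: linear_diff[OF Tl])
    have "T x \<in> cball (T x0) r" if "x \<in> cball x0 r" for x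
      using that Td[of x0 x] by (simp add: dist_norm)
    then show ?thesis
      using L2(2)[of k] Td unfolding holder_bd_one_iff by metis
  qed
  \<comment> \<open>Each component of \<open>d\<rho> x\<close> combines the terms
    \<open>axis i 1 $ k - partial_deriv k h (T x)\<close>, bounded by 1 and \<open>L2 k\<close>,
    with weights \<open>T (axis j 1) $ k\<close>.\<close>
  define N where "N j = (\<Sum>k\<in>UNIV. \<bar>T (axis j 1) $ k\<bar> * (1 + L2 k))" for j
  have N: "holder_bd 1 (N j) (cball x0 r) (\<lambda>x. d\<rho> x $ j)" for j
  proof -
    have "holder_bd 1 (N j) (cball x0 r) (\<lambda>x. \<Sum>k\<in>UNIV. T (axis j 1) $ k * (axis i 1 $ k - partial_deriv k h (T x)))"
      unfolding N_def
      by (intro holder_bd_sum holder_bd_cmult holder_bd_diff TL holder_bd_const) (auto simp: axis_def)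
    then show ?thesis by (simp add: d\<rho>j inner_vec_def gh_def)
  qed
  have N0: "0 \<le> N j" for j unfolding N_def using L2(1) by (intro sum_nonneg mult_nonneg_nonneg) (auto simp: add_nonneg_nonneg)
  define L where "L = L1 + (\<Sum>j\<in>UNIV. N j)"
  have L: "0 \<le> L" "L1 \<le> L" "N j \<le> L" for j
    using L1(1) N0 member_le_sum[of j UNIV N] sum_nonneg[of UNIV N] by (auto simp: L_def)
  have "boundary_chart \<Omega> x0 r e \<rho> d\<rho> L"
    unfolding boundary_chart_def
  proof (intro conjI allI r L(1) en \<rho>d d\<rho>c)
    show "\<rho> (x + t *\<^sub>R e) = \<rho> x + t" for x t
    proof -
      have "T (x + t *\<^sub>R e) = T x + t *\<^sub>R axis i 1" by (simp add: linear_add[OF Tl] linear_scale[OF Tl] e)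
      moreover have "h (T x + t *\<^sub>R axis i 1) = h (T x)" by (rule hi) (simp add: axis_def)
      ultimately show ?thesis by (simp add: \<rho>_def)
    qed
    show "holder_bd 1 L (ball x0 r) \<rho>"
      by (rule holder_bd_subset[OF holder_bd_mono[OF L1(2) L(2)]]) auto
    show "holder_bd 1 L (ball x0 r) (\<lambda>x. d\<rho> x $ j)" for j
      by (rule holder_bd_subset[OF holder_bd_mono[OF N L(3)]]) auto
    show "\<Omega> \<inter> ball x0 r = {x \<in> ball x0 r. 0 < \<rho> x}" unfolding \<Omega> \<rho>_def by auto
  qed
  then show ?thesis by blast
qed

lemma boundary_chartD:
  assumes "boundary_chart \<Omega> x0 r e \<rho> d\<rho> L"
  shows "0 < r" "0 \<le> L" "norm e = 1" "\<rho> (x + t *\<^sub>R e) = \<rho> x + t"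
    "(\<rho> has_derivative (\<lambda>v. d\<rho> x \<bullet> v)) (at x)" "continuous_on UNIV d\<rho>"
    "holder_bd 1 L (ball x0 r) \<rho>" "holder_bd 1 L (ball x0 r) (\<lambda>x. d\<rho> x $ j)"
    "x \<in> ball x0 r \<Longrightarrow> x \<in> \<Omega> \<longleftrightarrow> 0 < \<rho> x"
proof -
  note a = assms[unfolded boundary_chart_def]
  show "0 < r" "0 \<le> L" "norm e = 1" "\<rho> (x + t *\<^sub>R e) = \<rho> x + t"
    "continuous_on UNIV d\<rho>" "holder_bd 1 L (ball x0 r) \<rho>" "holder_bd 1 L (ball x0 r) (\<lambda>x. d\<rho> x $ j)"
    using a by simp_all
  show "(\<rho> has_derivative (\<lambda>v. d\<rho> x \<bullet> v)) (at x)"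
    using a by (elim conjE) (erule spec)
  have "\<Omega> \<inter> ball x0 r = {x \<in> ball x0 r. 0 < \<rho> x}"
    using a by (elim conjE)
  then show "x \<in> ball x0 r \<Longrightarrow> x \<in> \<Omega> \<longleftrightarrow> 0 < \<rho> x" by (metis (no_types, lifting) IntD1 IntI mem_Collect_eq)
qed

lemma boundary_chart_line_deriv:
  assumes "boundary_chart \<Omega> x0 r e \<rho> d\<rho> L"
  shows "((\<lambda>\<tau>. \<rho> (x + \<tau> *\<^sub>R v)) has_real_derivative d\<rho> (x + \<tau> *\<^sub>R v) \<bullet> v) (at \<tau>)"
proof -
  have "((\<lambda>\<tau>. x + \<tau> *\<^sub>R v) has_derivative (\<lambda>h. h *\<^sub>R v)) (at \<tau>)"
    by (auto intro!: derivative_eq_intros)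
  from has_derivative_compose[OF this boundary_chartD(5)[OF assms]]
  show ?thesis by (simp add: has_field_derivative_def mult_commute_abs)
qed

lemma boundary_chart_grad_dir:
  assumes "boundary_chart \<Omega> x0 r e \<rho> d\<rho> L"
  shows "d\<rho> x \<bullet> e = 1"
proof -
  have "((\<lambda>\<tau>. \<rho> (x + \<tau> *\<^sub>R e)) has_real_derivative d\<rho> (x + 0 *\<^sub>R e) \<bullet> e) (at 0)"
    by (rule boundary_chart_line_deriv[OF assms])
  moreover have "((\<lambda>\<tau>. \<rho> (x + \<tau> *\<^sub>R e)) has_real_derivative 1) (at 0)"
    unfolding boundary_chartD(4)[OF assms] by (auto intro!: derivative_eq_intros)
  ultimately show ?thesis using DERIV_unique by fastforce
qed

text \<open>Inside the ball the chart identifies \<Omega> with \<open>0 < \<rho>\<close>. Openness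
  of \<Omega> excludes positive values on the frontier, and continuity excludes negative ones, since
  a neighbourhood with \<open>\<rho> < 0\<close> would miss \<Omega>.\<close>

lemma boundary_chart_frontier:
  assumes c: "boundary_chart \<Omega> x0 r e \<rho> d\<rho> L" and o: "open \<Omega>" and x: "x \<in> frontier \<Omega>" "x \<in> ball x0 r"
  shows "\<rho> x = 0"
proof -
  note cd = boundary_chartD[OF c]
  have xo: "x \<notin> \<Omega>" "x \<in> closure \<Omega>" using x o by (auto simp: frontier_def interior_open)
  then have le: "\<rho> x \<le> 0" using cd(9)[OF x(2)] by auto
  have cont: "continuous_on UNIV \<rho>"
    by (rule has_derivative_continuous_on[OF has_derivative_at_withinI[OF cd(5)]])
  have "\<not> \<rho> x < 0"
  proof
    assume neg: "\<rho> x < 0"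
    have "open {y. \<rho> y < 0}" by (intro open_Collect_less cont continuous_on_const)
    then have "open ({y. \<rho> y < 0} \<inter> ball x0 r)" by auto
    moreover have "x \<in> {y. \<rho> y < 0} \<inter> ball x0 r" using neg x(2) by auto
    ultimately have "({y. \<rho> y < 0} \<inter> ball x0 r) \<inter> \<Omega> \<noteq> {}"
      using xo(2) open_Int_closure_eq_empty[of "{y. \<rho> y < 0} \<inter> ball x0 r" \<Omega>] by blast
    then obtain y where "y \<in> \<Omega>" "\<rho> y < 0" "y \<in> ball x0 r" by blast
    then show False using cd(9)[of y] by auto
  qed
  then show ?thesis using le by simp
qed

subsection \<open>Correcting the boundary values of the divergence\<close>

lemma moll_inner:
  fixes f :: "real^'n \<Rightarrow> real"
  assumes f: "continuous_on UNIV f" and k: "C1_kernel k dk R"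
  shows "(\<chi> i. moll f (\<lambda>w. dk w $ i) x t) \<bullet> u = moll f (\<lambda>w. dk w \<bullet> u) x t"
proof -
  have i: "(\<lambda>w. (dk w $ i) * f (x - t *\<^sub>R w)) integrable_on UNIV" for i
    by (rule moll_integrable[OF f, where R = R]) (auto intro!: continuous_intros C1_kernelD(3)[OF k] simp: C1_kernelD(5)[OF k])
  have "moll f (\<lambda>w. dk w \<bullet> u) x t = integral UNIV (\<lambda>w. \<Sum>i\<in>UNIV. (dk w $ i * f (x - t *\<^sub>R w)) * u $ i)"
    unfolding moll_def by (intro integral_cong) (simp add: inner_vec_def sum_distrib_left sum_distrib_right mult_ac)
  also have "\<dots> = (\<Sum>i\<in>UNIV. integral UNIV (\<lambda>w. dk w $ i * f (x - t *\<^sub>R w)) * u $ i)"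
    by (subst integral_sum) (auto intro!: integrable_on_mult_left i simp: integral_mult_left)
  finally show ?thesis by (simp add: moll_def inner_vec_def)
qed

lemma holder_bd_max0: "holder_bd a M S f \<Longrightarrow> holder_bd a M S (\<lambda>x. max 0 (f x))"
  unfolding holder_bd_def by (auto simp: max_def abs_if split: if_splits) (smt (verit, best))+

text \<open>\<open>D\<close> is the gradient of \<open>v\<close> on \<open>\<Omega>\<close>, so that \<open>D \<bullet> e\<close> is the divergence of the field \<open>v e\<close>.\<close>

definition boundary_field :: "(real^'n) set \<Rightarrow> real \<Rightarrow> real^'n \<Rightarrow> real \<Rightarrow> real^'n \<Rightarrow> real \<Rightarrow>
    (real^'n \<Rightarrow> real) \<Rightarrow> (real^'n \<Rightarrow> real) \<Rightarrow> (real^'n \<Rightarrow> real^'n) \<Rightarrow> bool" where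
  "boundary_field \<Omega> a x0 r e K F v D \<longleftrightarrow> (\<forall>x. x \<notin> \<Omega> \<longrightarrow> v x = 0) \<and> holder_bd a K UNIV v \<and>
     (\<forall>i. \<forall>x\<in>\<Omega>. ((\<lambda>t. v (x + t *\<^sub>R axis i 1)) has_real_derivative D x $ i) (at 0)) \<and>
     (\<forall>i. holder_bd a K UNIV (\<lambda>x. D x $ i)) \<and>
     (\<forall>x\<in>frontier \<Omega>. D x \<bullet> e = bump x0 (r / 2) x * F x) \<and>
     ((\<lambda>x. if x \<in> \<Omega> then D x \<bullet> e else 0) has_integral 0) UNIV"

lemma boundary_fieldD:
  assumes "boundary_field \<Omega> a x0 r e K F v D"
  shows "x \<notin> \<Omega> \<Longrightarrow> v x = 0" and "holder_bd a K UNIV v"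
    and "x \<in> \<Omega> \<Longrightarrow> ((\<lambda>t. v (x + t *\<^sub>R axis i 1)) has_real_derivative D x $ i) (at 0)"
    and "holder_bd a K UNIV (\<lambda>x. D x $ i)"
    and "x \<in> frontier \<Omega> \<Longrightarrow> D x \<bullet> e = bump x0 (r / 2) x * F x"
    and "((\<lambda>x. if x \<in> \<Omega> then D x \<bullet> e else 0) has_integral 0) UNIV"
  using assms unfolding boundary_field_def by simp_all

text \<open>The scalar field is \<open>b * \<rho> * P\<close>, with \<open>b\<close> a cut-off and
  \<open>P\<close> the mollification at scale \<rho>. Differentiating \<open>P\<close> costs
  \<open>1 / \<rho>\<close>, which the factor \<rho> absorbs, so the gradient is built from
  mollifications that stay Hoelder up to the boundary. At scale 0 the kernels in
  \<open>A x \<bullet> e\<close> and \<open>E\<close> integrate to zero while \<open>P\<close>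
  equals \<open>F\<close>, and \<open>d\<rho> x \<bullet> e = 1\<close> leaves
  \<open>b x * F x\<close>.\<close>

lemma boundary_corrector:
  fixes \<Omega> :: "(real^'n) set"
  assumes chart: "boundary_chart \<Omega> x0 r e \<rho> d\<rho> L" and o: "open \<Omega>" and a: "0 < a" "a \<le> 1"
  shows "\<exists>C\<ge>0. \<forall>F M. 0 \<le> M \<longrightarrow> holder_bd a M UNIV F \<longrightarrow>
    (\<exists>v D. boundary_field \<Omega> a x0 r e (C * M) F v D)"
proof -
  note cd = boundary_chartD[OF chart]
  define b where "b = bump x0 (r / 2)"
  define db where "db = dbump x0 (r / 2)"
  define \<phi> :: "real^'n \<Rightarrow> real" where "\<phi> = nbump 0 1"
  define d\<phi> :: "real^'n \<Rightarrow> real^'n" where "d\<phi> = dnbump 0 1"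
  define euler where "euler w = real CARD('n) * \<phi> w + d\<phi> w \<bullet> w" for w
  \<comment> \<open>Truncation makes the field vanish where \<rho> is not positive, and it keeps the
    Lipschitz constant \<open>L\<close>.\<close>
  define t where "t x = max 0 (\<rho> x)" for x
  have k: "C1_kernel \<phi> d\<phi> 1" using nbump_kernel[of 1 0] by (simp add: \<phi>_def d\<phi>_def)
  note kd = C1_kernelD[OF k]
  have r2: "0 < r / 2" using cd(1) by simp
  have b0: "b x = 0" "db x = 0" if "x \<notin> ball x0 r" for x
    using that r2 by (auto simp: b_def db_def dist_norm norm_minus_commute intro!: bump_eq_0 dbump_eq_0)
  obtain Lb where Lb: "0 \<le> Lb" "holder_bd 1 Lb UNIV b"
    using bump_holder[OF r2] unfolding b_def by blast
  obtain Ldb where Ldb: "0 \<le> Ldb" "\<And>i. holder_bd 1 Ldb UNIV (\<lambda>x. db x $ i)"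
    using dbump_holder[OF r2] unfolding db_def by blast
  have bh: "holder_bd a (2 * Lb) UNIV b"
    by (rule holder_bd_exponent_mono[OF Lb(2) a Lb(1)])
  have dbh: "holder_bd a (2 * Ldb) UNIV (\<lambda>x. db x $ i)" for i
    by (rule holder_bd_exponent_mono[OF Ldb(2) a Ldb(1)])
  have d\<rho>h: "holder_bd a (2 * L) (ball x0 r) (\<lambda>x. d\<rho> x $ i)" for i
    by (rule holder_bd_exponent_mono[OF cd(8) a cd(2)])
  have t1: "holder_bd 1 L (ball x0 r) t" unfolding t_def by (rule holder_bd_max0[OF cd(7)])
  have th: "holder_bd a (2 * L) (ball x0 r) t" by (rule holder_bd_exponent_mono[OF t1 a cd(2)])
  have tL: "\<bar>t x - t y\<bar> \<le> L * norm (x - y)" if "x \<in> ball x0 r" "y \<in> ball x0 r" for x y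
    using t1 that by (auto simp: holder_bd_one_iff)
  have \<rho>c: "continuous_on UNIV \<rho>"
    by (rule has_derivative_continuous_on[OF has_derivative_at_withinI[OF cd(5)]])
  define cP where "cP = integral UNIV (\<lambda>w. \<bar>\<phi> w\<bar>) * (1 + L)"
  define cE where "cE = integral UNIV (\<lambda>w. \<bar>euler w\<bar>) * (1 + L)"
  define cA where "cA i = integral UNIV (\<lambda>w. \<bar>d\<phi> w $ i\<bar>) * (1 + L)" for i
  have c0: "0 \<le> cP" "0 \<le> cE" "0 \<le> cA i" for i
    using cd(2) by (auto simp: cP_def cE_def cA_def intro!: mult_nonneg_nonneg integral_abs_nonneg)
  have euler: "continuous_on UNIV euler" "\<And>w. 1 < norm w \<Longrightarrow> euler w = 0"
    unfolding euler_def by (auto intro!: continuous_intros kd simp: kd(4,5))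
  have d\<phi>i: "continuous_on UNIV (\<lambda>w. d\<phi> w $ i)" "\<And>w. 1 < norm w \<Longrightarrow> d\<phi> w $ i = 0" for i
    by (auto intro!: continuous_intros kd simp: kd(5))
  \<comment> \<open>Every use of \<open>holder_bd_mult\<close> contributes a factor 2, and every
    passage from exponent 1 to \<open>a\<close> another one.\<close>
  define Cv where "Cv = 2 * (2 * Lb) * (2 * (2 * L) * cP)"
  define CD where "CD i = 2 * (2 * Ldb) * (2 * (2 * L) * cP) + 2 * (2 * Lb) * (2 * (2 * L) * (cP + cE) + cA i)" for i
  define C where "C = Cv + (\<Sum>i\<in>UNIV. CD i)"
  have C0: "0 \<le> Cv" "0 \<le> CD i" for i
    using c0 cd(2) Lb(1) Ldb(1) by (auto simp: Cv_def CD_def intro!: mult_nonneg_nonneg add_nonneg_nonneg)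
  have C: "0 \<le> C" "Cv \<le> C" "CD i \<le> C" for i
    using C0 member_le_sum[of i UNIV CD] sum_nonneg[of UNIV CD] by (auto simp: C_def)
  show ?thesis
  proof (intro exI[of _ C] conjI C(1) allI impI)
    fix F :: "real^'n \<Rightarrow> real" and M assume M: "0 \<le> M" and F: "holder_bd a M UNIV F"
    have Fc: "continuous_on UNIV F" by (rule holder_bd_continuous_on[OF F a(1)])
    define P where "P x = moll F \<phi> x (t x)" for x
    define E where "E x = moll F euler x (t x)" for x
    define A where "A x = (\<chi> i. moll F (\<lambda>w. d\<phi> w $ i) x (t x))" for x
    define v where "v x = b x * (t x * P x)" for x
    \<comment> \<open>Product rule for \<open>b * (t * P)\<close>, in which
      \<open>moll_has_derivative\<close> turns the gradient of \<open>t * P\<close> into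
      \<open>(P - E) *\<^sub>R d\<rho> + A\<close>.\<close>
    define D where "D x = (t x * P x) *\<^sub>R db x + b x *\<^sub>R ((P x - E x) *\<^sub>R d\<rho> x + A x)" for x
    have Ph: "holder_bd a (cP * M) (ball x0 r) P"
      using moll_holder[where R = 1 and S = "ball x0 r", OF F a M kd(6) kd(4) _ cd(2) tL] by (simp add: P_def[abs_def] cP_def)
    have Eh: "holder_bd a (cE * M) (ball x0 r) E"
      using moll_holder[where R = 1 and S = "ball x0 r", OF F a M euler _ cd(2) tL] by (simp add: E_def[abs_def] cE_def)
    have Ah: "holder_bd a (cA i * M) (ball x0 r) (\<lambda>x. A x $ i)" for i
      using moll_holder[where R = 1 and S = "ball x0 r", OF F a M d\<phi>i _ cd(2) tL] by (simp add: A_def cA_def)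
    have tP: "holder_bd a (2 * (2 * L) * (cP * M)) (ball x0 r) (\<lambda>x. t x * P x)"
      using c0 M cd(2) by (intro holder_bd_mult th holder_bd_subset[OF Ph]) auto
    have PEd: "holder_bd a (2 * (2 * L) * (cP * M + cE * M)) (ball x0 r) (\<lambda>x. d\<rho> x $ i * (P x - E x))" for i
      using c0 M cd(2) by (intro holder_bd_mult d\<rho>h holder_bd_subset[OF holder_bd_diff[OF Ph Eh]]) auto
    have bsub: "UNIV \<inter> {x. b x \<noteq> 0} \<subseteq> ball x0 r" "UNIV \<inter> {x. db x $ i \<noteq> 0} \<subseteq> ball x0 r" for i
      using b0 by force+
    have vh: "holder_bd a (Cv * M) UNIV v"
    proof -
      have "holder_bd a (2 * (2 * Lb) * (2 * (2 * L) * (cP * M))) UNIV v"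
        unfolding v_def using c0 M cd(2) Lb(1) by (intro holder_bd_mult bh holder_bd_subset[OF tP bsub(1)]) auto
      then show ?thesis by (simp add: Cv_def mult_ac)
    qed
    have Dh: "holder_bd a (CD i * M) UNIV (\<lambda>x. D x $ i)" for i
    proof -
      have "holder_bd a (2 * (2 * Ldb) * (2 * (2 * L) * (cP * M))
          + 2 * (2 * Lb) * (2 * (2 * L) * (cP * M + cE * M) + cA i * M)) UNIV
          (\<lambda>x. db x $ i * (t x * P x) + b x * (d\<rho> x $ i * (P x - E x) + A x $ i))"
        using c0 M cd(2) Lb(1) Ldb(1)
        by (intro holder_bd_add holder_bd_mult[OF dbh holder_bd_subset[OF tP bsub(2)]]
            holder_bd_mult[OF bh holder_bd_subset[OF holder_bd_add[OF PEd Ah] bsub(1)]]) (auto intro!: add_nonneg_nonneg)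
      then show ?thesis by (simp add: CD_def D_def algebra_simps)
    qed
    have Dout: "D x = 0" "v x = 0" if "x \<notin> ball x0 r" for x
      using b0[OF that] by (auto simp: D_def v_def)
    have vneg: "v x = 0" if "\<rho> x \<le> 0" for x using that by (simp add: v_def t_def)
    have Av: "A x \<bullet> u = moll F (\<lambda>w. d\<phi> w \<bullet> u) x (t x)" for x u
      unfolding A_def by (rule moll_inner[OF Fc k])
    have vder: "((\<lambda>\<tau>. v (x + \<tau> *\<^sub>R u)) has_real_derivative D x \<bullet> u) (at 0)" if pos: "0 < \<rho> x" for x u
    proof -
      have "continuous_on UNIV (\<lambda>\<tau>. \<rho> (x + \<tau> *\<^sub>R u))"
        by (intro continuous_on_compose2[OF \<rho>c] continuous_intros) auto
      then have "open {\<tau>. 0 < \<rho> (x + \<tau> *\<^sub>R u)}"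
        by (intro open_Collect_less continuous_on_const)
      moreover have "0 \<in> {\<tau>. 0 < \<rho> (x + \<tau> *\<^sub>R u)}" using pos by simp
      ultimately obtain \<delta> where \<delta>: "0 < \<delta>" "ball 0 \<delta> \<subseteq> {\<tau>. 0 < \<rho> (x + \<tau> *\<^sub>R u)}"
        unfolding open_contains_ball by blast
      have near: "0 < \<rho> (x + \<tau> *\<^sub>R u)" if "\<bar>\<tau>\<bar> < \<delta>" for \<tau> using \<delta>(2) that by auto
      have tx: "t x = \<rho> x" using pos by (simp add: t_def)
      have dc: "continuous_on {-\<delta><..<\<delta>} (\<lambda>\<tau>. d\<rho> (x + \<tau> *\<^sub>R u) \<bullet> u)"
        by (intro continuous_intros continuous_on_compose2[OF cd(6)]) auto
      have m: "((\<lambda>\<tau>. moll F \<phi> (x + \<tau> *\<^sub>R u) (\<rho> (x + \<tau> *\<^sub>R u))) has_real_derivative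
          (1 / \<rho> x) * (A x \<bullet> u - (d\<rho> x \<bullet> u) * E x)) (at 0)"
        using moll_has_derivative[OF Fc k \<delta>(1), of "\<lambda>\<tau>. \<rho> (x + \<tau> *\<^sub>R u)" "\<lambda>\<tau>. d\<rho> (x + \<tau> *\<^sub>R u) \<bullet> u" x u,
            OF boundary_chart_line_deriv[OF chart] dc near]
        by (simp add: Av E_def euler_def[abs_def] tx)
      have bd: "((\<lambda>\<tau>. b (x + \<tau> *\<^sub>R u)) has_real_derivative db x \<bullet> u) (at 0)"
      proof -
        have "((\<lambda>\<tau>. x + \<tau> *\<^sub>R u) has_derivative (\<lambda>h. h *\<^sub>R u)) (at 0)"
          by (auto intro!: derivative_eq_intros)
        from has_derivative_compose[OF this bump_has_derivative]
        show ?thesis by (simp add: has_field_derivative_def mult_commute_abs b_def db_def)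
      qed
      have \<rho>d: "((\<lambda>\<tau>. \<rho> (x + \<tau> *\<^sub>R u)) has_real_derivative d\<rho> x \<bullet> u) (at 0)"
        using boundary_chart_line_deriv[OF chart, of x u 0] by simp
      have "((\<lambda>\<tau>. b (x + \<tau> *\<^sub>R u) * (\<rho> (x + \<tau> *\<^sub>R u) * moll F \<phi> (x + \<tau> *\<^sub>R u) (\<rho> (x + \<tau> *\<^sub>R u))))
          has_real_derivative D x \<bullet> u) (at 0)"
        by (rule derivative_eq_intros bd \<rho>d m refl)+
          (use pos in \<open>simp add: D_def P_def tx inner_add_left algebra_simps\<close>)
      then show ?thesis
      proof (rule has_field_derivative_transform_within[where d = \<delta>])
        fix \<tau> :: real assume "dist \<tau> 0 < \<delta>"
        then have "t (x + \<tau> *\<^sub>R u) = \<rho> (x + \<tau> *\<^sub>R u)" using near[of \<tau>] by (simp add: t_def)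
        then show "b (x + \<tau> *\<^sub>R u) * (\<rho> (x + \<tau> *\<^sub>R u) * moll F \<phi> (x + \<tau> *\<^sub>R u) (\<rho> (x + \<tau> *\<^sub>R u)))
            = v (x + \<tau> *\<^sub>R u)" by (simp add: v_def P_def)
      qed (use \<delta>(1) in auto)
    qed
    have v\<Omega>: "v x = 0" if "x \<notin> \<Omega>" for x
      using that cd(9)[of x] Dout(2)[of x] vneg[of x] by (cases "x \<in> ball x0 r") auto
    have \<Omega>der: "((\<lambda>\<tau>. v (x + \<tau> *\<^sub>R axis i 1)) has_real_derivative D x $ i) (at 0)" if x: "x \<in> \<Omega>" for x i
    proof (cases "0 < \<rho> x")
      case True
      then show ?thesis using vder[OF True, of "axis i 1"] by (simp add: inner_axis)
    next
      case False
      \<comment> \<open>Outside the ball the chart says nothing, so \<rho> may be negative at a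
        point of \<Omega>. There the cut-off, of radius \<open>r / 2\<close>, vanishes in a whole
        neighbourhood.\<close>
      then have xb: "x \<notin> ball x0 r" using cd(9) x by blast
      have "((\<lambda>\<tau>::real. 0) has_real_derivative D x $ i) (at 0)" using Dout(1)[OF xb] by simp
      then show ?thesis
      proof (rule has_field_derivative_transform_within[where d = "r / 2"])
        fix \<tau> :: real assume "dist \<tau> 0 < r / 2"
        then have "\<bar>\<tau>\<bar> < r / 2" by simp
        moreover have "norm (x0 - x) \<le> norm (x0 - (x + \<tau> *\<^sub>R axis i 1)) + norm (\<tau> *\<^sub>R axis i (1::real))"
          using norm_triangle_ineq[of "x0 - (x + \<tau> *\<^sub>R axis i 1)" "\<tau> *\<^sub>R axis i 1"] by simp
        ultimately have "r / 2 \<le> norm (x + \<tau> *\<^sub>R axis i 1 - x0)"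
          using xb by (simp add: dist_norm norm_minus_commute)
        then show "0 = v (x + \<tau> *\<^sub>R axis i 1)" using r2 by (simp add: v_def b_def bump_eq_0)
      qed (use r2 in auto)
    qed
    have front: "D x \<bullet> e = bump x0 (r / 2) x * F x" if x: "x \<in> frontier \<Omega>" for x
    proof (cases "x \<in> ball x0 r")
      case True
      have "t x = 0" using boundary_chart_frontier[OF chart o x True] by (simp add: t_def)
      then show ?thesis
        using integral_kernel_deriv[OF k, of e] integral_kernel_euler[OF k] integral_nbump[of 1 "0::real^'n"]
        by (simp add: D_def inner_add_left boundary_chart_grad_dir[OF chart] Av P_def E_def moll_zero_scale
            euler_def[abs_def] \<phi>_def[symmetric] b_def)
    next
      case False
      then show ?thesis using Dout(1)[OF False] b0(1)[OF False] by (simp add: b_def)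
    qed
    have vc: "continuous_on UNIV v" by (rule holder_bd_continuous_on[OF vh a(1)])
    define K where "K = real CARD('n) * (C * M)"
    have Db: "\<bar>D x \<bullet> e\<bar> \<le> K" for x
    proof -
      have "\<bar>D x $ i\<bar> \<le> C * M" for i
        using holder_bdD(1)[OF holder_bd_mono[OF Dh mult_right_mono[OF C(3) M]]] by blast
      then have "(\<Sum>i\<in>UNIV. \<bar>D x $ i\<bar>) \<le> K" unfolding K_def using sum_bounded_above[of UNIV "\<lambda>i. \<bar>D x $ i\<bar>" "C * M"] by simp
      then have "norm (D x) \<le> K" using norm_le_l1_cart[of "D x"] by linarith
      then show ?thesis using Cauchy_Schwarz_ineq2[of "D x" e] cd(3) by simp
    qed
    have K0: "0 \<le> K" using Db[of 0] by linarith
    \<comment> \<open>A bound independent of \<open>s\<close> for the quotients, to serve as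
      majorant in dominated convergence. Across \<open>\<rho> = 0\<close> the field may have a kink,
      so the mean value theorem is applied only on the part of the segment with
      \<open>\<rho> > 0\<close>.\<close>
    have quot: "\<bar>v x - v (x - s *\<^sub>R e)\<bar> \<le> K * s" if s: "0 < s" for x s
    proof (cases "0 < \<rho> x")
      case False
      have "\<rho> (x + (-s) *\<^sub>R e) = \<rho> x + (-s)" by (rule cd(4))
      then show ?thesis using False vneg[of x] vneg[of "x - s *\<^sub>R e"] s K0 by simp
    next
      case True
      define g where "g \<sigma> = v (x + (\<sigma> - s) *\<^sub>R e)" for \<sigma>
      \<comment> \<open>Parameter at which the segment from \<open>x - s *\<^sub>R e\<close> to
        \<open>x\<close> enters the region \<open>\<rho> > 0\<close>, or 0 if
        \<open>s \<le> \<rho> x\<close>.\<close>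
      define \<sigma>0 where "\<sigma>0 = max 0 (s - \<rho> x)"
      have \<sigma>0: "0 \<le> \<sigma>0" "\<sigma>0 < s" using True s by (auto simp: \<sigma>0_def)
      have "norm (g s - g \<sigma>0) \<le> K * norm (s - \<sigma>0)"
      proof -
        have gd: "(g has_real_derivative D (x + (\<sigma> - s) *\<^sub>R e) \<bullet> e) (at \<sigma>)" if "\<sigma>0 < \<sigma>" for \<sigma>
        proof -
          have "0 < \<rho> (x + (\<sigma> - s) *\<^sub>R e)" using that by (simp add: cd(4) \<sigma>0_def)
          from vder[OF this, of e]
          have "((\<lambda>h. g (h + \<sigma>)) has_real_derivative D (x + (\<sigma> - s) *\<^sub>R e) \<bullet> e) (at 0)"
            by (simp add: g_def algebra_simps)
          then show ?thesis using DERIV_shift[of g _ 0 \<sigma>] by simp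
        qed
        have gc: "continuous_on {\<sigma>0..s} g"
          unfolding g_def by (intro continuous_on_compose2[OF vc] continuous_intros) auto
        obtain \<xi> where "\<sigma>0 < \<xi>" "\<xi> < s" "g s - g \<sigma>0 = (s - \<sigma>0) * (D (x + (\<xi> - s) *\<^sub>R e) \<bullet> e)"
          using MVT[OF \<sigma>0(2) gc] gd by (metis DERIV_unique real_differentiable_def)
        then show ?thesis using Db[of "x + (\<xi> - s) *\<^sub>R e"] \<sigma>0 by (simp add: abs_mult mult_right_mono mult.commute)
      qed
      moreover have "g s = v x" by (simp add: g_def)
      moreover have "g \<sigma>0 = v (x - s *\<^sub>R e)"
      proof (cases "s \<le> \<rho> x")
        case True then show ?thesis by (simp add: g_def \<sigma>0_def)
      next
        case False
        have "\<rho> (x + (-s) *\<^sub>R e) = \<rho> x + (-s)" by (rule cd(4))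
        then have "v (x - s *\<^sub>R e) = 0" using False by (intro vneg) simp
        moreover have "g \<sigma>0 = 0" unfolding g_def
        proof (rule vneg)
          show "\<rho> (x + (\<sigma>0 - s) *\<^sub>R e) \<le> 0" unfolding cd(4) using False by (simp add: \<sigma>0_def)
        qed
        ultimately show ?thesis by simp
      qed
      moreover have "K * norm (s - \<sigma>0) \<le> K * s" using \<sigma>0 K0 by (intro mult_left_mono) auto
      ultimately show ?thesis by simp
    qed
    define G where "G x = (if x \<in> \<Omega> then D x \<bullet> e else 0)" for x
    define s where "s n = 1 / real (Suc n)" for n
    have s: "0 < s n" "s n \<le> 1" for n by (auto simp: s_def)
    \<comment> \<open>Backward quotients: where \<open>\<rho> \<le> 0\<close> both values vanish for
      every \<open>n\<close>, so the limit is \<open>G\<close> at every point, the surface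
      \<open>\<rho> = 0\<close> included.\<close>
    define q where "q n x = (v x - v (x - s n *\<^sub>R e)) / s n" for n x
    define B where "B = norm x0 + r"
    have vB: "v x = 0" if "B < norm x" for x
    proof -
      have "norm x \<le> norm x0 + norm (x - x0)" by (rule norm_triangle_sub)
      then have "x \<notin> ball x0 r" using that by (simp add: B_def dist_norm norm_minus_commute)
      then show ?thesis by (rule Dout(2))
    qed
    have vB': "v (x - s n *\<^sub>R e) = 0" if "B + 1 < norm x" for x n
    proof (rule vB)
      have "norm x \<le> norm (x - s n *\<^sub>R e) + norm (s n *\<^sub>R e)"
        using norm_triangle_ineq[of "x - s n *\<^sub>R e" "s n *\<^sub>R e"] by simp
      also have "norm (s n *\<^sub>R e) \<le> 1" using s[of n] cd(3) by simp
      finally show "B < norm (x - s n *\<^sub>R e)" using that by linarith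
    qed
    have qc: "continuous_on UNIV (q n)" for n
      unfolding q_def using s[of n] by (intro continuous_intros continuous_on_compose2[OF vc]) auto
    have qz: "q n x = 0" if "B + 1 < norm x" for n x
      using vB[of x] vB'[OF that] that by (simp add: q_def)
    have qi: "q n integrable_on UNIV" for n by (rule integrable_compact_support[OF qc qz])
    have v1: "v integrable_on UNIV" by (rule integrable_compact_support[OF vc vB])
    have v2: "(\<lambda>x. v (x - s n *\<^sub>R e)) integrable_on UNIV" for n
      by (rule integrable_compact_support[OF _ vB']) (intro continuous_on_compose2[OF vc] continuous_intros, auto)
    have q0: "integral UNIV (q n) = 0" for n
    proof -
      have "integral UNIV (\<lambda>x. v (1 *\<^sub>R x + - (s n *\<^sub>R e))) = integral UNIV v / \<bar>1\<bar> ^ DIM(real^'n)"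
        by (rule integral_affine_compact_support[OF vc vB]) auto
      then have "integral UNIV (\<lambda>x. v x - v (x - s n *\<^sub>R e)) = 0"
        by (simp add: integral_diff[OF v1 v2])
      then show ?thesis unfolding q_def by (simp add: integral_divide)
    qed
    obtain c :: "real^'n" where c: "cball 0 (B + 1) \<subseteq> cbox (-c) c" using cball_subset_symmetric_cbox by blast
    define H where "H x = (if x \<in> cbox (-c) c then K else 0)" for x
    have Hi: "H integrable_on UNIV" unfolding H_def by (simp add: integrable_restrict_UNIV integrable_const)
    have qH: "norm (q n x) \<le> H x" for n x
    proof (cases "x \<in> cbox (-c) c")
      case True
      have "\<bar>q n x\<bar> = \<bar>v x - v (x - s n *\<^sub>R e)\<bar> / s n" using s[of n] by (simp add: q_def)
      also have "\<dots> \<le> K" using quot[OF s(1)[of n], of x] s(1)[of n] by (simp add: pos_divide_le_eq)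
      finally show ?thesis using True by (simp add: H_def)
    next
      case False
      then have "B + 1 < norm x" using c by force
      then show ?thesis using qz False by (simp add: H_def)
    qed
    have qG: "(\<lambda>n. q n x) \<longlonglongrightarrow> G x" for x
    proof (cases "0 < \<rho> x")
      case True
      have "G x = D x \<bullet> e"
        using True cd(9)[of x] Dout(1)[of x] by (cases "x \<in> ball x0 r") (auto simp: G_def)
      moreover have "((\<lambda>h. (v (x + h *\<^sub>R e) - v x) / h) \<longlongrightarrow> D x \<bullet> e) (at 0)"
        using vder[OF True, of e] by (simp add: DERIV_def)
      moreover have "filterlim (\<lambda>n. - s n) (at 0) sequentially"
      proof -
        have "s \<longlonglongrightarrow> 0" unfolding s_def using LIMSEQ_Suc[OF lim_1_over_n] by simp
        then have "(\<lambda>n. - s n) \<longlonglongrightarrow> 0" using tendsto_minus[of s 0 sequentially] by simp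
        then show ?thesis using s(1) by (intro filterlim_atI always_eventually) (auto simp: less_imp_neq[symmetric])
      qed
      ultimately have "(\<lambda>n. (v (x + (- s n) *\<^sub>R e) - v x) / (- s n)) \<longlonglongrightarrow> G x"
        using filterlim_compose[of "\<lambda>h. (v (x + h *\<^sub>R e) - v x) / h" "nhds (D x \<bullet> e)" "at 0" "\<lambda>n. - s n"] by simp
      then show ?thesis by (simp add: q_def minus_divide_left)
    next
      case False
      have "\<rho> (x + (- s n) *\<^sub>R e) = \<rho> x + (- s n)" for n by (rule cd(4))
      then have "q n x = 0" for n
        using False s(1)[of n] vneg[of x] vneg[of "x - s n *\<^sub>R e"] by (simp add: q_def)
      moreover have "G x = 0"
        using False cd(9)[of x] Dout(1)[of x] by (cases "x \<in> ball x0 r") (auto simp: G_def)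
      ultimately show ?thesis by simp
    qed
    have "G integrable_on UNIV" "(\<lambda>n. integral UNIV (q n)) \<longlonglongrightarrow> integral UNIV G"
      using dominated_convergence[of q UNIV H G] qi Hi qH qG by auto
    then have "(G has_integral 0) UNIV"
      using q0 LIMSEQ_unique[OF tendsto_const] integrable_integral by fastforce
    then show "\<exists>v D. boundary_field \<Omega> a x0 r e (C * M) F v D"
      unfolding boundary_field_def G_def using v\<Omega> \<Omega>der front
        holder_bd_mono[OF vh mult_right_mono[OF C(2) M]] holder_bd_mono[OF Dh mult_right_mono[OF C(3) M]]
      by (intro exI[of _ v] exI[of _ D]) simp
  qed
qed

subsection \<open>Solutions of the divergence equation\<close>

text \<open>\<open>partial_deriv\<close> is built on the total function \<open>deriv\<close>, so
  existence of the partial derivatives is stated alongside the bounds.\<close>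

definition C1_holder :: "real \<Rightarrow> real \<Rightarrow> (real^'n) set \<Rightarrow> (real^'n \<Rightarrow> real) \<Rightarrow> bool" where
  "C1_holder b M S v \<longleftrightarrow> holder_bd b M S v \<and>
     (\<forall>i. (\<forall>x\<in>S. ((\<lambda>t. v (x + t *\<^sub>R axis i 1)) has_real_derivative partial_deriv i v x) (at 0)) \<and>
          holder_bd b M S (partial_deriv i v))"

lemma partial_deriv_eqI:
  "((\<lambda>t. v (x + t *\<^sub>R axis i 1)) has_real_derivative d) (at 0) \<Longrightarrow> partial_deriv i v x = d"
  unfolding partial_deriv_def by (rule DERIV_imp_deriv)

lemma C1_holderI:
  assumes "holder_bd b M S v"
    and d: "\<And>i x. x \<in> S \<Longrightarrow> ((\<lambda>t. v (x + t *\<^sub>R axis i 1)) has_real_derivative d i x) (at 0)"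
    and "\<And>i. holder_bd b M S (d i)"
  shows "C1_holder b M S v"
  unfolding C1_holder_def
proof (intro conjI allI ballI)
  have e: "partial_deriv i v x = d i x" if "x \<in> S" for i x using d[OF that] by (rule partial_deriv_eqI)
  show "((\<lambda>t. v (x + t *\<^sub>R axis i 1)) has_real_derivative partial_deriv i v x) (at 0)" if "x \<in> S" for i x
    using d[OF that] e[OF that] by simp
  show "holder_bd b M S (partial_deriv i v)" for i
    by (rule holder_bd_cong[OF assms(3)]) (rule e)
qed (rule assms(1))

lemma C1_holderD:
  assumes "C1_holder b M S v"
  shows "holder_bd b M S v"
    and "x \<in> S \<Longrightarrow> ((\<lambda>t. v (x + t *\<^sub>R axis i 1)) has_real_derivative partial_deriv i v x) (at 0)"
    and "holder_bd b M S (partial_deriv i v)"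
  using assms unfolding C1_holder_def by simp_all

lemma C1_holder_subset: "C1_holder b M S v \<Longrightarrow> T \<subseteq> S \<Longrightarrow> C1_holder b M T v"
  by (intro C1_holderI[where d = "\<lambda>i. partial_deriv i v"])
    (auto dest: C1_holderD intro: holder_bd_subset)

lemma C1_holder_mono: "C1_holder b M S v \<Longrightarrow> M \<le> N \<Longrightarrow> C1_holder b N S v"
  by (intro C1_holderI[where d = "\<lambda>i. partial_deriv i v"])
    (auto dest: C1_holderD intro: holder_bd_mono)

lemma C1_holder_add:
  "C1_holder b M S v \<Longrightarrow> C1_holder b N S w \<Longrightarrow> C1_holder b (M + N) S (\<lambda>x. v x + w x)"
  by (intro C1_holderI[where d = "\<lambda>i x. partial_deriv i v x + partial_deriv i w x"] holder_bd_add DERIV_add)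
    (auto dest: C1_holderD)

lemma C1_holder_cmult:
  "C1_holder b M S v \<Longrightarrow> C1_holder b (\<bar>c\<bar> * M) S (\<lambda>x. c * v x)"
  by (intro C1_holderI[where d = "\<lambda>i x. c * partial_deriv i v x"] holder_bd_cmult DERIV_cmult)
    (auto dest: C1_holderD)

lemma C1_holder_zero: "0 \<le> M \<Longrightarrow> C1_holder b M S (\<lambda>x. 0)"
  by (intro C1_holderI[where d = "\<lambda>i x. 0"] holder_bd_zero) auto

lemma partial_deriv_add:
  assumes "C1_holder b M S v" "C1_holder b' M' S w" "x \<in> S"
  shows "partial_deriv i (\<lambda>x. v x + w x) x = partial_deriv i v x + partial_deriv i w x"
  by (intro partial_deriv_eqI DERIV_add C1_holderD(2)[OF assms(1)] C1_holderD(2)[OF assms(2)] assms(3))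

lemma partial_deriv_cmult:
  assumes "C1_holder b M S v" "x \<in> S"
  shows "partial_deriv i (\<lambda>x. c * v x) x = c * partial_deriv i v x"
  by (intro partial_deriv_eqI DERIV_cmult C1_holderD(2)[OF assms(1)] assms(2))

text \<open>The estimates hold on the whole space and the field vanishes off \<Omega>, so solutions
  can be added without attention to the boundary. The constant is a function of the exponent because
  one \<open>u\<close> has to serve all \<open>b < a\<close>; \<open>M\<close> is kept apart as the
  size of the data.\<close>

definition div_solution ::
    "(real^'n) set \<Rightarrow> real \<Rightarrow> (real \<Rightarrow> real) \<Rightarrow> real \<Rightarrow> (real^'n \<Rightarrow> real^'n) \<Rightarrow> (real^'n \<Rightarrow> real) \<Rightarrow> bool" where
  "div_solution \<Omega> a C M u g \<longleftrightarrow> (\<forall>x. x \<notin> \<Omega> \<longrightarrow> u x = 0) \<and>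
     (\<forall>b. 0 < b \<and> b < a \<longrightarrow> (\<forall>i. C1_holder b (C b * M) UNIV (\<lambda>x. u x $ i))) \<and>
     (\<forall>x. divergence u x = g x)"

lemma div_solutionD:
  assumes "div_solution \<Omega> a C M u g"
  shows "x \<notin> \<Omega> \<Longrightarrow> u x = 0"
    and "0 < b \<Longrightarrow> b < a \<Longrightarrow> C1_holder b (C b * M) UNIV (\<lambda>x. u x $ i)"
    and "divergence u x = g x"
  using assms unfolding div_solution_def by auto

lemma div_solution_add:
  assumes u: "div_solution \<Omega> a C M u g" and w: "div_solution \<Omega> a C' M w h" and a: "0 < a"
  shows "div_solution \<Omega> a (\<lambda>b. C b + C' b) M (\<lambda>x. u x + w x) (\<lambda>x. g x + h x)"
  unfolding div_solution_def
proof (intro conjI allI impI)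
  show "u x + w x = 0" if "x \<notin> \<Omega>" for x
    using div_solutionD(1)[OF u that] div_solutionD(1)[OF w that] by simp
  show "C1_holder b ((C b + C' b) * M) UNIV (\<lambda>x. (u x + w x) $ i)" if "0 < b \<and> b < a" for b i
    using C1_holder_add[OF div_solutionD(2)[OF u] div_solutionD(2)[OF w]] that by (simp add: distrib_right)
  \<comment> \<open>Some admissible exponent, from which the partial derivatives of both summands
    are known to exist.\<close>
  have a2: "0 < a / 2" "a / 2 < a" using a by auto
  show "divergence (\<lambda>x. u x + w x) x = g x + h x" for x
    using div_solutionD(3)[OF u, of x] div_solutionD(3)[OF w, of x]
    by (simp add: divergence_def sum.distrib
        partial_deriv_add[OF div_solutionD(2)[OF u a2] div_solutionD(2)[OF w a2]])
qed

lemma div_solution_cmult: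
  assumes u: "div_solution \<Omega> a C M u g" and a: "0 < a"
  shows "div_solution \<Omega> a C (\<bar>c\<bar> * M) (\<lambda>x. c *\<^sub>R u x) (\<lambda>x. c * g x)"
  unfolding div_solution_def
proof (intro conjI allI impI)
  show "c *\<^sub>R u x = 0" if "x \<notin> \<Omega>" for x
    using div_solutionD(1)[OF u that] by simp
  show "C1_holder b (C b * (\<bar>c\<bar> * M)) UNIV (\<lambda>x. (c *\<^sub>R u x) $ i)" if "0 < b \<and> b < a" for b i
    using C1_holder_cmult[OF div_solutionD(2)[OF u], of b c] that by (simp add: mult_ac)
  have a2: "0 < a / 2" "a / 2 < a" using a by auto
  show "divergence (\<lambda>x. c *\<^sub>R u x) x = c * g x" for x
    using div_solutionD(3)[OF u, of x]
    by (simp add: divergence_def sum_distrib_left[symmetric] partial_deriv_cmult[OF div_solutionD(2)[OF u a2]])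
qed

lemma div_solution_zero: "0 \<le> M \<Longrightarrow> div_solution \<Omega> a (\<lambda>b. 0) M (\<lambda>x. 0) (\<lambda>x. 0)"
  unfolding div_solution_def
  by (auto intro: C1_holder_zero simp: divergence_def intro!: sum.neutral partial_deriv_eqI)

lemma div_solution_mono:
  assumes u: "div_solution \<Omega> a C M u g" and "\<And>b. 0 < b \<Longrightarrow> b < a \<Longrightarrow> C b * M \<le> C' b * M'"
  shows "div_solution \<Omega> a C' M' u g"
  unfolding div_solution_def
proof (intro conjI allI impI)
  show "C1_holder b (C' b * M') UNIV (\<lambda>x. u x $ i)" if "0 < b \<and> b < a" for b i
    using C1_holder_mono[OF div_solutionD(2)[OF u] assms(2)] that by blast
qed (use div_solutionD(1,3)[OF u] in auto)

lemma div_solution_sum: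
  assumes "finite I" "\<And>i. i \<in> I \<Longrightarrow> div_solution \<Omega> a (C i) M (u i) (g i)" "0 < a" "0 \<le> M"
  shows "div_solution \<Omega> a (\<lambda>b. \<Sum>i\<in>I. C i b) M (\<lambda>x. \<Sum>i\<in>I. u i x) (\<lambda>x. \<Sum>i\<in>I. g i x)"
  using assms by (induction I rule: finite_induct) (auto intro: div_solution_zero div_solution_add)

subsection \<open>Transport along a fixed family of directions\<close>

text \<open>The open interval keeps the singularity at 0 out of the domain: continuity gives
  measurability, domination by the power gives integrability. In the uses with
  \<open>p = a - b - 1\<close> the condition on \<open>p\<close> is where \<open>b < a\<close>
  enters.\<close>

lemma singular_integral_bound:
  fixes f :: "real \<Rightarrow> real"
  assumes c: "continuous_on {0<..<1} f" and b: "\<And>s. s \<in> {0<..<1} \<Longrightarrow> \<bar>f s\<bar> \<le> K * s powr p" and p: "-1 < p"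
  shows "f integrable_on {0<..<1}" "\<bar>integral {0<..<1} f\<bar> \<le> K / (p + 1)"
proof -
  have "((\<lambda>s. s powr p) has_integral (1 powr (p + 1) / (p + 1))) {0..1}"
    by (rule has_integral_powr_from_0[OF p]) simp
  then have "((\<lambda>s. s powr p) has_integral (1 / (p + 1))) {0<..<1}"
    by (simp add: has_integral_Icc_iff_Ioo)
  then have K: "((\<lambda>s. K * s powr p) has_integral (K / (p + 1))) {0<..<1}"
    using has_integral_mult_right[of "\<lambda>s. s powr p" "1 / (p + 1)" "{0<..<1}" K] by simp
  have "f absolutely_integrable_on {0<..<1}"
    by (rule measurable_bounded_by_integrable_imp_absolutely_integrable[OF continuous_imp_measurable_on_sets_lebesgue[OF c] _
          has_integral_integrable[OF K]]) (use b in auto)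
  then show fi: "f integrable_on {0<..<1}" by (rule set_lebesgue_integral_eq_integral(1))
  have "norm (integral {0<..<1} f) \<le> integral {0<..<1} (\<lambda>s. K * s powr p)"
    by (rule integral_norm_bound_integral[OF fi has_integral_integrable[OF K]]) (use b in auto)
  then show "\<bar>integral {0<..<1} f\<bar> \<le> K / (p + 1)" using integral_unique[OF K] by simp
qed

lemma tendsto_dist_powr_zero:
  fixes R a :: real
  assumes "0 \<le> R" "0 < a"
  shows "((\<lambda>s. A * (R * \<bar>s - t\<bar>) powr a) \<longlongrightarrow> 0) (at t)"
proof -
  have "((\<lambda>s. R * \<bar>s - t\<bar>) \<longlongrightarrow> R * \<bar>t - t\<bar>) (at t)" by (intro tendsto_intros)
  then have "((\<lambda>s. (R * \<bar>s - t\<bar>) powr a) \<longlongrightarrow> (R * \<bar>t - t\<bar>) powr a) (at t)"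
    by (rule tendsto_powr'[OF _ tendsto_const]) (use assms in auto)
  then show ?thesis by (intro tendsto_mult_right_zero) simp
qed

text \<open>Scale 0 is included, which the fundamental theorem of calculus in
  \<open>transport_solution\<close> relies on.\<close>

lemma moll_continuous_scale:
  fixes g k :: "real^'n \<Rightarrow> real"
  assumes g: "holder_bd a M UNIV g" and a: "0 < a" and M: "0 \<le> M"
    and k: "continuous_on UNIV k" "\<And>w. R < norm w \<Longrightarrow> k w = 0" and R: "0 \<le> R"
  shows "continuous_on S (\<lambda>s. moll g k x s)"
proof -
  have gc: "continuous_on UNIV g" by (rule holder_bd_continuous_on[OF g a])
  let ?A = "integral UNIV (\<lambda>w. \<bar>k w\<bar>)"
  have "((\<lambda>s. moll g k x s) \<longlongrightarrow> moll g k x t) (at t)" for t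
  proof -
    have "\<bar>moll g k x s - moll g k x t\<bar> \<le> ?A * (M * (R * \<bar>s - t\<bar>) powr a)" for s
    proof (rule moll_diff_le[OF gc k])
      fix w :: "real^'n" assume w: "norm w \<le> R"
      have "\<bar>g (x - s *\<^sub>R w) - g (x - t *\<^sub>R w)\<bar> \<le> M * norm ((t - s) *\<^sub>R w) powr a"
        using holder_bdD(2)[OF g, of "x - s *\<^sub>R w" "x - t *\<^sub>R w"] by (simp add: algebra_simps)
      also have "\<dots> \<le> M * (R * \<bar>s - t\<bar>) powr a"
        using w M a by (intro mult_left_mono powr_mono2) (auto simp: mult.commute[of R] abs_minus_commute mult.commute[of "norm w"] mult_left_mono)
      finally show "\<bar>g (x - s *\<^sub>R w) - g (x - t *\<^sub>R w)\<bar> \<le> M * (R * \<bar>s - t\<bar>) powr a" .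
    qed
    moreover have "((\<lambda>s. ?A * (M * (R * \<bar>s - t\<bar>) powr a)) \<longlongrightarrow> 0) (at t)"
      using tendsto_dist_powr_zero[OF R a, of "?A * M" t] by (simp add: mult.assoc)
    ultimately have "((\<lambda>s. moll g k x s - moll g k x t) \<longlongrightarrow> 0) (at t)"
      using Lim_null_comparison[of "\<lambda>s. moll g k x s - moll g k x t" "\<lambda>s. ?A * (M * (R * \<bar>s - t\<bar>) powr a)" "at t"]
      by (simp add: eventually_at_filter)
    then show ?thesis by (rule LIM_zero_cancel)
  qed
  then show ?thesis unfolding continuous_on_def using tendsto_within_subset[OF _ subset_UNIV] by blast
qed

text \<open>
  A kernel of mean zero gains a factor \<open>s\<^sup>a\<close>; interpolating with the Hoelder bound trades part
  of it for \<open>norm (x - y) powr b\<close>, which leaves an integrable singularity in \<open>s\<close>.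
\<close>

lemma moll_mean_zero:
  fixes g k :: "real^'n \<Rightarrow> real"
  assumes g: "holder_bd a M UNIV g" and a: "0 < a" "a \<le> 1" and M: "0 \<le> M"
    and k: "continuous_on UNIV k" "\<And>w. R < norm w \<Longrightarrow> k w = 0" and R: "0 \<le> R"
    and z: "integral UNIV k = 0" and s: "0 < s"
  defines "K \<equiv> integral UNIV (\<lambda>w. \<bar>k w\<bar>) * (1 + R) * M"
  shows "\<bar>moll g k x s\<bar> \<le> K * s powr a"
    and "0 < b \<Longrightarrow> b < a \<Longrightarrow> \<bar>moll g k x s - moll g k y s\<bar> \<le> 2 * K * s powr (a - b) * norm (x - y) powr b"
proof -
  have gc: "continuous_on UNIV g" by (rule holder_bd_continuous_on[OF g a(1)])
  let ?A = "integral UNIV (\<lambda>w. \<bar>k w\<bar>)"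
  have A: "0 \<le> ?A" by (rule integral_abs_nonneg)
  then have K: "0 \<le> K" "?A * M \<le> K" using R M by (auto simp: K_def algebra_simps)
  have one: "\<bar>moll g k x s\<bar> \<le> K * s powr a" for x
  proof -
    have "\<bar>moll g k x s - moll g k x 0\<bar> \<le> ?A * (M * ((1 + R) * s powr a))"
    proof (rule moll_diff_le[OF gc k])
      fix w :: "real^'n" assume w: "norm w \<le> R"
      have "\<bar>g (x - s *\<^sub>R w) - g (x - 0 *\<^sub>R w)\<bar> \<le> M * norm (s *\<^sub>R w) powr a"
        using holder_bdD(2)[OF g, of "x - s *\<^sub>R w" "x - 0 *\<^sub>R w"] by simp
      also have "norm (s *\<^sub>R w) powr a \<le> ((1 + R) * s) powr a"
        using w s a by (intro powr_mono2) (auto simp: mult.commute mult_right_mono)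
      also have "((1 + R) * s) powr a = (1 + R) powr a * s powr a" using R s by (simp add: powr_mult)
      also have "(1 + R) powr a \<le> (1 + R) powr 1" using R a by (intro powr_mono) auto
      finally show "\<bar>g (x - s *\<^sub>R w) - g (x - 0 *\<^sub>R w)\<bar> \<le> M * ((1 + R) * s powr a)"
        using R M by (simp add: mult_left_mono mult_right_mono)
    qed
    then show ?thesis using z by (simp add: moll_zero_scale K_def mult_ac)
  qed
  show "\<bar>moll g k x s\<bar> \<le> K * s powr a" by (rule one)
  assume b: "0 < b" "b < a"
  let ?d = "norm (x - y)"
  have two: "\<bar>moll g k x s - moll g k y s\<bar> \<le> K * ?d powr a"
  proof -
    have "\<bar>moll g k x s - moll g k y s\<bar> \<le> ?A * (M * ?d powr a)"
    proof (rule moll_diff_le[OF gc k])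
      fix w :: "real^'n"
      show "\<bar>g (x - s *\<^sub>R w) - g (y - s *\<^sub>R w)\<bar> \<le> M * ?d powr a"
        using holder_bdD(2)[OF g, of "x - s *\<^sub>R w" "y - s *\<^sub>R w"] by simp
    qed
    also have "\<dots> \<le> K * ?d powr a" using mult_right_mono[OF K(2), of "?d powr a"] by (simp add: mult_ac)
    finally show ?thesis .
  qed
  have three: "\<bar>moll g k x s - moll g k y s\<bar> \<le> 2 * K * s powr a"
    using one[of x] one[of y] by linarith
  \<comment> \<open>For points within distance \<open>s\<close> the Hoelder bound
    \<open>K * ?d powr a\<close> is used, for the others the mean zero bound
    \<open>2 * K * s powr a\<close>; both lie below the mixed product.\<close>
  show "\<bar>moll g k x s - moll g k y s\<bar> \<le> 2 * K * s powr (a - b) * ?d powr b"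
  proof (cases "?d \<le> s")
    case True
    have "?d powr a = ?d powr (a - b) * ?d powr b" by (simp add: powr_add[symmetric])
    also have "\<dots> \<le> s powr (a - b) * ?d powr b"
      using True b by (intro mult_right_mono powr_mono2) auto
    finally have "K * ?d powr a \<le> K * (s powr (a - b) * ?d powr b)" using K(1) by (rule mult_left_mono)
    moreover have "0 \<le> K * (s powr (a - b) * ?d powr b)" using K(1) by simp
    ultimately show ?thesis using two by (simp add: mult.assoc)
  next
    case False
    have "s powr a = s powr (a - b) * s powr b" by (simp add: powr_add[symmetric])
    also have "\<dots> \<le> s powr (a - b) * ?d powr b"
      using False s b by (intro mult_left_mono powr_mono2) auto
    finally have "2 * K * s powr a \<le> 2 * K * (s powr (a - b) * ?d powr b)" using K(1) by (intro mult_left_mono) auto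
    then show ?thesis using three by (simp add: mult.assoc)
  qed
qed

text \<open>One component of the flux is a superposition of mollifications over all scales in (0,1).
  The integral for \<open>d j\<close> converges because \<open>dk w $ j\<close> has mean zero, but
  its integrand is singular at 0 and so escapes the usual Leibniz rule; differentiability follows
  from a remainder estimate that is integrable in \<open>s\<close>.\<close>

lemma transport_component:
  fixes g k :: "real^'n \<Rightarrow> real"
  assumes g: "holder_bd a M UNIV g" and a: "0 < a" "a \<le> 1" and M: "0 \<le> M" and k: "C1_kernel k dk R"
  defines "u \<equiv> \<lambda>x. integral {0<..<1} (\<lambda>s. moll g k x s)"
    and "d \<equiv> \<lambda>j x. integral {0<..<1} (\<lambda>s. (1 / s) * moll g (\<lambda>w. dk w $ j) x s)"
    and "A \<equiv> integral UNIV (\<lambda>w. \<bar>k w\<bar>) * 2"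
    and "B \<equiv> (\<Sum>j\<in>UNIV. integral UNIV (\<lambda>w. \<bar>dk w $ j\<bar>)) * (1 + R)"
  shows "(\<lambda>s. (1 / s) * moll g (\<lambda>w. dk w $ j) x s) integrable_on {0<..<1}"
    and "0 < b \<Longrightarrow> b < a \<Longrightarrow> holder_bd b (A * M) UNIV u"
    and "((\<lambda>t. u (x + t *\<^sub>R axis j 1)) has_real_derivative d j x) (at 0)"
    and "0 < b \<Longrightarrow> b < a \<Longrightarrow> holder_bd b (B * (1 / a + 2 / (a - b)) * M) UNIV (d j)"
proof -
  note kd = C1_kernelD[OF k]
  have gc: "continuous_on UNIV g" by (rule holder_bd_continuous_on[OF g a(1)])
  have dkj: "continuous_on UNIV (\<lambda>w. dk w $ j)" "\<And>w. R < norm w \<Longrightarrow> dk w $ j = 0"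
    "integral UNIV (\<lambda>w. dk w $ j) = 0" for j
    using integral_kernel_deriv[OF k, of "axis j 1"]
    by (auto intro!: continuous_intros kd simp: kd(5) inner_axis)
  define E where "E j x s = (1 / s) * moll g (\<lambda>w. dk w $ j) x s" for j x s
  define K where "K = B * M"
  have R: "0 \<le> R" by (rule kd(1))
  \<comment> \<open>\<open>B\<close> sums over all directions, so that \<open>K\<close> dominates
    each of them.\<close>
  have Kj: "integral UNIV (\<lambda>w. \<bar>dk w $ j\<bar>) * (1 + R) * M \<le> K" for j
    unfolding K_def B_def using R M
    by (intro mult_right_mono member_le_sum) (auto intro: integral_abs_nonneg)
  have K0: "0 \<le> K" unfolding K_def B_def using R M
    by (intro mult_nonneg_nonneg sum_nonneg integral_abs_nonneg) auto
  have Ec: "continuous_on {0<..<1} (E j x)" for j x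
    unfolding E_def by (intro continuous_intros moll_continuous_scale[OF g a(1) M dkj(1,2) R]) auto
  have Eb: "\<bar>E j x s\<bar> \<le> K * s powr (a - 1)" if "0 < s" for j x s
  proof -
    have "\<bar>moll g (\<lambda>w. dk w $ j) x s\<bar> \<le> K * s powr a"
      using moll_mean_zero(1)[OF g a M dkj(1,2) R dkj(3) that, of j x] mult_right_mono[OF Kj[of j], of "s powr a"] by simp
    then have "(1 / s) * \<bar>moll g (\<lambda>w. dk w $ j) x s\<bar> \<le> (1 / s) * (K * s powr a)"
      using that by (intro mult_left_mono) auto
    then show ?thesis using that by (simp add: E_def abs_mult powr_diff)
  qed
  have Eh: "\<bar>E j x s - E j y s\<bar> \<le> 2 * K * norm (x - y) powr b * s powr (a - b - 1)"
    if s: "0 < s" and b: "0 < b" "b < a" for j x y s b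
  proof -
    have "\<bar>moll g (\<lambda>w. dk w $ j) x s - moll g (\<lambda>w. dk w $ j) y s\<bar>
        \<le> 2 * (integral UNIV (\<lambda>w. \<bar>dk w $ j\<bar>) * (1 + R) * M) * (s powr (a - b) * norm (x - y) powr b)"
      using moll_mean_zero(2)[OF g a M dkj(1,2) R dkj(3) s b, of j x y] by (simp add: mult.assoc)
    also have "\<dots> \<le> 2 * K * (s powr (a - b) * norm (x - y) powr b)"
      using Kj[of j] by (intro mult_right_mono) auto
    finally have "(1 / s) * \<bar>moll g (\<lambda>w. dk w $ j) x s - moll g (\<lambda>w. dk w $ j) y s\<bar>
        \<le> (1 / s) * (2 * K * (s powr (a - b) * norm (x - y) powr b))"
      using s by (intro mult_left_mono) auto
    then show ?thesis using s
      by (simp add: E_def abs_mult powr_diff[of s "a - b" 1] right_diff_distrib[symmetric] diff_divide_distrib[symmetric] mult_ac)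
  qed
  have Ei: "E j x integrable_on {0<..<1}" for j x
    by (rule singular_integral_bound(1)[where K = K and p = "a - 1", OF Ec]) (use Eb a in auto)
  then show "(\<lambda>s. (1 / s) * moll g (\<lambda>w. dk w $ j) x s) integrable_on {0<..<1}" by (simp add: E_def[abs_def])
  define J where "J x s = moll g k x s" for x s
  have Jc: "continuous_on {0<..<1} (J x)" for x
    unfolding J_def by (rule moll_continuous_scale[OF g a(1) M kd(6,4) R])
  let ?Ak = "integral UNIV (\<lambda>w. \<bar>k w\<bar>)"
  have Jb: "\<bar>J x s\<bar> \<le> ?Ak * M" for x s
    unfolding J_def using holder_bdD(1)[OF g] by (intro moll_le[OF gc kd(6,4)]) auto
  have Ji: "J x integrable_on {0<..<1}" for x
    by (rule singular_integral_bound(1)[where K = "?Ak * M" and p = 0, OF Jc]) (use Jb in auto)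
  have Jh: "\<bar>J x s - J y s\<bar> \<le> ?Ak * M * norm (x - y) powr a" for x y s
    unfolding J_def mult.assoc
  proof (rule moll_diff_le[OF gc kd(6,4)])
    fix w :: "real^'n"
    show "\<bar>g (x - s *\<^sub>R w) - g (y - s *\<^sub>R w)\<bar> \<le> M * norm (x - y) powr a"
      using holder_bdD(2)[OF g, of "x - s *\<^sub>R w" "y - s *\<^sub>R w"] by simp
  qed
  have uh: "holder_bd a (?Ak * M) UNIV u"
  proof (rule holder_bdI)
    show "\<bar>u x\<bar> \<le> ?Ak * M" for x
      using singular_integral_bound(2)[where K = "?Ak * M" and p = 0, OF Jc] Jb by (simp add: u_def J_def[abs_def])
    fix x y
    have "u x - u y = integral {0<..<1} (\<lambda>s. J x s - J y s)"
      unfolding u_def J_def[symmetric] by (rule integral_diff[OF Ji Ji, symmetric])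
    then show "\<bar>u x - u y\<bar> \<le> ?Ak * M * norm (x - y) powr a"
      using singular_integral_bound(2)[where K = "?Ak * M * norm (x - y) powr a" and p = 0,
          OF continuous_on_diff[OF Jc[of x] Jc[of y]]] Jh[of x _ y]
      by simp
  qed
  have Ak: "0 \<le> ?Ak" by (rule integral_abs_nonneg)
  show "holder_bd b (A * M) UNIV u" if "0 < b" "b < a"
    using holder_bd_exponent_mono[OF uh that(1) less_imp_le[OF that(2)]] Ak M by (simp add: A_def mult_ac)
  show "holder_bd b (B * (1 / a + 2 / (a - b)) * M) UNIV (d j)" if b: "0 < b" "b < a" for b j
  proof (rule holder_bdI)
    have e: "B * (1 / a + 2 / (a - b)) * M = K / a + 2 * K / (a - b)"
      unfolding K_def using a b by (simp add: field_simps)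
    have nn: "0 \<le> K / a" "0 \<le> 2 * K / (a - b)" using K0 a b by auto
    fix x y
    have "\<bar>d j x\<bar> \<le> K / (a - 1 + 1)"
      unfolding d_def E_def[symmetric]
      by (rule singular_integral_bound(2)[OF Ec]) (use Eb a in auto)
    then show "\<bar>d j x\<bar> \<le> B * (1 / a + 2 / (a - b)) * M" unfolding e using nn by simp
    have "d j x - d j y = integral {0<..<1} (\<lambda>s. E j x s - E j y s)"
      unfolding d_def E_def[symmetric] by (rule integral_diff[OF Ei Ei, symmetric])
    also have "\<bar>\<dots>\<bar> \<le> 2 * K * norm (x - y) powr b / (a - b - 1 + 1)"
      by (rule singular_integral_bound(2)[OF continuous_on_diff[OF Ec[of j x] Ec[of j y]]])
        (use Eh[OF _ b] b in auto)
    also have "\<dots> = 2 * K / (a - b) * norm (x - y) powr b" by simp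
    also have "\<dots> \<le> (K / a + 2 * K / (a - b)) * norm (x - y) powr b"
      using nn by (intro mult_right_mono) auto
    finally show "\<bar>d j x - d j y\<bar> \<le> B * (1 / a + 2 / (a - b)) * M * norm (x - y) powr b" unfolding e .
  qed
  show "((\<lambda>t. u (x + t *\<^sub>R axis j 1)) has_real_derivative d j x) (at 0)"
  proof -
    \<comment> \<open>Any exponent strictly between 0 and \<open>a\<close> works: positive so that
      the remainder is o(h), below \<open>a\<close> so that it is integrable in
      \<open>s\<close>.\<close>
    define b where "b = a / 2"
    have b: "0 < b" "b < a" using a by (auto simp: b_def)
    have Jd: "((\<lambda>t. J (y + t *\<^sub>R axis j 1) s) has_real_derivative E j y s) (at 0)" if s: "0 < s" for y s
      using moll_has_derivative[OF gc k zero_less_one, of "\<lambda>_. s" "\<lambda>_. 0" y "axis j 1"] s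
      by (simp add: J_def E_def inner_axis)
    have Jd': "((\<lambda>t. J (x + t *\<^sub>R axis j 1) s) has_real_derivative E j (x + \<tau> *\<^sub>R axis j 1) s) (at \<tau>)"
      if s: "0 < s" for \<tau> s
    proof -
      have "((\<lambda>t. J (x + (t + \<tau>) *\<^sub>R axis j 1) s) has_real_derivative E j (x + \<tau> *\<^sub>R axis j 1) s) (at 0)"
        using Jd[OF s, of "x + \<tau> *\<^sub>R axis j 1"] by (simp add: scaleR_left_distrib add_ac)
      then show ?thesis using DERIV_shift[of "\<lambda>t. J (x + t *\<^sub>R axis j 1) s" _ 0 \<tau>] by simp
    qed
    \<comment> \<open>Mean value inequality along the segment: the Hoelder bound on \<open>E\<close>
      becomes a remainder of order \<open>\<bar>h\<bar> powr (1 + b)\<close> with an integrable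
      weight in \<open>s\<close>.\<close>
    have rem: "\<bar>J (x + h *\<^sub>R axis j 1) s - J x s - h * E j x s\<bar> \<le> 2 * K * \<bar>h\<bar> powr b * \<bar>h\<bar> * s powr (a - b - 1)"
      if s: "0 < s" for h s
    proof -
      let ?S = "closed_segment 0 h"
      have "norm ((J (x + h *\<^sub>R axis j 1) s - E j x s * h) - (J (x + 0 *\<^sub>R axis j 1) s - E j x s * 0))
          \<le> (2 * K * \<bar>h\<bar> powr b * s powr (a - b - 1)) * norm (h - 0)"
      proof (rule field_differentiable_bound[of ?S "\<lambda>t. J (x + t *\<^sub>R axis j 1) s - E j x s * t"
            "\<lambda>t. E j (x + t *\<^sub>R axis j 1) s - E j x s"])
        fix t assume t: "t \<in> ?S"
        show "((\<lambda>t. J (x + t *\<^sub>R axis j 1) s - E j x s * t) has_field_derivative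
            E j (x + t *\<^sub>R axis j 1) s - E j x s) (at t within ?S)"
          using Jd'[OF s, of t] by (auto intro!: derivative_eq_intros intro: has_field_derivative_at_within)
        have th: "\<bar>t\<bar> \<le> \<bar>h\<bar>" using t by (auto simp: closed_segment_eq_real_ivl split: if_splits)
        have "\<bar>E j (x + t *\<^sub>R axis j 1) s - E j x s\<bar> \<le> 2 * K * \<bar>t\<bar> powr b * s powr (a - b - 1)"
          using Eh[OF s b, of j "x + t *\<^sub>R axis j 1" x] by simp
        also have "\<dots> \<le> 2 * K * \<bar>h\<bar> powr b * s powr (a - b - 1)"
          using th b K0 by (intro mult_right_mono mult_left_mono powr_mono2) auto
        finally show "norm (E j (x + t *\<^sub>R axis j 1) s - E j x s) \<le> 2 * K * \<bar>h\<bar> powr b * s powr (a - b - 1)" by simp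
      qed auto
      then show ?thesis by (simp add: mult_ac)
    qed
    define Q where "Q = 2 * K / (a - b)"
    have quot: "\<bar>u (x + h *\<^sub>R axis j 1) - u x - h * d j x\<bar> \<le> Q * \<bar>h\<bar> powr b * \<bar>h\<bar>" for h
    proof -
      have "u (x + h *\<^sub>R axis j 1) - u x - h * d j x
          = integral {0<..<1} (\<lambda>s. J (x + h *\<^sub>R axis j 1) s - J x s - h * E j x s)"
        unfolding u_def d_def J_def[symmetric] E_def[symmetric]
        by (simp add: integral_diff integral_mult_right integrable_diff integrable_on_mult_right Ji Ei)
      also have "\<bar>\<dots>\<bar> \<le> 2 * K * \<bar>h\<bar> powr b * \<bar>h\<bar> / (a - b - 1 + 1)"
        by (rule singular_integral_bound(2)) (use rem b in \<open>auto intro!: continuous_intros Jc Ec\<close>)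
      finally show ?thesis by (simp add: Q_def)
    qed
    have "((\<lambda>h. (u (x + h *\<^sub>R axis j 1) - u x) / h - d j x) \<longlongrightarrow> 0) (at 0)"
    proof (rule Lim_null_comparison)
      show "\<forall>\<^sub>F h in at 0. norm ((u (x + h *\<^sub>R axis j 1) - u x) / h - d j x) \<le> Q * \<bar>h\<bar> powr b"
        unfolding eventually_at_filter
      proof (intro always_eventually allI impI)
        fix h :: real assume h: "h \<noteq> 0"
        have "(u (x + h *\<^sub>R axis j 1) - u x) / h - d j x = (u (x + h *\<^sub>R axis j 1) - u x - h * d j x) / h"
          using h by (simp add: field_simps)
        then have "norm ((u (x + h *\<^sub>R axis j 1) - u x) / h - d j x) = \<bar>u (x + h *\<^sub>R axis j 1) - u x - h * d j x\<bar> / \<bar>h\<bar>"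
          by simp
        also have "\<dots> \<le> Q * \<bar>h\<bar> powr b" using quot[of h] h by (simp add: pos_divide_le_eq)
        finally show "norm ((u (x + h *\<^sub>R axis j 1) - u x) / h - d j x) \<le> Q * \<bar>h\<bar> powr b" .
      qed
      show "((\<lambda>h. Q * \<bar>h\<bar> powr b) \<longlongrightarrow> 0) (at (0::real))"
        using tendsto_dist_powr_zero[OF zero_le_one b(1), of Q 0] by simp
    qed
    then have "((\<lambda>h. (u (x + h *\<^sub>R axis j 1) - u x) / h) \<longlongrightarrow> d j x) (at 0)" by (rule LIM_zero_cancel)
    then show ?thesis by (simp add: DERIV_def)
  qed
qed

text \<open>The flux has components with kernels \<open>w $ i * \<omega> w\<close>. The diagonal of
  their derivatives sums to the Euler kernel
  \<open>n * \<omega> w + d\<omega> w \<bullet> w\<close>, and mollification with it, divided by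
  \<open>s\<close>, is minus the derivative of \<open>moll g \<omega> x s\<close> in
  \<open>s\<close>. Integrating over the scales leaves the value at 0, which is \<open>g x\<close>,
  minus the value at 1.\<close>

lemma transport_solution:
  fixes \<Omega> :: "(real^'n) set"
  assumes a: "0 < a" "a \<le> 1" and k: "C1_kernel \<omega> d\<omega> R" and one: "integral UNIV \<omega> = 1"
  shows "\<exists>C. (\<forall>b. 0 < b \<and> b < a \<longrightarrow> 0 \<le> C b) \<and> (\<forall>g M. 0 \<le> M \<longrightarrow> holder_bd a M UNIV g \<longrightarrow>
     (\<forall>x w. \<forall>s\<in>{0<..<1}. \<omega> w \<noteq> 0 \<and> g (x - s *\<^sub>R w) \<noteq> 0 \<longrightarrow> x \<in> \<Omega>) \<longrightarrow>
     (\<exists>u. div_solution \<Omega> a C M u (\<lambda>x. g x - moll g \<omega> x 1)))"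
proof -
  note kd = C1_kernelD[OF k]
  define ki where "ki i w = w $ i * \<omega> w" for i :: 'n and w
  define dki where "dki i w = \<omega> w *\<^sub>R axis i 1 + w $ i *\<^sub>R d\<omega> w" for i w
  have ki: "C1_kernel (ki i) (dki i) R" for i
    unfolding ki_def[abs_def] dki_def[abs_def] by (rule C1_kernel_coordinate_mult[OF k])
  define A where "A i = integral UNIV (\<lambda>w. \<bar>ki i w\<bar>) * 2" for i
  define B where "B i = (\<Sum>j\<in>UNIV. integral UNIV (\<lambda>w. \<bar>dki i w $ j\<bar>)) * (1 + R)" for i
  define C where "C b = (\<Sum>i\<in>UNIV. A i + B i * (1 / a + 2 / (a - b)))" for b
  have AB: "0 \<le> A i" "0 \<le> B i" for i
    using kd(1) by (auto simp: A_def B_def intro!: mult_nonneg_nonneg sum_nonneg integral_abs_nonneg)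
  have Ci: "A i \<le> C b" "B i * (1 / a + 2 / (a - b)) \<le> C b" "0 \<le> C b" if b: "0 < b" "b < a" for i b
  proof -
    have nn: "0 \<le> B i * (1 / a + 2 / (a - b))" for i using AB(2)[of i] a b by simp
    have "A i + B i * (1 / a + 2 / (a - b)) \<le> C b"
      unfolding C_def using AB nn by (intro member_le_sum) (auto intro: add_nonneg_nonneg)
    then show "A i \<le> C b" "B i * (1 / a + 2 / (a - b)) \<le> C b" "0 \<le> C b"
      using AB(1)[of i] nn[of i] by linarith+
  qed
  show ?thesis
  proof (rule exI[of _ C], intro conjI allI impI)
    show "0 \<le> C b" if "0 < b \<and> b < a" for b using Ci(3) that by blast
    fix g M assume M: "0 \<le> M" and g: "holder_bd a M UNIV g"
      and sup: "\<forall>x w. \<forall>s\<in>{0<..<1}. \<omega> w \<noteq> 0 \<and> g (x - s *\<^sub>R w) \<noteq> 0 \<longrightarrow> x \<in> \<Omega>"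
    have gc: "continuous_on UNIV g" by (rule holder_bd_continuous_on[OF g a(1)])
    define u :: "real^'n \<Rightarrow> real^'n" where "u x = (\<chi> i. integral {0<..<1} (\<lambda>s. moll g (ki i) x s))" for x
    define d where "d i j x = integral {0<..<1} (\<lambda>s. (1 / s) * moll g (\<lambda>w. dki i w $ j) x s)" for i j x
    note tc = transport_component[OF g a M ki, folded A_def B_def d_def]
    have ui: "(\<lambda>x. u x $ i) = (\<lambda>x. integral {0<..<1} (\<lambda>s. moll g (ki i) x s))" for i
      by (simp add: u_def)
    have der: "((\<lambda>t. u (x + t *\<^sub>R axis j 1) $ i) has_real_derivative d i j x) (at 0)" for x i j
      unfolding u_def vec_lambda_beta by (rule tc(3))
    have "div_solution \<Omega> a C M u (\<lambda>x. g x - moll g \<omega> x 1)"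
      unfolding div_solution_def
    proof (intro conjI allI impI)
      fix x assume x: "x \<notin> \<Omega>"
      have "moll g (ki i) x s = 0" if "s \<in> {0<..<1}" for i s
      proof -
        have "(\<lambda>w. ki i w * g (x - s *\<^sub>R w)) = (\<lambda>w. 0)"
          using sup x that by (metis (no_types, opaque_lifting) ki_def mult_eq_0_iff)
        then show ?thesis by (simp add: moll_def)
      qed
      then have "integral {0<..<1} (\<lambda>s. moll g (ki i) x s) = integral {0<..<1::real} (\<lambda>s. 0)" for i
        by (rule integral_cong)
      then show "u x = 0" by (simp add: u_def vec_eq_iff)
    next
      fix b i assume b: "0 < b \<and> b < a"
      show "C1_holder b (C b * M) UNIV (\<lambda>x. u x $ i)"
      proof (rule C1_holderI[OF _ der])
        show "holder_bd b (C b * M) UNIV (\<lambda>x. u x $ i)"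
          unfolding ui by (rule holder_bd_mono[OF tc(2)]) (use b Ci M in \<open>auto intro: mult_right_mono\<close>)
        show "holder_bd b (C b * M) UNIV (d i j)" for j
          by (rule holder_bd_mono[OF tc(4)]) (use b Ci M in \<open>auto intro: mult_right_mono\<close>)
      qed
    next
      fix x
      define euler where "euler w = real CARD('n) * \<omega> w + d\<omega> w \<bullet> w" for w
      have tr: "(\<Sum>i\<in>UNIV. dki i w $ i) = euler w" for w
        by (simp add: dki_def euler_def sum.distrib inner_vec_def mult.commute)
      have "divergence u x = (\<Sum>i\<in>UNIV. d i i x)"
        unfolding divergence_def by (intro sum.cong refl partial_deriv_eqI der)
      also have "\<dots> = integral {0<..<1} (\<lambda>s. \<Sum>i\<in>UNIV. (1 / s) * moll g (\<lambda>w. dki i w $ i) x s)"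
        unfolding d_def using tc(1) by (subst integral_sum) auto
      also have "\<dots> = integral {0<..<1} (\<lambda>s. (1 / s) * moll g euler x s)"
      proof (intro integral_cong)
        fix s
        have "(\<lambda>w. dki i w $ i * g (x - s *\<^sub>R w)) integrable_on UNIV" for i
          by (rule moll_integrable[OF gc, where R = R])
            (auto intro!: continuous_intros C1_kernelD(3)[OF ki] simp: C1_kernelD(5)[OF ki])
        then have "(\<Sum>i\<in>UNIV. moll g (\<lambda>w. dki i w $ i) x s) = moll g euler x s"
          unfolding moll_def tr[symmetric] sum_distrib_right by (intro integral_sum[symmetric]) auto
        then show "(\<Sum>i\<in>UNIV. (1 / s) * moll g (\<lambda>w. dki i w $ i) x s) = (1 / s) * moll g euler x s"
          by (simp only: sum_distrib_left[symmetric])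
      qed
      also have "\<dots> = g x - moll g \<omega> x 1"
      proof -
        \<comment> \<open>The derivative formula holds for \<open>s > 0\<close> only, hence the
          version of the theorem that asks for mere continuity at the endpoints.\<close>
        have ftc: "((\<lambda>s. - ((1 / s) * moll g euler x s)) has_integral (moll g \<omega> x 1 - moll g \<omega> x 0)) {0..1}"
        proof (rule fundamental_theorem_of_calculus_interior)
          show "continuous_on {0..1} (\<lambda>s. moll g \<omega> x s)"
            by (rule moll_continuous_scale[OF g a(1) M kd(6,4,1)])
          fix s :: real assume s: "s \<in> {0<..<1}"
          have "((\<lambda>\<tau>. moll g \<omega> (x + \<tau> *\<^sub>R 0) (s + \<tau>)) has_real_derivative
              (1 / (s + 0)) * (moll g (\<lambda>w. d\<omega> w \<bullet> 0) x (s + 0) - 1 * moll g euler x (s + 0))) (at 0)"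
            unfolding euler_def[abs_def]
            by (rule moll_has_derivative[OF gc k, where \<delta> = s and t' = "\<lambda>_. 1"])
              (use s in \<open>auto intro!: continuous_intros derivative_eq_intros\<close>)
          then have "((\<lambda>\<tau>. moll g \<omega> x (\<tau> + s)) has_real_derivative - ((1 / s) * moll g euler x s)) (at 0)"
            by (simp add: moll_def add.commute)
          then have "((\<lambda>\<tau>. moll g \<omega> x \<tau>) has_real_derivative - ((1 / s) * moll g euler x s)) (at s)"
            using DERIV_shift[of "\<lambda>\<tau>. moll g \<omega> x \<tau>" _ 0 s] by simp
          then show "((\<lambda>\<tau>. moll g \<omega> x \<tau>) has_vector_derivative - ((1 / s) * moll g euler x s)) (at s)"
            by (rule has_real_derivative_iff_has_vector_derivative[THEN iffD1])
        qed simp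
        have "((\<lambda>s. (1 / s) * moll g euler x s) has_integral (g x - moll g \<omega> x 1)) {0..1}"
          using has_integral_neg[OF ftc] by (simp add: moll_zero_scale one)
        then show ?thesis by (simp add: has_integral_Icc_iff_Ioo integral_unique)
      qed
      finally show "divergence u x = g x - moll g \<omega> x 1" .
    qed
    then show "\<exists>u. div_solution \<Omega> a C M u (\<lambda>x. g x - moll g \<omega> x 1)" by blast
  qed
qed

subsection \<open>Contraction to a fixed profile\<close>

text \<open>With \<Phi> the bump this is, up to sign, a component of the contraction field; with
  \<Phi> a partial derivative of the bump it is a derivative of that component. The kernel is
  Lipschitz in \<open>x\<close> with no singular factor, and \<open>norm (y - x0) \<le> s\<close>
  wherever \<open>g\<close> is nonzero.\<close>

lemma contraction_component:
  fixes g \<Phi> :: "real^'n \<Rightarrow> real" and c x0 :: "real^'n" and i :: 'n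
  assumes g: "continuous_on UNIV g" "\<And>y. \<bar>g y\<bar> \<le> M" "\<And>y. g y \<noteq> 0 \<Longrightarrow> norm (y - x0) \<le> s"
    and M: "0 \<le> M" and s: "0 \<le> s" and \<Phi>: "holder_bd 1 L UNIV \<Phi>" and L: "0 \<le> L"
  defines "V \<equiv> \<lambda>x. integral (cbox (-c, 0) (c, 1)) (\<lambda>z. g (fst z) * (fst z - x0) $ i * \<Phi> (x - x0 - snd z *\<^sub>R (fst z - x0)))"
  shows "holder_bd 1 (measure lborel (cbox (-c, 0::real) (c, 1)) * (s * L) * M) UNIV V"
proof -
  define Z where "Z = cbox (-c, 0::real) (c, 1)"
  have gs: "\<bar>g y * (y - x0) $ i\<bar> \<le> M * s" for y
  proof (cases "g y = 0")
    case False
    then have "\<bar>(y - x0) $ i\<bar> \<le> s" using g(3)[of y] component_le_norm_cart[of "y - x0" i] by linarith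
    then show ?thesis using g(2)[of y] M s unfolding abs_mult by (intro mult_mono) auto
  qed (use M s in simp)
  have \<Phi>c: "continuous_on UNIV \<Phi>" by (rule holder_bd_continuous_on[OF \<Phi>]) simp
  have int: "(\<lambda>z. g (fst z) * (fst z - x0) $ i * \<Phi> (x - x0 - snd z *\<^sub>R (fst z - x0))) integrable_on Z" for x
    unfolding Z_def
    by (intro integrable_continuous continuous_intros continuous_on_compose2[OF g(1)] continuous_on_compose2[OF \<Phi>c]) auto
  have bound: "\<bar>integral Z h\<bar> \<le> B * measure lborel Z" if "h integrable_on Z" "0 \<le> B" "\<And>z. z \<in> Z \<Longrightarrow> \<bar>h z\<bar> \<le> B" for h B
    using has_integral_bound[of B h "integral Z h" "(-c, 0)" "(c, 1)"] that
    by (simp add: Z_def integrable_integral)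
  show ?thesis
    unfolding holder_bd_one_iff
  proof (intro conjI ballI)
    fix x y
    have "\<bar>V x\<bar> \<le> (M * s * L) * measure lborel Z"
      unfolding V_def Z_def[symmetric]
    proof (rule bound[OF int])
      show "\<bar>g (fst z) * (fst z - x0) $ i * \<Phi> (x - x0 - snd z *\<^sub>R (fst z - x0))\<bar> \<le> M * s * L" for z
        using gs[of "fst z"] holder_bdD(1)[OF \<Phi>, of "x - x0 - snd z *\<^sub>R (fst z - x0)"] M s
        unfolding abs_mult[of "g (fst z) * (fst z - x0) $ i"] by (intro mult_mono) auto
    qed (use M s L in auto)
    then show "\<bar>V x\<bar> \<le> measure lborel (cbox (-c, 0::real) (c, 1)) * (s * L) * M"
      by (simp add: Z_def mult_ac)
    have "V x - V y = integral Z (\<lambda>z. g (fst z) * (fst z - x0) $ i * \<Phi> (x - x0 - snd z *\<^sub>R (fst z - x0))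
        - g (fst z) * (fst z - x0) $ i * \<Phi> (y - x0 - snd z *\<^sub>R (fst z - x0)))"
      unfolding V_def Z_def[symmetric] by (rule integral_diff[OF int int, symmetric])
    also have "\<bar>\<dots>\<bar> \<le> (M * s * (L * norm (x - y))) * measure lborel Z"
    proof (rule bound[OF integrable_diff[OF int int]])
      fix z
      let ?x = "x - x0 - snd z *\<^sub>R (fst z - x0)" and ?y = "y - x0 - snd z *\<^sub>R (fst z - x0)"
      have "\<bar>\<Phi> ?x - \<Phi> ?y\<bar> \<le> L * norm (x - y)"
        using holder_bdD(2)[OF \<Phi>, of ?x ?y] by simp
      then show "\<bar>g (fst z) * (fst z - x0) $ i * \<Phi> ?x - g (fst z) * (fst z - x0) $ i * \<Phi> ?y\<bar> \<le> M * s * (L * norm (x - y))"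
        using gs[of "fst z"] M s unfolding right_diff_distrib[symmetric] abs_mult[of "g (fst z) * (fst z - x0) $ i"]
        by (intro mult_mono) auto
    qed (use M s L in auto)
    finally show "\<bar>V x - V y\<bar> \<le> measure lborel (cbox (-c, 0::real) (c, 1)) * (s * L) * M * norm (x - y)"
      by (simp add: Z_def mult_ac)
  qed
qed

text \<open>\<open>moll g \<omega> x 1\<close> is a superposition of bumps centred at
  \<open>y + \<zeta>0\<close> with weights \<open>g y\<close>. Each is slid along a segment to
  \<open>x0 + \<zeta>0\<close>, where all of them merge; \<open>dom\<close> says that the sliding
  bumps stay in \<Omega>.\<close>

lemma contraction_solution:
  fixes \<Omega> :: "(real^'n) set" and x0 \<zeta>0 :: "real^'n"
  assumes a: "0 < a" "a \<le> 1" and s: "0 < s" and r: "0 < r"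
    and dom: "\<And>y \<zeta> \<tau>. y \<in> ball x0 s \<Longrightarrow> \<zeta> \<in> cball \<zeta>0 r \<Longrightarrow> \<tau> \<in> {0..1} \<Longrightarrow> x0 + \<tau> *\<^sub>R (y - x0) + \<zeta> \<in> \<Omega>"
  shows "\<exists>C. (\<forall>b. 0 < b \<and> b < a \<longrightarrow> 0 \<le> C b) \<and> (\<forall>g M. 0 \<le> M \<longrightarrow> holder_bd a M UNIV g \<longrightarrow>
     (\<forall>y. g y \<noteq> 0 \<longrightarrow> y \<in> ball x0 s) \<longrightarrow>
     (\<exists>u. div_solution \<Omega> a C M u (\<lambda>x. moll g (nbump \<zeta>0 r) x 1 - integral UNIV g * nbump (x0 + \<zeta>0) r x)))"
proof -
  define \<omega> where "\<omega> = nbump \<zeta>0 r"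
  define d\<omega> where "d\<omega> = dnbump \<zeta>0 r"
  have k: "C1_kernel \<omega> d\<omega> (norm \<zeta>0 + r)" unfolding \<omega>_def d\<omega>_def by (rule nbump_kernel[OF r])
  note kd = C1_kernelD[OF k]
  obtain L1 where L1: "0 \<le> L1" "holder_bd 1 L1 UNIV \<omega>" using nbump_holder[OF r] \<omega>_def by blast
  obtain L2 where L2: "0 \<le> L2" "\<And>j. holder_bd 1 L2 UNIV (\<lambda>x. d\<omega> x $ j)" using dnbump_holder[OF r] d\<omega>_def by blast
  obtain c :: "real^'n" where c: "cball 0 (norm x0 + s + (norm \<zeta>0 + r)) \<subseteq> cbox (-c) c"
    using cball_subset_symmetric_cbox by blast
  define I where "I = measure lborel (cbox (-c, 0::real) (c, 1))"
  \<comment> \<open>The factor 2 pays for lowering the exponent from 1 to \<open>b\<close>;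
    \<open>L1\<close> serves the field and \<open>L2\<close> its derivatives.\<close>
  define C0 where "C0 = 2 * (I * (s * L1) + I * (s * L2))"
  have I: "0 \<le> I" by (simp add: I_def)
  have C0: "0 \<le> C0" using I s L1 L2 by (simp add: C0_def)
  have CL: "2 * (I * (s * L1)) \<le> C0" "2 * (I * (s * L2)) \<le> C0" using I s L1 L2 by (simp_all add: C0_def)
  show ?thesis
  proof (rule exI[of _ "\<lambda>b. C0"], intro conjI allI impI C0)
    fix g M assume M: "0 \<le> M" and gh: "holder_bd a M UNIV g" and gs: "\<forall>y. g y \<noteq> 0 \<longrightarrow> y \<in> ball x0 s"
    have gc: "continuous_on UNIV g" by (rule holder_bd_continuous_on[OF gh a(1)])
    have gM: "\<bar>g y\<bar> \<le> M" for y using holder_bdD(1)[OF gh] by blast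
    have gz: "norm (y - x0) \<le> s" if "g y \<noteq> 0" for y using gs that by (auto simp: dist_norm norm_minus_commute less_imp_le)
    have gB: "g y = 0" if "norm x0 + s < norm y" for y
      using gz[of y] norm_triangle_sub[of y x0] that by linarith
    have gbox: "g y = 0" if "y \<notin> cbox (-c) c" for y
    proof (rule gB)
      have "y \<notin> cball 0 (norm x0 + s + (norm \<zeta>0 + r))" using c that by blast
      then have "norm x0 + s + (norm \<zeta>0 + r) < norm y" by simp
      moreover have "0 \<le> norm \<zeta>0" by simp
      ultimately show "norm x0 + s < norm y" using r by linarith
    qed
    define V where "V \<Phi> i x = integral (cbox (-c, 0) (c, 1)) (\<lambda>z. g (fst z) * (fst z - x0) $ i * \<Phi> (x - x0 - snd z *\<^sub>R (fst z - x0)))"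
      for \<Phi> :: "real^'n \<Rightarrow> real" and i x
    \<comment> \<open>The minus sign: mass travels from \<open>y\<close> towards \<open>x0\<close>,
      against \<open>fst z - x0\<close>.\<close>
    define u :: "real^'n \<Rightarrow> real^'n" where "u x = (\<chi> i. - V \<omega> i x)" for x
    note cc = contraction_component[OF gc gM _ M less_imp_le[OF s]]
    have der: "((\<lambda>t. u (x + t *\<^sub>R axis j 1) $ i) has_real_derivative - V (\<lambda>w. d\<omega> w $ j) i x) (at 0)" for x i j
    proof -
      let ?q = "\<lambda>t z. x + t *\<^sub>R axis j 1 - x0 - snd z *\<^sub>R (fst z - x0)"
      have "((\<lambda>t. integral (cbox (-c, 0) (c, 1)) (\<lambda>z. g (fst z) * (fst z - x0) $ i * \<omega> (?q t z)))
          has_field_derivative integral (cbox (-c, 0) (c, 1)) (\<lambda>z. g (fst z) * (fst z - x0) $ i * d\<omega> (?q 0 z) $ j)) (at 0 within UNIV)"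
      proof (rule leibniz_rule_field_derivative)
        fix t and z :: "(real^'n) \<times> real"
        have "((\<lambda>t. ?q t z) has_derivative (\<lambda>h. h *\<^sub>R axis j 1)) (at t)"
          by (auto intro!: derivative_eq_intros)
        from has_derivative_compose[OF this kd(2)]
        have "((\<lambda>t. \<omega> (?q t z)) has_real_derivative d\<omega> (?q t z) $ j) (at t)"
          by (simp add: has_field_derivative_def mult_commute_abs inner_axis)
        then show "((\<lambda>t. g (fst z) * (fst z - x0) $ i * \<omega> (?q t z)) has_field_derivative
            g (fst z) * (fst z - x0) $ i * d\<omega> (?q t z) $ j) (at t within UNIV)"
          by (rule DERIV_cmult)
      next
        show "(\<lambda>z. g (fst z) * (fst z - x0) $ i * \<omega> (?q t z)) integrable_on cbox (-c, 0) (c, 1)" for t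
          by (intro integrable_continuous continuous_intros continuous_on_compose2[OF gc] continuous_on_compose2[OF kd(6)]) auto
        have "continuous_on (UNIV \<times> cbox (-c, 0) (c, 1)) (\<lambda>tz. g (fst (snd tz)) * (fst (snd tz) - x0) $ i * d\<omega> (?q (fst tz) (snd tz)) $ j)"
          by (intro continuous_intros continuous_on_compose2[OF gc] continuous_on_compose2[OF kd(3)]) auto
        then show "continuous_on (UNIV \<times> cbox (-c, 0) (c, 1)) (\<lambda>(t, z). g (fst z) * (fst z - x0) $ i * d\<omega> (?q t z) $ j)"
          by (simp add: case_prod_unfold)
      qed auto
      then show ?thesis unfolding u_def V_def vec_lambda_beta by (intro DERIV_minus) simp
    qed
    have "div_solution \<Omega> a (\<lambda>b. C0) M u (\<lambda>x. moll g \<omega> x 1 - integral UNIV g * nbump (x0 + \<zeta>0) r x)"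
      unfolding div_solution_def
    proof (intro conjI allI impI)
      fix x assume x: "x \<notin> \<Omega>"
      have "V \<omega> i x = integral (cbox (-c, 0::real) (c, 1)) (\<lambda>z. 0)" for i
        unfolding V_def
      proof (rule integral_cong)
        fix z assume "z \<in> cbox (-c, 0::real) (c, 1)"
        then have \<tau>: "snd z \<in> {0..1}" by (cases z) (auto simp: cbox_Pair_eq)
        let ?\<zeta> = "x - x0 - snd z *\<^sub>R (fst z - x0)"
        have "\<omega> ?\<zeta> = 0" if "g (fst z) \<noteq> 0"
        proof (rule ccontr)
          assume "\<omega> ?\<zeta> \<noteq> 0"
          then have "norm (?\<zeta> - \<zeta>0) < r" using nbump_eq_0[OF r, of ?\<zeta> \<zeta>0] unfolding \<omega>_def by force
          then have "?\<zeta> \<in> cball \<zeta>0 r" by (simp add: dist_norm norm_minus_commute)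
          from dom[OF _ this \<tau>] gs that have "x0 + snd z *\<^sub>R (fst z - x0) + ?\<zeta> \<in> \<Omega>" by blast
          then show False using x by simp
        qed
        then show "g (fst z) * (fst z - x0) $ i * \<omega> ?\<zeta> = 0" by auto
      qed
      then show "u x = 0" by (simp add: u_def vec_eq_iff)
    next
      fix b i assume b: "0 < b \<and> b < a"
      have h: "holder_bd b (C0 * M) UNIV (\<lambda>x. - V \<Phi> i x)" if \<Phi>: "holder_bd 1 L UNIV \<Phi>" "0 \<le> L" "2 * (I * (s * L)) \<le> C0" for \<Phi> L
      proof -
        have V: "holder_bd 1 (I * (s * L) * M) UNIV (V \<Phi> i)"
          unfolding V_def I_def by (rule cc[OF _ \<Phi>(1,2)]) (rule gz)
        have "holder_bd b (2 * (I * (s * L) * M)) UNIV (V \<Phi> i)"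
          by (rule holder_bd_exponent_mono[OF V]) (use b a I s \<Phi>(2) M in auto)
        then have "holder_bd b (C0 * M) UNIV (V \<Phi> i)"
          by (rule holder_bd_mono) (use mult_right_mono[OF \<Phi>(3) M] in \<open>simp add: mult_ac\<close>)
        then show ?thesis by (rule holder_bd_minus)
      qed
      show "C1_holder b (C0 * M) UNIV (\<lambda>x. u x $ i)"
        by (rule C1_holderI[OF _ der]) (use h[OF L1(2,1) CL(1)] h[OF L2(2,1) CL(2)] in \<open>simp_all add: u_def\<close>)
    next
      fix x
      have int: "(\<lambda>z. g (fst z) * (fst z - x0) $ i * d\<omega> (x - x0 - snd z *\<^sub>R (fst z - x0)) $ i) integrable_on cbox (-c, 0) (c, 1)" for i
        by (intro integrable_continuous continuous_intros continuous_on_compose2[OF gc] continuous_on_compose2[OF kd(3)]) auto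
      have "divergence u x = (\<Sum>i\<in>UNIV. - V (\<lambda>w. d\<omega> w $ i) i x)"
        unfolding divergence_def by (intro sum.cong refl partial_deriv_eqI der)
      also have "\<dots> = - integral (cbox (-c, 0) (c, 1)) (\<lambda>z. \<Sum>i\<in>UNIV. g (fst z) * (fst z - x0) $ i * d\<omega> (x - x0 - snd z *\<^sub>R (fst z - x0)) $ i)"
        unfolding V_def sum_negf using int by (subst integral_sum) auto
      also have "\<dots> = - integral (cbox (-c, 0) (c, 1)) (\<lambda>z. g (fst z) * (d\<omega> (x - x0 - snd z *\<^sub>R (fst z - x0)) \<bullet> (fst z - x0)))"
        by (simp add: inner_vec_def sum_distrib_left mult_ac)
      \<comment> \<open>Fubini with the time integral inside: there the integrand is a derivative in
        \<tau> and is evaluated at the endpoints.\<close>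
      also have "integral (cbox (-c, 0) (c, 1)) (\<lambda>z. g (fst z) * (d\<omega> (x - x0 - snd z *\<^sub>R (fst z - x0)) \<bullet> (fst z - x0)))
          = integral (cbox (-c) c) (\<lambda>y. integral (cbox 0 1) (\<lambda>\<tau>. g y * (d\<omega> (x - x0 - \<tau> *\<^sub>R (y - x0)) \<bullet> (y - x0))))"
        by (subst integral_prod_continuous)
          (auto intro!: continuous_intros continuous_on_compose2[OF gc] continuous_on_compose2[OF kd(3)])
      also have "\<dots> = integral (cbox (-c) c) (\<lambda>y. g y * (\<omega> (x - x0) - \<omega> (x - y)))"
      proof (rule integral_cong)
        fix y
        have "((\<lambda>\<tau>. d\<omega> (x - x0 - \<tau> *\<^sub>R (y - x0)) \<bullet> (y - x0)) has_integral
            (- \<omega> (x - x0 - 1 *\<^sub>R (y - x0)) - - \<omega> (x - x0 - 0 *\<^sub>R (y - x0)))) {0..1}"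
        proof (rule fundamental_theorem_of_calculus)
          fix \<tau> :: real
          have "((\<lambda>\<tau>. x - x0 - \<tau> *\<^sub>R (y - x0)) has_derivative (\<lambda>h. - (h *\<^sub>R (y - x0)))) (at \<tau>)"
            by (auto intro!: derivative_eq_intros simp: algebra_simps)
          then have "((\<lambda>\<tau>. \<omega> (x - x0 - \<tau> *\<^sub>R (y - x0))) has_real_derivative - (d\<omega> (x - x0 - \<tau> *\<^sub>R (y - x0)) \<bullet> (y - x0))) (at \<tau>)"
            unfolding has_field_derivative_def
            by (rule has_derivative_eq_rhs[OF has_derivative_compose[OF _ kd(2)]]) (simp add: fun_eq_iff)
          then have "((\<lambda>\<tau>. - \<omega> (x - x0 - \<tau> *\<^sub>R (y - x0))) has_real_derivative d\<omega> (x - x0 - \<tau> *\<^sub>R (y - x0)) \<bullet> (y - x0)) (at \<tau>)"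
            using DERIV_minus by fastforce
          then show "((\<lambda>\<tau>. - \<omega> (x - x0 - \<tau> *\<^sub>R (y - x0))) has_vector_derivative d\<omega> (x - x0 - \<tau> *\<^sub>R (y - x0)) \<bullet> (y - x0)) (at \<tau> within {0..1})"
            using has_field_derivative_at_within has_real_derivative_iff_has_vector_derivative by blast
        qed simp
        then have "((\<lambda>\<tau>. g y * (d\<omega> (x - x0 - \<tau> *\<^sub>R (y - x0)) \<bullet> (y - x0))) has_integral (g y * (\<omega> (x - x0) - \<omega> (x - y)))) (cbox 0 1)"
          by (intro has_integral_mult_right) (simp add: algebra_simps)
        then show "integral (cbox 0 1) (\<lambda>\<tau>. g y * (d\<omega> (x - x0 - \<tau> *\<^sub>R (y - x0)) \<bullet> (y - x0))) = g y * (\<omega> (x - x0) - \<omega> (x - y))"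
          by (rule integral_unique)
      qed
      also have "\<dots> = integral (cbox (-c) c) (\<lambda>y. g y * \<omega> (x - x0)) - integral (cbox (-c) c) (\<lambda>y. g y * \<omega> (x - y))"
        unfolding right_diff_distrib
        by (intro integral_diff integrable_continuous continuous_intros continuous_on_subset[OF gc] continuous_on_compose2[OF kd(6)]) auto
      also have "integral (cbox (-c) c) (\<lambda>y. g y * \<omega> (x - x0)) = integral UNIV g * \<omega> (x - x0)"
      proof -
        have "(g has_integral integral (cbox (-c) c) g) UNIV"
          by (rule has_integral_compact_support[OF gc]) (rule gbox)
        then show ?thesis by (simp add: integral_mult_left integral_unique)
      qed
      also have "\<omega> (x - x0) = nbump (x0 + \<zeta>0) r x" unfolding \<omega>_def by (rule nbump_translate[OF r])
      also have "integral (cbox (-c) c) (\<lambda>y. g y * \<omega> (x - y)) = moll g \<omega> x 1"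
      proof -
        have xc: "continuous_on UNIV (\<lambda>y. g y * \<omega> (x - y))"
          by (intro continuous_intros gc continuous_on_compose2[OF kd(6)]) auto
        have "integral UNIV (\<lambda>w. (\<lambda>y. g y * \<omega> (x - y)) ((-1) *\<^sub>R w + x)) = integral UNIV (\<lambda>y. g y * \<omega> (x - y)) / \<bar>-1\<bar> ^ DIM(real^'n)"
          by (rule integral_affine_compact_support[OF xc, where B = "norm x0 + s"]) (auto simp: gB)
        then have "moll g \<omega> x 1 = integral UNIV (\<lambda>y. g y * \<omega> (x - y))"
          by (simp add: moll_def mult.commute)
        also have "\<dots> = integral (cbox (-c) c) (\<lambda>y. g y * \<omega> (x - y))"
          by (intro integral_unique has_integral_compact_support[OF xc]) (simp add: gbox)
        finally show ?thesis by simp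
      qed
      finally show "divergence u x = moll g \<omega> x 1 - integral UNIV g * nbump (x0 + \<zeta>0) r x" by simp
    qed
    then show "\<exists>u. div_solution \<Omega> a (\<lambda>b. C0) M u (\<lambda>x. moll g (nbump \<zeta>0 r) x 1 - integral UNIV g * nbump (x0 + \<zeta>0) r x)"
      unfolding \<omega>_def by blast
  qed
qed

subsection \<open>Local solutions\<close>

text \<open>
  Mass of \<open>\<Omega> \<inter> ball x0 s\<close> may be moved along the segments \<open>y + \<tau> \<zeta>\<close> with \<open>\<zeta>\<close> near \<open>\<zeta>0\<close>, and
  then contracted towards \<open>x0 + \<zeta>0\<close>, without leaving \<open>\<Omega>\<close>.
\<close>

definition transportable :: "(real^'n) set \<Rightarrow> real^'n \<Rightarrow> real \<Rightarrow> real^'n \<Rightarrow> real \<Rightarrow> bool" where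
  "transportable \<Omega> x0 s \<zeta>0 r \<longleftrightarrow> 0 < s \<and> 0 < r \<and>
     (\<forall>y\<in>\<Omega> \<inter> ball x0 s. \<forall>\<zeta>\<in>cball \<zeta>0 r. \<forall>\<tau>\<in>{0..1}. y + \<tau> *\<^sub>R \<zeta> \<in> \<Omega>) \<and>
     (\<forall>y\<in>ball x0 s. \<forall>\<zeta>\<in>cball \<zeta>0 r. \<forall>\<tau>\<in>{0..1}. x0 + \<tau> *\<^sub>R (y - x0) + \<zeta> \<in> \<Omega>) \<and>
     cball (x0 + \<zeta>0) (2 * r) \<subseteq> \<Omega>"

text \<open>Transport replaces \<open>g\<close> by its mollification at scale 1, contraction
  replaces this by a multiple of one fixed bump; of \<open>g\<close> only the total mass
  remains.\<close>

lemma local_solution: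
  fixes \<Omega> :: "(real^'n) set"
  assumes a: "0 < a" "a \<le> 1" and t: "transportable \<Omega> x0 s \<zeta>0 r"
  shows "\<exists>C. (\<forall>b. 0 < b \<and> b < a \<longrightarrow> 0 \<le> C b) \<and> (\<forall>g M. 0 \<le> M \<longrightarrow> holder_bd a M UNIV g \<longrightarrow>
     (\<forall>y. g y \<noteq> 0 \<longrightarrow> y \<in> \<Omega> \<inter> ball x0 s) \<longrightarrow>
     (\<exists>u. div_solution \<Omega> a C M u (\<lambda>x. g x - integral UNIV g * nbump (x0 + \<zeta>0) r x)))"
proof -
  have s: "0 < s" "0 < r" and t1: "\<And>y \<zeta> \<tau>. y \<in> \<Omega> \<inter> ball x0 s \<Longrightarrow> \<zeta> \<in> cball \<zeta>0 r \<Longrightarrow> \<tau> \<in> {0..1} \<Longrightarrow> y + \<tau> *\<^sub>R \<zeta> \<in> \<Omega>"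
    and t2: "\<And>y \<zeta> \<tau>. y \<in> ball x0 s \<Longrightarrow> \<zeta> \<in> cball \<zeta>0 r \<Longrightarrow> \<tau> \<in> {0..1} \<Longrightarrow> x0 + \<tau> *\<^sub>R (y - x0) + \<zeta> \<in> \<Omega>"
    using t unfolding transportable_def by blast+
  obtain C1 where C1: "\<And>b. 0 < b \<and> b < a \<Longrightarrow> 0 \<le> C1 b" and
    T: "\<And>g M. 0 \<le> M \<Longrightarrow> holder_bd a M UNIV g \<Longrightarrow>
     (\<forall>x w. \<forall>\<tau>\<in>{0<..<1}. nbump \<zeta>0 r w \<noteq> 0 \<and> g (x - \<tau> *\<^sub>R w) \<noteq> 0 \<longrightarrow> x \<in> \<Omega>) \<Longrightarrow>
     (\<exists>u. div_solution \<Omega> a C1 M u (\<lambda>x. g x - moll g (nbump \<zeta>0 r) x 1))"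
    using transport_solution[OF a nbump_kernel[OF s(2)] integral_nbump[OF s(2)], where \<Omega> = \<Omega>] by blast
  obtain C2 where C2: "\<And>b. 0 < b \<and> b < a \<Longrightarrow> 0 \<le> C2 b" and
    K: "\<And>g M. 0 \<le> M \<Longrightarrow> holder_bd a M UNIV g \<Longrightarrow> (\<forall>y. g y \<noteq> 0 \<longrightarrow> y \<in> ball x0 s) \<Longrightarrow>
     (\<exists>u. div_solution \<Omega> a C2 M u (\<lambda>x. moll g (nbump \<zeta>0 r) x 1 - integral UNIV g * nbump (x0 + \<zeta>0) r x))"
    using contraction_solution[OF a s t2] by blast
  show ?thesis
  proof (rule exI[of _ "\<lambda>b. C1 b + C2 b"], intro conjI allI impI)
    show "0 \<le> C1 b + C2 b" if "0 < b \<and> b < a" for b using C1 C2 that by (simp add: add_nonneg_nonneg)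
    fix g M assume M: "0 \<le> M" and gh: "holder_bd a M UNIV g" and gs: "\<forall>y. g y \<noteq> 0 \<longrightarrow> y \<in> \<Omega> \<inter> ball x0 s"
    have "x \<in> \<Omega>" if "\<tau> \<in> {0<..<1}" "nbump \<zeta>0 r w \<noteq> 0" "g (x - \<tau> *\<^sub>R w) \<noteq> 0" for x w \<tau>
    proof -
      have "norm (w - \<zeta>0) < r" using nbump_eq_0[OF s(2), of w \<zeta>0] that(2) by force
      then have "w \<in> cball \<zeta>0 r" by (simp add: dist_norm norm_minus_commute)
      moreover have "x - \<tau> *\<^sub>R w \<in> \<Omega> \<inter> ball x0 s" using gs that(3) by blast
      ultimately have "x - \<tau> *\<^sub>R w + \<tau> *\<^sub>R w \<in> \<Omega>" using that(1) by (intro t1) auto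
      then show ?thesis by simp
    qed
    then obtain u1 where u1: "div_solution \<Omega> a C1 M u1 (\<lambda>x. g x - moll g (nbump \<zeta>0 r) x 1)"
      using T[OF M gh] by blast
    obtain u2 where u2: "div_solution \<Omega> a C2 M u2 (\<lambda>x. moll g (nbump \<zeta>0 r) x 1 - integral UNIV g * nbump (x0 + \<zeta>0) r x)"
      using K[OF M gh] gs by blast
    show "\<exists>u. div_solution \<Omega> a (\<lambda>b. C1 b + C2 b) M u (\<lambda>x. g x - integral UNIV g * nbump (x0 + \<zeta>0) r x)"
      using div_solution_add[OF u1 u2 a(1)] by auto
  qed
qed

lemma transportable_interior:
  fixes p :: "real^'n"
  assumes "cball p R \<subseteq> \<Omega>" "0 < s" "0 < r" "s + r \<le> R" "2 * r \<le> R"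
  shows "transportable \<Omega> p s 0 r"
  unfolding transportable_def
proof (intro conjI ballI assms(2,3))
  have sub: "x \<in> \<Omega>" if "norm (x - p) \<le> R" for x
    using assms(1) that by (auto simp: dist_norm norm_minus_commute)
  fix y \<zeta> :: "real^'n" and \<tau> :: real
  assume \<zeta>: "\<zeta> \<in> cball 0 r" and \<tau>: "\<tau> \<in> {0..1}"
  have t1: "norm (\<tau> *\<^sub>R v) \<le> norm v" for v using \<tau> by (simp add: mult_left_le_one_le)
  show "p + \<tau> *\<^sub>R (y - p) + \<zeta> \<in> \<Omega>" if "y \<in> ball p s"
  proof (rule sub)
    have "norm (p + \<tau> *\<^sub>R (y - p) + \<zeta> - p) \<le> norm (\<tau> *\<^sub>R (y - p)) + norm \<zeta>"
      using norm_triangle_ineq[of "\<tau> *\<^sub>R (y - p)" \<zeta>] by simp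
    also have "\<dots> \<le> R" using t1[of "y - p"] \<zeta> that assms(4) by (simp add: dist_norm norm_minus_commute)
    finally show "norm (p + \<tau> *\<^sub>R (y - p) + \<zeta> - p) \<le> R" .
  qed
  show "y + \<tau> *\<^sub>R \<zeta> \<in> \<Omega>" if "y \<in> \<Omega> \<inter> ball p s"
  proof (rule sub)
    have "norm (y + \<tau> *\<^sub>R \<zeta> - p) \<le> norm (y - p) + norm (\<tau> *\<^sub>R \<zeta>)"
      using norm_triangle_ineq[of "y - p" "\<tau> *\<^sub>R \<zeta>"] by (simp add: algebra_simps)
    also have "\<dots> \<le> R" using t1[of \<zeta>] \<zeta> that assms(4) by (simp add: dist_norm norm_minus_commute)
    finally show "norm (y + \<tau> *\<^sub>R \<zeta> - p) \<le> R" .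
  qed
next
  show "cball (p + 0) (2 * r) \<subseteq> \<Omega>" using assms(1,5) subset_cball[of "2 * r" R p] by simp
qed

text \<open>The drift \<open>K *\<^sub>R e\<close> points into \<Omega>: it raises \<rho> at unit
  speed, while the deviations allowed by the radius \<open>q\<close> lower \<rho> by at most
  \<open>L\<close> times their size. Smallness of \<open>L * q\<close> against \<open>K\<close>
  decides.\<close>

lemma transportable_boundary:
  fixes x0 :: "real^'n"
  assumes c: "boundary_chart \<Omega> x0 r e \<rho> d\<rho> L" and o: "open \<Omega>" and x0: "x0 \<in> frontier \<Omega>"
  shows "\<exists>s \<zeta>0 q. transportable \<Omega> x0 s \<zeta>0 q"
proof -
  note cd = boundary_chartD[OF c]
  \<comment> \<open>A quarter of \<open>r\<close> keeps every path inside the chart ball; dividing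
    by \<open>4 * (L + 1)\<close> makes both \<open>L * q\<close> and \<open>q\<close> at most
    \<open>K / 4\<close>.\<close>
  define K where "K = r / 4"
  define q where "q = K / (4 * (L + 1))"
  have K: "0 < K" using cd(1) by (simp add: K_def)
  have q: "0 < q" using K cd(2) by (simp add: q_def)
  have Lq: "L * q \<le> K / 4" and qK: "q \<le> K / 4"
  proof -
    have "(L + 1) * q = K / 4" using cd(2) by (simp add: q_def field_simps)
    then have "L * q + q = K / 4" by (simp add: algebra_simps)
    moreover have "0 \<le> L * q" using cd(2) q by simp
    ultimately show "L * q \<le> K / 4" "q \<le> K / 4" using q by linarith+
  qed
  have r: "r = 4 * K" by (simp add: K_def)
  \<comment> \<open>Here \<open>x\<close> is \<open>y\<close> moved by \<tau> along
    \<open>e\<close>, up to an error of size \<open>B\<close>; \<open>\<rho> y\<close> together with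
    the gain \<tau> must beat the loss \<open>L * B\<close>.\<close>
  have shift: "x \<in> \<Omega>" if x: "norm (x - x0) < r" and y: "norm (y - x0) < r" and \<tau>: "0 \<le> \<tau>"
    and d: "norm (x - y - \<tau> *\<^sub>R e) \<le> B" and z: "norm (x - \<tau> *\<^sub>R e - x0) < r" and pos: "L * B < \<rho> y + \<tau>" for x y \<tau> B
  proof -
    have "\<rho> x = \<rho> ((x - \<tau> *\<^sub>R e) + \<tau> *\<^sub>R e)" by simp
    also have "\<dots> = \<rho> (x - \<tau> *\<^sub>R e) + \<tau>" by (rule cd(4))
    finally have \<rho>x: "\<rho> x = \<rho> (x - \<tau> *\<^sub>R e) + \<tau>" .
    have "\<bar>\<rho> (x - \<tau> *\<^sub>R e) - \<rho> y\<bar> \<le> L * norm (x - \<tau> *\<^sub>R e - y)"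
      using holder_bdD(2)[OF cd(7), of "x - \<tau> *\<^sub>R e" y] y z by (simp add: dist_norm norm_minus_commute)
    also have "\<dots> \<le> L * B" using d cd(2) by (intro mult_left_mono) (auto simp: algebra_simps)
    finally have "0 < \<rho> x" using \<rho>x pos by linarith
    moreover have "x \<in> ball x0 r" using x by (simp add: dist_norm norm_minus_commute)
    ultimately show ?thesis using cd(9) by blast
  qed
  have \<rho>0: "\<rho> x0 = 0" using boundary_chart_frontier[OF c o x0] cd(1) by simp
  have Ke: "norm (t *\<^sub>R (K *\<^sub>R e)) \<le> K" if "t \<in> {0..1}" for t
    using that cd(3) K by (simp add: mult_left_le_one_le)
  have "transportable \<Omega> x0 q (K *\<^sub>R e) q"
    unfolding transportable_def
  proof (intro conjI ballI q)
    fix y \<zeta> :: "real^'n" and \<tau> :: real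
    assume \<zeta>: "\<zeta> \<in> cball (K *\<^sub>R e) q" and \<tau>: "\<tau> \<in> {0..1}"
    define \<xi> where "\<xi> = \<zeta> - K *\<^sub>R e"
    have \<xi>: "norm \<xi> \<le> q" "\<zeta> = K *\<^sub>R e + \<xi>" using \<zeta> by (auto simp: \<xi>_def dist_norm norm_minus_commute)
    have t1: "norm (\<tau> *\<^sub>R v) \<le> norm v" for v using \<tau> by (simp add: mult_left_le_one_le)
    show "y + \<tau> *\<^sub>R \<zeta> \<in> \<Omega>" if y: "y \<in> \<Omega> \<inter> ball x0 q"
    proof (rule shift[of _ y "\<tau> * K" "norm (\<tau> *\<^sub>R \<xi>)"])
      have yq: "norm (y - x0) < q" using y by (simp add: dist_norm norm_minus_commute)
      have "norm (y + \<tau> *\<^sub>R \<zeta> - x0) \<le> norm (y - x0) + norm (\<tau> *\<^sub>R (K *\<^sub>R e)) + norm (\<tau> *\<^sub>R \<xi>)"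
        unfolding \<xi>(2) by (rule order_trans[OF _ order_trans[OF norm_triangle_ineq add_right_mono[OF norm_triangle_ineq]]])
          (simp add: algebra_simps)
      then show "norm (y + \<tau> *\<^sub>R \<zeta> - x0) < r" using yq Ke[OF \<tau>] t1[of \<xi>] \<xi>(1) qK K r by linarith
      show yr: "norm (y - x0) < r" using yq qK K r by linarith
      show "0 \<le> \<tau> * K" using \<tau> K by simp
      show "norm (y + \<tau> *\<^sub>R \<zeta> - y - (\<tau> * K) *\<^sub>R e) \<le> norm (\<tau> *\<^sub>R \<xi>)" by (simp add: \<xi>(2) algebra_simps)
      have "norm (y + \<tau> *\<^sub>R \<zeta> - (\<tau> * K) *\<^sub>R e - x0) \<le> norm (y - x0) + norm (\<tau> *\<^sub>R \<xi>)"
        using norm_triangle_ineq[of "y - x0" "\<tau> *\<^sub>R \<xi>"] by (simp add: \<xi>(2) algebra_simps)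
      then show "norm (y + \<tau> *\<^sub>R \<zeta> - (\<tau> * K) *\<^sub>R e - x0) < r" using yq t1[of \<xi>] \<xi>(1) qK K r by linarith
      have \<rho>y: "0 < \<rho> y" using y cd(9)[of y] yr by (simp add: dist_norm norm_minus_commute)
      \<comment> \<open>The error shrinks with \<tau>, as it must: \<open>\<rho> y\<close> is
        positive but may be arbitrarily small, so the gain \<open>\<tau> * K\<close> has to cover
        the loss at every time.\<close>
      have "L * norm (\<tau> *\<^sub>R \<xi>) \<le> L * (\<tau> * q)" using \<tau> \<xi>(1) cd(2) by (intro mult_left_mono) (auto intro: mult_left_mono)
      also have "\<dots> = \<tau> * (L * q)" by simp
      also have "\<dots> \<le> \<tau> * K" using \<tau> Lq K by (intro mult_left_mono) auto
      finally show "L * norm (\<tau> *\<^sub>R \<xi>) < \<rho> y + \<tau> * K" using \<rho>y by linarith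
    qed
    show "x0 + \<tau> *\<^sub>R (y - x0) + \<zeta> \<in> \<Omega>" if y: "y \<in> ball x0 q"
    proof (rule shift[of _ x0 K "2 * q"])
      have yq: "norm (\<tau> *\<^sub>R (y - x0)) \<le> q" using y t1[of "y - x0"] by (simp add: dist_norm norm_minus_commute)
      have e1: "norm (\<tau> *\<^sub>R (y - x0) + \<xi>) \<le> 2 * q" using norm_triangle_ineq[of "\<tau> *\<^sub>R (y - x0)" \<xi>] yq \<xi>(1) by linarith
      have e2: "norm (K *\<^sub>R e) = K" using cd(3) K by simp
      have "norm (x0 + \<tau> *\<^sub>R (y - x0) + \<zeta> - x0) = norm ((\<tau> *\<^sub>R (y - x0) + \<xi>) + K *\<^sub>R e)"
        by (simp add: \<xi>(2) add_ac)
      then show "norm (x0 + \<tau> *\<^sub>R (y - x0) + \<zeta> - x0) < r"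
        using norm_triangle_ineq[of "\<tau> *\<^sub>R (y - x0) + \<xi>" "K *\<^sub>R e"] e1 e2 qK K r by linarith
      show "norm (x0 - x0) < r" using cd(1) by simp
      show "0 \<le> K" using K by simp
      have "x0 + \<tau> *\<^sub>R (y - x0) + \<zeta> - x0 - K *\<^sub>R e = \<tau> *\<^sub>R (y - x0) + \<xi>" by (simp add: \<xi>(2))
      then show "norm (x0 + \<tau> *\<^sub>R (y - x0) + \<zeta> - x0 - K *\<^sub>R e) \<le> 2 * q" using e1 by (simp only:)
      have "x0 + \<tau> *\<^sub>R (y - x0) + \<zeta> - K *\<^sub>R e - x0 = \<tau> *\<^sub>R (y - x0) + \<xi>" by (simp add: \<xi>(2))
      then show "norm (x0 + \<tau> *\<^sub>R (y - x0) + \<zeta> - K *\<^sub>R e - x0) < r" using e1 qK K r by (simp only:)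
      show "L * (2 * q) < \<rho> x0 + K" using Lq \<rho>0 K by simp
    qed
  next
    show "cball (x0 + K *\<^sub>R e) (2 * q) \<subseteq> \<Omega>"
    proof
      fix z assume "z \<in> cball (x0 + K *\<^sub>R e) (2 * q)"
      then have z: "norm (z - x0 - K *\<^sub>R e) \<le> 2 * q" by (simp add: dist_norm norm_minus_commute algebra_simps)
      have e2: "norm (K *\<^sub>R e) = K" using cd(3) K by simp
      show "z \<in> \<Omega>"
      proof (rule shift[of _ x0 K "2 * q"])
        show "norm (z - x0) < r"
          using norm_triangle_ineq[of "z - x0 - K *\<^sub>R e" "K *\<^sub>R e"] z e2 qK K r by simp
        show "norm (z - K *\<^sub>R e - x0) < r" using z qK K r by (simp add: algebra_simps)
        show "L * (2 * q) < \<rho> x0 + K" using Lq \<rho>0 K by simp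
      qed (use z K cd(1) in auto)
    qed
  qed
  then show ?thesis by blast
qed

subsection \<open>Moving mass between interior points\<close>

text \<open>The constant is hidden: only finitely many pairs of bumps are joined later, and they are
  fixed before the data.\<close>

definition joined :: "(real^'n) set \<Rightarrow> real \<Rightarrow> real^'n \<Rightarrow> real \<Rightarrow> real^'n \<Rightarrow> real \<Rightarrow> bool" where
  "joined \<Omega> a p r q t \<longleftrightarrow> (\<exists>C v. div_solution \<Omega> a C 1 v (\<lambda>x. nbump p r x - nbump q t x))"

lemma joined_sym:
  assumes "joined \<Omega> a p r q t" "0 < a"
  shows "joined \<Omega> a q t p r"
proof -
  obtain C v where "div_solution \<Omega> a C 1 v (\<lambda>x. nbump p r x - nbump q t x)"
    using assms(1) unfolding joined_def by blast
  from div_solution_cmult[OF this assms(2), of "-1"] show ?thesis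
    unfolding joined_def by (auto simp: algebra_simps)
qed

lemma joined_trans:
  assumes "joined \<Omega> a p r q t" "joined \<Omega> a q t z u" "0 < a"
  shows "joined \<Omega> a p r z u"
proof -
  obtain C v where v: "div_solution \<Omega> a C 1 v (\<lambda>x. nbump p r x - nbump q t x)"
    using assms(1) unfolding joined_def by blast
  obtain C' v' where v': "div_solution \<Omega> a C' 1 v' (\<lambda>x. nbump q t x - nbump z u x)"
    using assms(2) unfolding joined_def by blast
  from div_solution_add[OF v v' assms(3)] show ?thesis
    unfolding joined_def by auto
qed

text \<open>Local solution around \<open>p\<close> with the bump at \<open>q\<close> as data: its
  mass is 1, so exactly one copy of the bump at \<open>p\<close> is left.\<close>

lemma joined_nearby:
  fixes p q :: "real^'n"
  assumes a: "0 < a" "a \<le> 1" and R: "cball p R \<subseteq> \<Omega>" "s + r \<le> R" "2 * r \<le> R" "0 < r" "0 < t" "norm (q - p) + t \<le> s"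
  shows "joined \<Omega> a q t p r"
proof -
  have s: "0 < s" using R(5,6) norm_ge_zero[of "q - p"] by linarith
  have T: "transportable \<Omega> p s 0 r" by (rule transportable_interior[OF R(1) s R(4,2,3)])
  obtain L where L: "0 \<le> L" "holder_bd 1 L UNIV (nbump q t)" using nbump_holder[OF R(5)] by blast
  have h: "holder_bd a (2 * L) UNIV (nbump q t)" by (rule holder_bd_exponent_mono[OF L(2) a L(1)])
  have sup: "y \<in> \<Omega> \<inter> ball p s" if "nbump q t y \<noteq> 0" for y
  proof -
    have "norm (y - q) < t" using nbump_eq_0[OF R(5), of y q] that by force
    then have "norm (y - p) < s" using norm_triangle_ineq[of "y - q" "q - p"] R(6) by simp
    then have "y \<in> ball p s" "y \<in> cball p R" using R(2,4) by (auto simp: dist_norm norm_minus_commute)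
    then show ?thesis using R(1) by blast
  qed
  have L2: "0 \<le> 2 * L" using L(1) by simp
  obtain C where C: "\<forall>g M. 0 \<le> M \<longrightarrow> holder_bd a M UNIV g \<longrightarrow> (\<forall>y. g y \<noteq> 0 \<longrightarrow> y \<in> \<Omega> \<inter> ball p s) \<longrightarrow>
      (\<exists>u. div_solution \<Omega> a C M u (\<lambda>x. g x - integral UNIV g * nbump (p + 0) r x))"
    using local_solution[OF a T] by (elim exE conjE)
  obtain u where u: "div_solution \<Omega> a C (2 * L) u (\<lambda>x. nbump q t x - integral UNIV (nbump q t) * nbump (p + 0) r x)"
    using C[rule_format, OF L2 h sup] by blast
  have "div_solution \<Omega> a (\<lambda>b. C b * (2 * L)) 1 u (\<lambda>x. nbump q t x - nbump p r x)"
    using div_solution_mono[OF u, of "\<lambda>b. C b * (2 * L)" 1] by (simp add: integral_nbump[OF R(5)])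
  then show ?thesis unfolding joined_def by blast
qed

text \<open>Neighbouring points can be joined and joining is symmetric and transitive, so the
  classes are open and a connected set consists of a single one.\<close>

lemma joined_connected:
  fixes \<Omega> :: "(real^'n) set"
  assumes a: "0 < a" "a \<le> 1" and o: "open \<Omega>" "connected \<Omega>"
    and p: "0 < r" "cball p (2 * r) \<subseteq> \<Omega>" and q: "0 < t" "cball q (2 * t) \<subseteq> \<Omega>"
  shows "joined \<Omega> a p r q t"
proof -
  \<comment> \<open>Quantifying over all admissible radii makes this a relation between points;
    transitivity may then choose any bump at the middle point.\<close>
  define Rel where "Rel p q \<longleftrightarrow> (\<forall>r t. 0 < r \<and> cball p (2 * r) \<subseteq> \<Omega> \<and> 0 < t \<and> cball q (2 * t) \<subseteq> \<Omega> \<longrightarrow> joined \<Omega> a p r q t)"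
    for p q :: "real^'n"
  have ball_ex: "\<exists>t>0. cball x (2 * t) \<subseteq> \<Omega>" if x: "x \<in> \<Omega>" for x
  proof -
    obtain e where "0 < e" "cball x e \<subseteq> \<Omega>" using open_contains_cball_eq[OF o(1), THEN spec, THEN iffD1, OF x] by (elim exE conjE)
    then show ?thesis by (intro exI[of _ "e / 2"]) auto
  qed
  have "Rel p q"
  proof (rule connected_equivalence_relation[OF o(2)])
    show "p \<in> \<Omega>" "q \<in> \<Omega>" using p q by auto
    show "Rel y x" if "Rel x y" for x y
      using that joined_sym[OF _ a(1)] unfolding Rel_def by blast
    show "Rel x z" if xy: "Rel x y" and yz: "Rel y z" and y: "y \<in> \<Omega>" for x y z
      unfolding Rel_def
    proof (intro allI impI)
      fix r t assume rt: "0 < r \<and> cball x (2 * r) \<subseteq> \<Omega> \<and> 0 < t \<and> cball z (2 * t) \<subseteq> \<Omega>"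
      obtain u where "0 < u" "cball y (2 * u) \<subseteq> \<Omega>" using ball_ex[OF y] by blast
      then show "joined \<Omega> a x r z t"
        using xy yz rt joined_trans[OF _ _ a(1)] unfolding Rel_def by blast
    qed
    fix z assume z: "z \<in> \<Omega>"
    obtain R where R: "0 < R" "cball z R \<subseteq> \<Omega>" using open_contains_cball_eq[OF o(1), THEN spec, THEN iffD1, OF z] by (elim exE conjE)
    have "Rel z x" if x: "x \<in> ball z (R / 8)" for x
      unfolding Rel_def
    proof (intro allI impI, elim conjE)
      fix r t assume r: "0 < r" "cball z (2 * r) \<subseteq> \<Omega>" and t: "0 < t" "cball x (2 * t) \<subseteq> \<Omega>"
      \<comment> \<open>Both bumps are first shrunk in place until they fit into
        \<open>ball z (R / 4)\<close>; then one is moved to the other.\<close>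
      define r0 where "r0 = min r (R / 8)"
      define t0 where "t0 = min t (R / 8)"
      have r0: "0 < r0" "r0 \<le> r" "r0 \<le> R / 8" and t0: "0 < t0" "t0 \<le> t" "t0 \<le> R / 8"
        using r t R by (auto simp: r0_def t0_def)
      have xz: "norm (x - z) < R / 8" using x by (simp add: dist_norm norm_minus_commute)
      have j1: "joined \<Omega> a z r z r0" by (rule joined_nearby[OF a r(2), of r]) (use r r0 in auto)
      have j2: "joined \<Omega> a x t x t0" by (rule joined_nearby[OF a t(2), of t]) (use t t0 in auto)
      have j3: "joined \<Omega> a x t0 z r0" by (rule joined_nearby[OF a R(2), of "R / 4"]) (use R r0 t0 xz in auto)
      show "joined \<Omega> a z r x t"
        by (rule joined_trans[OF joined_trans[OF j1 joined_sym[OF j3 a(1)] a(1)] joined_sym[OF j2 a(1)] a(1)])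
    qed
    moreover have "ball z (R / 8) \<subseteq> \<Omega>" using R by (auto simp: subset_iff)
    ultimately show "\<exists>T. openin (top_of_set \<Omega>) T \<and> z \<in> T \<and> (\<forall>x\<in>T. Rel z x)"
      using R(1) by (intro exI[of _ "ball z (R / 8)"]) (auto simp: openin_open_eq[OF o(1)])
  qed
  then show ?thesis using p q unfolding Rel_def by blast
qed

subsection \<open>Data vanishing on the boundary\<close>

lemma continuous_positive_lower_bound:
  assumes "compact K" "continuous_on K h" "\<And>x. x \<in> K \<Longrightarrow> 0 < (h x :: real)"
  shows "\<exists>c>0. \<forall>x\<in>K. c \<le> h x"
proof (cases "K = {}")
  case False
  then obtain x where "x \<in> K" "\<forall>y\<in>K. h x \<le> h y" using continuous_attains_inf[OF assms(1) _ assms(2)] by blast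
  then show ?thesis using assms(3) by blast
qed (auto intro: exI[of _ 1])

text \<open>In the applications \<open>h\<close> is bounded below by \<open>c\<close> on a compact
  set only; the truncation leaves it unchanged there and makes the reciprocal Hoelder
  everywhere.\<close>

lemma holder_bd_max_inverse:
  assumes h: "holder_bd a L S h" and c: "0 < c" and L: "0 \<le> L"
  shows "holder_bd a (1 / c + (L + c) / c\<^sup>2) S (\<lambda>x. 1 / max c (h x))"
proof (rule holder_bd_inverse)
  show "holder_bd a (L + c) S (\<lambda>x. max c (h x))"
  proof (rule holder_bdI)
    show "\<bar>max c (h x)\<bar> \<le> L + c" if "x \<in> S" for x using holder_bdD(1)[OF h that] c by auto
    fix x y assume "x \<in> S" "y \<in> S"
    then have "\<bar>h x - h y\<bar> \<le> L * norm (x - y) powr a" by (rule holder_bdD(2)[OF h])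
    moreover have "\<bar>max c (h x) - max c (h y)\<bar> \<le> \<bar>h x - h y\<bar>" by (auto simp: max_def)
    moreover have "L * norm (x - y) powr a \<le> (L + c) * norm (x - y) powr a" using c by (intro mult_right_mono) auto
    ultimately show "\<bar>max c (h x) - max c (h y)\<bar> \<le> (L + c) * norm (x - y) powr a" by linarith
  qed
qed (use c L in auto)

text \<open>Tent functions divided by their sum, which is truncated below by a positive bound
  \<open>c\<close> valid on \<open>K\<close>. Lipschitz regularity is enough for multipliers of
  Hoelder data.\<close>

lemma lipschitz_partition_of_unity:
  fixes X K :: "'a::real_normed_vector set"
  assumes K: "compact K" and X: "finite X" "K \<subseteq> (\<Union>x\<in>X. ball x (s x))"
  shows "\<exists>\<phi> L. 0 \<le> L \<and> (\<forall>x\<in>X. holder_bd 1 L UNIV (\<phi> x) \<and> (\<forall>y. y \<notin> ball x (s x) \<longrightarrow> \<phi> x y = 0)) \<and>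
    (\<forall>y\<in>K. (\<Sum>x\<in>X. \<phi> x y) = (1::real))"
proof -
  define \<beta> where "\<beta> x y = max 0 (s x - norm (y - x))" for x y
  define N where "N = (\<Sum>x\<in>X. 1 + \<bar>s x\<bar>)"
  have N: "0 \<le> N" "x \<in> X \<Longrightarrow> 1 + \<bar>s x\<bar> \<le> N" for x
    using X(1) by (auto simp: N_def intro!: sum_nonneg member_le_sum)
  have \<beta>: "holder_bd 1 (1 + \<bar>s x\<bar>) UNIV (\<beta> x)" for x
    unfolding holder_bd_one_iff
  proof (intro conjI ballI)
    fix y z
    show "\<bar>\<beta> x y\<bar> \<le> 1 + \<bar>s x\<bar>" unfolding \<beta>_def using norm_ge_zero[of "y - x"] by linarith
    have "\<bar>\<beta> x y - \<beta> x z\<bar> \<le> norm (y - z)"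
      unfolding \<beta>_def using norm_triangle_ineq3[of "y - x" "z - x"] by auto
    also have "\<dots> \<le> (1 + \<bar>s x\<bar>) * norm (y - z)" by (simp add: algebra_simps)
    finally show "\<bar>\<beta> x y - \<beta> x z\<bar> \<le> (1 + \<bar>s x\<bar>) * norm (y - z)" .
  qed
  have S: "holder_bd 1 N UNIV (\<lambda>y. \<Sum>x\<in>X. \<beta> x y)" unfolding N_def by (intro holder_bd_sum X(1) \<beta>)
  have pos: "0 < (\<Sum>x\<in>X. \<beta> x y)" if y: "y \<in> K" for y
  proof -
    obtain x where "x \<in> X" "y \<in> ball x (s x)" using X(2) y by blast
    then show ?thesis using X(1) by (intro sum_pos2[of X x]) (auto simp: \<beta>_def dist_norm norm_minus_commute)
  qed
  obtain c where c: "0 < c" "\<And>y. y \<in> K \<Longrightarrow> c \<le> (\<Sum>x\<in>X. \<beta> x y)"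
    using continuous_positive_lower_bound[OF K continuous_on_subset[OF holder_bd_continuous_on[OF S]] pos] by auto
  define Q where "Q y = 1 / max c (\<Sum>x\<in>X. \<beta> x y)" for y
  define P where "P = 1 / c + (N + c) / c\<^sup>2"
  have Q: "holder_bd 1 P UNIV Q" unfolding Q_def P_def by (rule holder_bd_max_inverse[OF S c(1) N(1)])
  have P: "0 \<le> P" using c N by (simp add: P_def)
  define \<phi> where "\<phi> x y = \<beta> x y * Q y" for x y
  have "holder_bd 1 (2 * N * P) UNIV (\<phi> x)" if "x \<in> X" for x
    unfolding \<phi>_def
    by (rule holder_bd_mult[OF holder_bd_mono[OF \<beta> N(2)[OF that]] holder_bd_subset[OF Q]]) (use N P in auto)
  moreover have "\<phi> x y = 0" if "y \<notin> ball x (s x)" for x y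
    using that by (simp add: \<phi>_def \<beta>_def dist_norm norm_minus_commute)
  moreover have "(\<Sum>x\<in>X. \<phi> x y) = 1" if "y \<in> K" for y
    using c(1) c(2)[OF that] by (simp add: \<phi>_def Q_def sum_divide_distrib[symmetric] max_def)
  ultimately show ?thesis using N P by (intro exI[of _ \<phi>] exI[of _ "2 * N * P"]) auto
qed

text \<open>The cover, the partition of unity and the joining fields are fixed before
  \<open>g\<close> is given; this is what makes \<open>C\<close> independent of the data.\<close>

lemma solution_zero_boundary_data:
  fixes \<Omega> :: "(real^'n) set"
  assumes a: "0 < a" "a \<le> 1" and o: "open \<Omega>" "connected \<Omega>" "\<Omega> \<noteq> {}" "bounded \<Omega>"
    and tr: "\<forall>x\<in>closure \<Omega>. \<exists>s \<zeta>0 r. transportable \<Omega> x s \<zeta>0 r"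
  shows "\<exists>C. (\<forall>b. 0 < b \<and> b < a \<longrightarrow> 0 \<le> C b) \<and> (\<forall>g M. 0 \<le> M \<longrightarrow> holder_bd a M UNIV g \<longrightarrow>
     (\<forall>y. y \<notin> \<Omega> \<longrightarrow> g y = 0) \<longrightarrow> integral UNIV g = 0 \<longrightarrow> (\<exists>u. div_solution \<Omega> a C M u g))"
proof -
  have "\<forall>x. \<exists>s \<zeta> r. x \<in> closure \<Omega> \<longrightarrow> transportable \<Omega> x s \<zeta> r" using tr by blast
  then obtain s \<zeta> r where T: "\<And>x. x \<in> closure \<Omega> \<Longrightarrow> transportable \<Omega> x (s x) (\<zeta> x) (r x)" by metis
  then have s: "0 < s x" "0 < r x" "cball (x + \<zeta> x) (2 * r x) \<subseteq> \<Omega>" if "x \<in> closure \<Omega>" for x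
    using that unfolding transportable_def by blast+
  have K: "compact (closure \<Omega>)" using o(4) by (simp add: compact_closure)
  have "closure \<Omega> \<subseteq> (\<Union>x\<in>closure \<Omega>. ball x (s x))" using s(1) by force
  then obtain X where X: "X \<subseteq> closure \<Omega>" "finite X" "closure \<Omega> \<subseteq> (\<Union>x\<in>X. ball x (s x))"
    using compactE_image[OF K, of "closure \<Omega>" "\<lambda>x. ball x (s x)"] by auto
  obtain \<phi> L where L: "0 \<le> L" and \<phi>: "\<And>x. x \<in> X \<Longrightarrow> holder_bd 1 L UNIV (\<phi> x)"
    "\<And>x y. x \<in> X \<Longrightarrow> y \<notin> ball x (s x) \<Longrightarrow> \<phi> x y = 0" "\<And>y. y \<in> closure \<Omega> \<Longrightarrow> (\<Sum>x\<in>X. \<phi> x y) = (1::real)"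
    using lipschitz_partition_of_unity[OF K X(2,3)] by blast
  obtain p where p: "p \<in> \<Omega>" using o(3) by blast
  obtain t where t: "0 < t" "cball p (2 * t) \<subseteq> \<Omega>"
  proof -
    obtain e where "0 < e" "cball p e \<subseteq> \<Omega>" using open_contains_cball_eq[OF o(1), THEN spec, THEN iffD1, OF p] by (elim exE conjE)
    then show ?thesis using that[of "e / 2"] by auto
  qed
  have "\<forall>x. \<exists>Cv. x \<in> X \<longrightarrow> div_solution \<Omega> a (fst Cv) 1 (snd Cv) (\<lambda>y. nbump (x + \<zeta> x) (r x) y - nbump p t y)"
    using joined_connected[OF a o(1,2) s(2,3) t] X(1) unfolding joined_def by (metis fst_conv snd_conv subsetD)
  then obtain Cv where "\<forall>x. x \<in> X \<longrightarrow> div_solution \<Omega> a (fst (Cv x)) 1 (snd (Cv x)) (\<lambda>y. nbump (x + \<zeta> x) (r x) y - nbump p t y)"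
    by metis
  then obtain C1 v where v: "\<And>x. x \<in> X \<Longrightarrow> div_solution \<Omega> a (C1 x) 1 (v x) (\<lambda>y. nbump (x + \<zeta> x) (r x) y - nbump p t y)"
    using that[of "\<lambda>x. fst (Cv x)" "\<lambda>x. snd (Cv x)"] by blast
  have "\<forall>x. \<exists>C. x \<in> X \<longrightarrow> ((\<forall>b. 0 < b \<and> b < a \<longrightarrow> 0 \<le> C b) \<and> (\<forall>g M. 0 \<le> M \<longrightarrow> holder_bd a M UNIV g \<longrightarrow>
     (\<forall>y. g y \<noteq> 0 \<longrightarrow> y \<in> \<Omega> \<inter> ball x (s x)) \<longrightarrow>
     (\<exists>u. div_solution \<Omega> a C M u (\<lambda>y. g y - integral UNIV g * nbump (x + \<zeta> x) (r x) y))))"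
    using local_solution[OF a T] X(1) by blast
  from choice[OF this] obtain C2 where C2: "\<forall>x. x \<in> X \<longrightarrow> ((\<forall>b. 0 < b \<and> b < a \<longrightarrow> 0 \<le> C2 x b) \<and>
     (\<forall>g M. 0 \<le> M \<longrightarrow> holder_bd a M UNIV g \<longrightarrow> (\<forall>y. g y \<noteq> 0 \<longrightarrow> y \<in> \<Omega> \<inter> ball x (s x)) \<longrightarrow>
     (\<exists>u. div_solution \<Omega> a (C2 x) M u (\<lambda>y. g y - integral UNIV g * nbump (x + \<zeta> x) (r x) y))))"
    by (elim exE)
  obtain c :: "real^'n" where c: "\<Omega> \<subseteq> cbox (-c) c" using bounded_subset_cbox_symmetric[OF o(4)] by blast
  define I where "I = measure lborel (cbox (-c) c)"
  have I: "0 \<le> I" by (simp add: I_def)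
  \<comment> \<open>One factor 2 for lowering the exponent of the partition functions to
    \<open>a\<close>, one for the product with \<open>g\<close>.\<close>
  define LL where "LL = 2 * (2 * L)"
  have LL: "0 \<le> LL" using L by (simp add: LL_def)
  \<comment> \<open>Per piece: the local solution for data of size \<open>LL * M\<close>, and the
    joining field scaled by a mass of at most \<open>LL * I * M\<close>. The absolute value is there
    because \<open>joined\<close> gives no sign for its constants.\<close>
  define C where "C b = (\<Sum>x\<in>X. C2 x b * LL + \<bar>C1 x b\<bar> * (LL * I))" for b
  show ?thesis
  proof (rule exI[of _ C], intro conjI allI impI)
    show "0 \<le> C b" if "0 < b \<and> b < a" for b
      unfolding C_def using C2 that LL I by (intro sum_nonneg add_nonneg_nonneg mult_nonneg_nonneg) auto
    fix g M assume M: "0 \<le> M" and gh: "holder_bd a M UNIV g" and gz: "\<forall>y. y \<notin> \<Omega> \<longrightarrow> g y = 0" and g0: "integral UNIV g = 0"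
    define h where "h x y = \<phi> x y * g y" for x y
    define m where "m x = integral UNIV (h x)" for x
    have hh: "holder_bd a (LL * M) UNIV (h x)" if x: "x \<in> X" for x
      unfolding h_def LL_def
      by (rule holder_bd_mult[OF holder_bd_exponent_mono[OF \<phi>(1)[OF x] a L] holder_bd_subset[OF gh]]) (use L M in auto)
    have hsup: "\<forall>y. h x y \<noteq> 0 \<longrightarrow> y \<in> \<Omega> \<inter> ball x (s x)" if x: "x \<in> X" for x
      using \<phi>(2)[OF x] gz by (auto simp: h_def)
    have hz: "h x y = 0" if "y \<notin> cbox (-c) c" for x y using gz c that by (auto simp: h_def)
    have hI: "(h x has_integral m x) (cbox (-c) c)" "(h x has_integral m x) UNIV" if x: "x \<in> X" for x
    proof -
      have hc: "continuous_on UNIV (h x)" by (rule holder_bd_continuous_on[OF hh[OF x] a(1)])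
      have *: "(h x has_integral integral (cbox (-c) c) (h x)) UNIV"
        by (rule has_integral_compact_support[OF hc hz])
      then show "(h x has_integral m x) UNIV" unfolding m_def by (simp add: integral_unique)
      have "m x = integral (cbox (-c) c) (h x)" using * unfolding m_def by (rule integral_unique)
      then show "(h x has_integral m x) (cbox (-c) c)"
        using hc by (simp add: integrable_integral integrable_continuous continuous_on_subset[OF hc])
    qed
    have mb: "\<bar>m x\<bar> \<le> LL * I * M" if x: "x \<in> X" for x
    proof -
      have "norm (m x) \<le> (LL * M) * measure lborel (cbox (-c) c)"
        by (rule has_integral_bound[OF _ hI(1)[OF x]]) (use holder_bdD(1)[OF hh[OF x]] LL M in auto)
      then show ?thesis by (simp add: I_def mult_ac)
    qed
    have hsum: "(\<Sum>x\<in>X. h x y) = g y" for y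
    proof (cases "y \<in> \<Omega>")
      case True
      then have "y \<in> closure \<Omega>" using closure_subset by blast
      then show ?thesis using \<phi>(3)[of y] by (simp add: h_def sum_distrib_right[symmetric])
    qed (use gz in \<open>simp add: h_def\<close>)
    have m0: "(\<Sum>x\<in>X. m x) = 0"
    proof -
      have "((\<lambda>y. \<Sum>x\<in>X. h x y) has_integral (\<Sum>x\<in>X. m x)) UNIV"
        by (rule has_integral_sum[OF X(2)]) (rule hI(2))
      then show ?thesis using g0 by (simp add: hsum integral_unique)
    qed
    have "\<exists>u. div_solution \<Omega> a (C2 x) (LL * M) u (\<lambda>y. h x y - m x * nbump (x + \<zeta> x) (r x) y)" if x: "x \<in> X" for x
      unfolding m_def
      using C2[rule_format, OF x, THEN conjunct2, rule_format, OF mult_nonneg_nonneg[OF LL M] hh[OF x]] hsup[OF x] by blast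
    then have "\<forall>x. \<exists>u. x \<in> X \<longrightarrow> div_solution \<Omega> a (C2 x) (LL * M) u (\<lambda>y. h x y - m x * nbump (x + \<zeta> x) (r x) y)"
      by blast
    from choice[OF this] obtain u where
      u: "\<And>x. x \<in> X \<Longrightarrow> div_solution \<Omega> a (C2 x) (LL * M) (u x) (\<lambda>y. h x y - m x * nbump (x + \<zeta> x) (r x) y)"
      by blast
    have piece: "div_solution \<Omega> a (\<lambda>b. C2 x b * LL + \<bar>C1 x b\<bar> * (LL * I)) M (\<lambda>y. u x y + m x *\<^sub>R v x y)
        (\<lambda>y. (h x y - m x * nbump (x + \<zeta> x) (r x) y) + m x * (nbump (x + \<zeta> x) (r x) y - nbump p t y))" if x: "x \<in> X" for x
    proof (rule div_solution_add[OF div_solution_mono[OF u[OF x]] div_solution_mono[OF div_solution_cmult[OF v[OF x] a(1)]] a(1)])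
      show "C2 x b * (LL * M) \<le> C2 x b * LL * M" for b by simp
      show "C1 x b * (\<bar>m x\<bar> * 1) \<le> \<bar>C1 x b\<bar> * (LL * I) * M" for b
      proof -
        have "C1 x b * \<bar>m x\<bar> \<le> \<bar>C1 x b\<bar> * (LL * I * M)" using mb[OF x] by (intro mult_mono) auto
        then show ?thesis by (simp add: mult.assoc)
      qed
    qed
    have "div_solution \<Omega> a C M (\<lambda>y. \<Sum>x\<in>X. u x y + m x *\<^sub>R v x y)
        (\<lambda>y. \<Sum>x\<in>X. (h x y - m x * nbump (x + \<zeta> x) (r x) y) + m x * (nbump (x + \<zeta> x) (r x) y - nbump p t y))"
      unfolding C_def by (rule div_solution_sum[OF X(2) piece a(1) M])
    moreover have "(\<Sum>x\<in>X. (h x y - m x * nbump (x + \<zeta> x) (r x) y) + m x * (nbump (x + \<zeta> x) (r x) y - nbump p t y)) = g y" for y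
    proof -
      have "(\<Sum>x\<in>X. (h x y - m x * nbump (x + \<zeta> x) (r x) y) + m x * (nbump (x + \<zeta> x) (r x) y - nbump p t y))
          = (\<Sum>x\<in>X. h x y - m x * nbump p t y)"
        by (intro sum.cong) (auto simp: algebra_simps)
      also have "\<dots> = g y - (\<Sum>x\<in>X. m x) * nbump p t y"
        by (simp add: sum_subtractf hsum sum_distrib_right)
      finally show ?thesis using m0 by simp
    qed
    ultimately show "\<exists>u. div_solution \<Omega> a C M u g" by auto
  qed
qed

section \<open>Gluing the boundary correctors\<close>

lemma C1_holder_exponent_mono:
  assumes "C1_holder a M S v" "0 < b" "b \<le> a" "0 \<le> M"
  shows "C1_holder b (2 * M) S v"
  by (rule C1_holderI[where d = "\<lambda>i. partial_deriv i v"])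
    (use C1_holderD[OF assms(1)] assms in \<open>auto intro: holder_bd_exponent_mono\<close>)

text \<open>On the frontier a corrector for \<open>F\<close> has divergence equal to its bump times
  \<open>F\<close>, so the correctors of all centres add up to \<open>S * F\<close>; dividing the
  given function by \<open>S\<close> beforehand yields the right boundary values. \<open>S\<close>
  is bounded below only on the compact frontier, hence the truncation by \<open>c\<close>.\<close>

lemma boundary_correction:
  fixes \<Omega> :: "(real^'n) set"
  assumes a: "0 < a" "a \<le> 1" and o: "open \<Omega>" "bounded \<Omega>"
    and chart: "\<forall>x\<in>frontier \<Omega>. \<exists>r e \<rho> d\<rho> L. boundary_chart \<Omega> x r e \<rho> d\<rho> L"
  shows "\<exists>C\<ge>0. \<forall>f M. 0 \<le> M \<longrightarrow> holder_bd a M UNIV f \<longrightarrow>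
    (\<exists>u G. (\<forall>x. x \<notin> \<Omega> \<longrightarrow> u x = 0) \<and> continuous_on UNIV u \<and>
      (\<forall>i. C1_holder a (C * M) \<Omega> (\<lambda>x. u x $ i)) \<and> holder_bd a (C * M) UNIV G \<and>
      (\<forall>x\<in>\<Omega>. divergence u x = G x) \<and> (\<forall>x\<in>frontier \<Omega>. G x = f x) \<and>
      ((\<lambda>x. if x \<in> \<Omega> then G x else 0) has_integral 0) UNIV)"
proof -
  define good where "good x r e C \<longleftrightarrow> 0 < r \<and> norm e = 1 \<and> 0 \<le> C \<and> (\<forall>F M. 0 \<le> M \<longrightarrow> holder_bd a M UNIV F \<longrightarrow>
    (\<exists>v D. boundary_field \<Omega> a x r e (C * M) F v D))" for x e :: "real^'n" and r C
  have "\<exists>r e C. good x r e C" if x: "x \<in> frontier \<Omega>" for x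
  proof -
    obtain r e \<rho> d\<rho> L where c: "boundary_chart \<Omega> x r e \<rho> d\<rho> L" using bspec[OF chart x] by blast
    obtain C where "0 \<le> C" "\<forall>F M. 0 \<le> M \<longrightarrow> holder_bd a M UNIV F \<longrightarrow>
      (\<exists>v D. boundary_field \<Omega> a x r e (C * M) F v D)"
      using boundary_corrector[OF c o(1) a] by (elim exE conjE)
    then have "good x r e C" unfolding good_def using boundary_chartD(1,3)[OF c] by (intro conjI)
    then show ?thesis by blast
  qed
  then obtain r e Cc where good: "\<And>x. x \<in> frontier \<Omega> \<Longrightarrow> good x (r x) (e x) (Cc x)" by metis
  have r: "0 < r x" "norm (e x) = 1" "0 \<le> Cc x" if x: "x \<in> frontier \<Omega>" for x
  proof -
    note g = good[OF x, unfolded good_def]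
    show "0 < r x" by (rule conjunct1[OF g])
    show "norm (e x) = 1" by (rule conjunct1[OF conjunct2[OF g]])
    show "0 \<le> Cc x" by (rule conjunct1[OF conjunct2[OF conjunct2[OF g]]])
  qed
  have K: "compact (frontier \<Omega>)" using o(2) by (rule compact_frontier_bounded)
  have "frontier \<Omega> \<subseteq> (\<Union>x\<in>frontier \<Omega>. ball x (r x / 2))" using r(1) by force
  then obtain X where X: "X \<subseteq> frontier \<Omega>" "finite X" "frontier \<Omega> \<subseteq> (\<Union>x\<in>X. ball x (r x / 2))"
    using compactE_image[OF K, of "frontier \<Omega>" "\<lambda>x. ball x (r x / 2)"] by auto
  define S where "S y = (\<Sum>x\<in>X. bump x (r x / 2) y)" for y
  have "\<forall>x. \<exists>L. x \<in> X \<longrightarrow> 0 \<le> L \<and> holder_bd 1 L UNIV (bump x (r x / 2))"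
    using bump_holder r(1) X(1) by (metis half_gt_zero subsetD)
  from choice[OF this] obtain Lb where Lb: "\<And>x. x \<in> X \<Longrightarrow> 0 \<le> Lb x" "\<And>x. x \<in> X \<Longrightarrow> holder_bd 1 (Lb x) UNIV (bump x (r x / 2))"
    by blast
  define N where "N = (\<Sum>x\<in>X. Lb x)"
  have N: "0 \<le> N" unfolding N_def using Lb(1) by (intro sum_nonneg) auto
  have S1: "holder_bd 1 N UNIV S" unfolding S_def N_def by (intro holder_bd_sum X(2) Lb(2))
  have S: "holder_bd a (2 * N) UNIV S" by (rule holder_bd_exponent_mono[OF S1 a N])
  have pos: "0 < S y" if y: "y \<in> frontier \<Omega>" for y
  proof -
    obtain x where x: "x \<in> X" "y \<in> ball x (r x / 2)" using X(3) y by blast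
    have "0 < bump x (r x / 2) y" using x(2) by (intro bump_pos) (simp add: dist_norm norm_minus_commute)
    then show ?thesis unfolding S_def using x X(2) by (intro sum_pos2[of X x]) (auto simp: bump_nonneg)
  qed
  obtain c where c: "0 < c" "\<And>y. y \<in> frontier \<Omega> \<Longrightarrow> c \<le> S y"
    using continuous_positive_lower_bound[OF K continuous_on_subset[OF holder_bd_continuous_on[OF S a(1)]] pos] by auto
  define P where "P = 1 / c + (2 * N + c) / c\<^sup>2"
  have P: "0 \<le> P" using c N by (simp add: P_def)
  have Q: "holder_bd a P UNIV (\<lambda>y. 1 / max c (S y))"
    unfolding P_def using N by (intro holder_bd_max_inverse[OF S c(1)]) simp
  define Z where "Z = (\<Sum>x\<in>X. Cc x)"
  have CcX: "0 \<le> Cc x" if "x \<in> X" for x using r(3) X(1) that by blast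
  have Z: "0 \<le> Z" unfolding Z_def using CcX by (rule sum_nonneg)
  \<comment> \<open>\<open>Z * M'\<close> for the field and its derivatives,
    \<open>n * Z * M'\<close> for the divergence \<open>G\<close> as a sum of \<open>n\<close> of
    them; the factor \<open>2 * P\<close> comes from the product of \<open>f\<close> with the
    truncated reciprocal of \<open>S\<close>.\<close>
  define C where "C = (1 + real CARD('n)) * Z * (2 * P)"
  have C: "0 \<le> C" using Z P by (simp add: C_def)
  show ?thesis
  proof (intro exI[of _ C] conjI C allI impI)
    fix f :: "real^'n \<Rightarrow> real" and M assume M: "0 \<le> M" and f: "holder_bd a M UNIV f"
    define M' where "M' = 2 * M * P"
    have M': "0 \<le> M'" using M P by (simp add: M'_def)
    define F where "F y = f y * (1 / max c (S y))" for y
    have F: "holder_bd a M' UNIV F"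
      unfolding F_def M'_def by (rule holder_bd_mult[OF f holder_bd_subset[OF Q]]) (use M P in auto)
    have "\<exists>v D. boundary_field \<Omega> a x (r x) (e x) (Cc x * M') F v D" if "x \<in> X" for x
    proof -
      have "good x (r x) (e x) (Cc x)" using good X(1) that by blast
      then show ?thesis unfolding good_def using M' F by (elim conjE) blast
    qed
    then obtain v D where sol: "\<And>x. x \<in> X \<Longrightarrow> boundary_field \<Omega> a x (r x) (e x) (Cc x * M') F (v x) (D x)" by metis
    note vz = boundary_fieldD(1)[OF sol] and vh = boundary_fieldD(2)[OF sol] and vd = boundary_fieldD(3)[OF sol]
      and Dh = boundary_fieldD(4)[OF sol] and Df = boundary_fieldD(5)[OF sol] and DI = boundary_fieldD(6)[OF sol]
    have ei: "\<bar>e x $ i\<bar> \<le> 1" if "x \<in> X" for x i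
      using component_le_norm_cart[of "e x" i] r(2)[of x] X(1) that by auto
    have comb: "holder_bd a (Z * M') UNIV (\<lambda>y. \<Sum>x\<in>X. e x $ i * h x y)"
      if "\<And>x. x \<in> X \<Longrightarrow> holder_bd a (Cc x * M') UNIV (h x)" for h i
    proof -
      have "holder_bd a (\<Sum>x\<in>X. \<bar>e x $ i\<bar> * (Cc x * M')) UNIV (\<lambda>y. \<Sum>x\<in>X. e x $ i * h x y)"
        by (intro holder_bd_sum X(2) holder_bd_cmult that)
      then show ?thesis
      proof (rule holder_bd_mono)
        have "(\<Sum>x\<in>X. \<bar>e x $ i\<bar> * (Cc x * M')) \<le> (\<Sum>x\<in>X. Cc x * M')"
          using ei CcX M' by (intro sum_mono mult_left_le_one_le) auto
        then show "(\<Sum>x\<in>X. \<bar>e x $ i\<bar> * (Cc x * M')) \<le> Z * M'" by (simp add: Z_def sum_distrib_right)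
      qed
    qed
    define u :: "real^'n \<Rightarrow> real^'n" where "u y = (\<chi> i. \<Sum>x\<in>X. e x $ i * v x y)" for y
    define d where "d i j y = (\<Sum>x\<in>X. e x $ i * D x y $ j)" for i j y
    define G where "G y = (\<Sum>x\<in>X. D x y \<bullet> e x)" for y
    have CM: "Z * M' \<le> C * M" "real CARD('n) * (Z * M') \<le> C * M"
    proof -
      have e: "C * M = Z * M' + real CARD('n) * (Z * M')" by (simp add: C_def M'_def algebra_simps)
      have "0 \<le> Z * M'" using Z M' by simp
      then show "Z * M' \<le> C * M" "real CARD('n) * (Z * M') \<le> C * M" unfolding e by simp_all
    qed
    have ui: "holder_bd a (C * M) UNIV (\<lambda>y. u y $ i)" for i
      unfolding u_def vec_lambda_beta by (rule holder_bd_mono[OF comb[OF vh] CM(1)])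
    have der: "((\<lambda>t. u (y + t *\<^sub>R axis j 1) $ i) has_real_derivative d i j y) (at 0)" if "y \<in> \<Omega>" for y i j
      unfolding u_def d_def vec_lambda_beta by (intro DERIV_sum DERIV_cmult vd that)
    have G: "G y = (\<Sum>i\<in>UNIV. d i i y)" for y
      unfolding G_def d_def by (subst sum.swap) (simp add: inner_vec_def mult.commute)
    have "holder_bd a (real CARD('n) * (Z * M')) UNIV G"
    proof -
      have "holder_bd a (\<Sum>i\<in>(UNIV::'n set). Z * M') UNIV (\<lambda>y. \<Sum>i\<in>UNIV. d i i y)"
        unfolding d_def by (intro holder_bd_sum comb Dh) auto
      then show ?thesis by (simp add: G[abs_def])
    qed
    then have Gh: "holder_bd a (C * M) UNIV G" using CM(2) by (rule holder_bd_mono)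
    show "\<exists>u G. (\<forall>x. x \<notin> \<Omega> \<longrightarrow> u x = 0) \<and> continuous_on UNIV u \<and>
      (\<forall>i. C1_holder a (C * M) \<Omega> (\<lambda>x. u x $ i)) \<and> holder_bd a (C * M) UNIV G \<and>
      (\<forall>x\<in>\<Omega>. divergence u x = G x) \<and> (\<forall>x\<in>frontier \<Omega>. G x = f x) \<and>
      ((\<lambda>x. if x \<in> \<Omega> then G x else 0) has_integral 0) UNIV"
    proof (intro exI[of _ u] exI[of _ G] conjI allI impI ballI Gh)
      show "u y = 0" if "y \<notin> \<Omega>" for y using vz[OF _ that] by (simp add: u_def vec_eq_iff)
      show "continuous_on UNIV u" by (rule holder_bd_componentwise_continuous[OF ui a(1)])
      show "C1_holder a (C * M) \<Omega> (\<lambda>x. u x $ i)" for i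
      proof (rule C1_holderI[OF holder_bd_subset[OF ui] der])
        show "holder_bd a (C * M) \<Omega> (d i j)" for j
          unfolding d_def by (rule holder_bd_subset[OF holder_bd_mono[OF comb[OF Dh] CM(1)]]) auto
      qed auto
      show "divergence u y = G y" if "y \<in> \<Omega>" for y
        unfolding divergence_def G by (intro sum.cong refl partial_deriv_eqI der that)
      show "G y = f y" if y: "y \<in> frontier \<Omega>" for y
      proof -
        have "G y = S y * F y" unfolding G_def S_def using Df[OF _ y] by (simp add: sum_distrib_right)
        then show ?thesis using c(1) c(2)[OF y] by (simp add: F_def max_def)
      qed
      have "((\<lambda>y. \<Sum>x\<in>X. if y \<in> \<Omega> then D x y \<bullet> e x else 0) has_integral (\<Sum>x\<in>X. 0)) UNIV"
        by (rule has_integral_sum[OF X(2) DI])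
      moreover have "(\<lambda>y. \<Sum>x\<in>X. if y \<in> \<Omega> then D x y \<bullet> e x else 0) = (\<lambda>y. if y \<in> \<Omega> then G y else 0)"
        by (auto simp: G_def fun_eq_iff)
      ultimately show "((\<lambda>y. if y \<in> \<Omega> then G y else 0) has_integral 0) UNIV" by simp
    qed
  qed
qed

subsection \<open>Hoelder spaces\<close>

lemma mi_order_eq_0_iff: "mi_order \<gamma> = 0 \<longleftrightarrow> \<gamma> = (\<lambda>_. 0)"
  by (auto simp: mi_order_def)

lemma mi_deriv_zero:
  fixes f :: "real^'n \<Rightarrow> real"
  shows "mi_deriv (\<lambda>_. 0) f = f"
proof -
  have "(SOME xs. \<forall>i. count_list xs i = (0::nat)) = ([] :: 'n list)"
  proof (rule some_equality)
    fix xs :: "'n list" assume "\<forall>i. count_list xs i = 0"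
    then show "xs = []" by (cases xs) (auto dest: spec[of _ "hd xs"])
  qed simp
  then show ?thesis by (simp add: mi_deriv_def)
qed

text \<open>In order one exactly one list has the prescribed counts, so \<open>SOME\<close> leaves
  no freedom.\<close>

lemma mi_deriv_order_1:
  fixes \<gamma> :: "'n::finite \<Rightarrow> nat"
  assumes "mi_order \<gamma> = 1"
  shows "\<exists>i. mi_deriv \<gamma> f = partial_deriv i f"
proof -
  obtain i where i: "\<gamma> i = 1" "\<And>j. j \<noteq> i \<Longrightarrow> \<gamma> j = 0"
    using assms sum_eq_1_iff[of "UNIV :: 'n set" \<gamma>] by (auto simp: mi_order_def)
  have "(SOME xs. \<forall>j. count_list xs j = \<gamma> j) = [i]"
  proof (rule some_equality)
    show "\<forall>j. count_list [i] j = \<gamma> j" using i by auto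
    fix xs assume xs: "\<forall>j. count_list xs j = \<gamma> j"
    then have "set xs \<subseteq> {i}" using i(2) by (metis count_list_0_iff insertI1 subsetI)
    then have rep: "xs = replicate (length xs) i" by (metis replicate_length_same singletonD subsetD)
    have "count_list (replicate n i) i = n" for n by (induction n) auto
    then have "length xs = 1" using xs rep i(1) by metis
    then show "xs = [i]" using rep by simp
  qed
  then show ?thesis by (auto simp: mi_deriv_def)
qed

lemma Linf_norm_le:
  fixes f :: "real^'n \<Rightarrow> real"
  assumes "continuous_on \<Omega> f" "open \<Omega>" "\<And>x. x \<in> \<Omega> \<Longrightarrow> \<bar>f x\<bar> \<le> B"
  shows "Linf_norm \<Omega> f \<le> ennreal B"
  unfolding Linf_norm_def
proof (rule esssup_I)
  have "f \<in> borel_measurable (lebesgue_on \<Omega>)"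
    using assms(1,2) by (intro continuous_imp_measurable_on_sets_lebesgue) auto
  then show "(\<lambda>x. ennreal \<bar>f x\<bar>) \<in> borel_measurable (lebesgue_on \<Omega>)" by measurable
  show "AE x in lebesgue_on \<Omega>. ennreal \<bar>f x\<bar> \<le> ennreal B"
    by (rule AE_I2) (use assms(3) in \<open>auto intro: ennreal_leI\<close>)
qed

text \<open>If a value exceeded the essential supremum, so would the values on a nonempty open set,
  and such a set is not negligible.\<close>

lemma le_Linf_norm:
  fixes f :: "real^'n \<Rightarrow> real"
  assumes c: "continuous_on \<Omega> f" and o: "open \<Omega>" and x: "x \<in> \<Omega>"
  shows "ennreal \<bar>f x\<bar> \<le> Linf_norm \<Omega> f"
proof (rule ccontr)
  let ?z = "Linf_norm \<Omega> f"
  assume "\<not> ennreal \<bar>f x\<bar> \<le> ?z"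
  then have lt: "?z < ennreal \<bar>f x\<bar>" by simp
  then obtain z where z: "0 \<le> z" "?z = ennreal z"
    by (cases ?z) (auto simp: top_unique)
  define U where "U = {y \<in> \<Omega>. z < \<bar>f y\<bar>}"
  have "open U"
  proof -
    have "open (\<Omega> \<inter> (\<lambda>y. \<bar>f y\<bar>) -` {z<..})"
      by (intro continuous_open_preimage continuous_intros c o open_greaterThan)
    moreover have "U = \<Omega> \<inter> (\<lambda>y. \<bar>f y\<bar>) -` {z<..}" by (auto simp: U_def)
    ultimately show ?thesis by simp
  qed
  have m: "f \<in> borel_measurable (lebesgue_on \<Omega>)"
    using c o by (intro continuous_imp_measurable_on_sets_lebesgue) auto
  then have "(\<lambda>x. ennreal \<bar>f x\<bar>) \<in> borel_measurable (lebesgue_on \<Omega>)" by measurable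
  from esssup_AE[of "\<lambda>x. ennreal \<bar>f x\<bar>" "lebesgue_on \<Omega>"]
  have "AE y in lebesgue_on \<Omega>. ennreal \<bar>f y\<bar> \<le> ennreal z" by (simp add: Linf_norm_def[symmetric] z)
  then have "AE y in lebesgue. y \<in> \<Omega> \<longrightarrow> ennreal \<bar>f y\<bar> \<le> ennreal z"
    using o by (subst (asm) AE_restrict_space_iff) auto
  then have "AE y in lebesgue. y \<notin> U"
    by eventually_elim (use z(1) in \<open>auto simp: U_def\<close>)
  moreover have "U \<in> sets lebesgue" using \<open>open U\<close> by auto
  ultimately have "negligible U" by (simp add: AE_iff_null_sets negligible_iff_null_sets)
  moreover have "x \<in> U" using lt x z by (simp add: U_def ennreal_less_iff)
  ultimately show False using open_not_negligible[OF \<open>open U\<close>] by blast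
qed

lemma holder_seminorm_le:
  assumes "holder_bd b B \<Omega> f"
  shows "holder_seminorm b \<Omega> f \<le> ennreal B"
  unfolding holder_seminorm_def
proof (rule SUP_least, clarify)
  fix x y assume "x \<in> \<Omega>" "y \<in> \<Omega>" "x \<noteq> y"
  then show "ennreal (\<bar>f x - f y\<bar> / norm (x - y) powr b) \<le> ennreal B"
    using holder_bdD(2)[OF assms, of x y] by (intro ennreal_leI) (simp add: pos_divide_le_eq)
qed

lemma holder_bd_continuous_extension:
  fixes f :: "real^'n \<Rightarrow> real"
  assumes "holder_bd b B \<Omega> f" "0 < b"
  shows "\<exists>g. continuous_extension \<Omega> f g"
proof -
  obtain g where "uniformly_continuous_on (closure \<Omega>) g" "\<And>x. x \<in> \<Omega> \<Longrightarrow> f x = g x"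
    using uniformly_continuous_on_extension_on_closure[OF holder_bd_uniformly_continuous[OF assms]] by metis
  then show ?thesis
    unfolding continuous_extension_def by (metis uniformly_continuous_imp_continuous)
qed

lemma C1_holder_imp_holder_space:
  fixes v :: "real^'n \<Rightarrow> real"
  assumes v: "C1_holder b B \<Omega> v" and b: "0 < b" and o: "open \<Omega>"
  shows "v \<in> holder_space 1 b \<Omega>"
    and "holder_norm 1 b \<Omega> v \<le> of_nat (card {\<gamma> :: 'n \<Rightarrow> nat. mi_order \<gamma> \<le> 1}) * ennreal B
           + of_nat (card {\<gamma> :: 'n \<Rightarrow> nat. mi_order \<gamma> = 1}) * ennreal B"
proof -
  note vd = C1_holderD[OF v]
  have one: "holder_bd b B \<Omega> (mi_deriv \<gamma> v)" if "mi_order \<gamma> = 1" for \<gamma> :: "'n \<Rightarrow> nat"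
    using mi_deriv_order_1[OF that, of v] vd(3) by auto
  have le: "holder_bd b B \<Omega> (mi_deriv \<gamma> v)" if "mi_order \<gamma> \<le> 1" for \<gamma> :: "'n \<Rightarrow> nat"
  proof (cases "mi_order \<gamma> = 1")
    case False
    then have "mi_order \<gamma> = 0" using that by linarith
    then show ?thesis using vd(1) by (simp add: mi_order_eq_0_iff mi_deriv_zero)
  qed (rule one)
  have Ck: "Ck_on 1 \<Omega> v"
    using holder_bd_continuous_on[OF vd(1) b] holder_bd_continuous_on[OF vd(3) b] vd(2)
    by (auto simp: real_differentiable_def)
  show "v \<in> holder_space 1 b \<Omega>"
    unfolding holder_space_def
    using Ck holder_bd_continuous_extension[OF le b] le_less_trans[OF holder_seminorm_le[OF one] ennreal_less_top]
    by auto
  have "Linf_norm \<Omega> (mi_deriv \<gamma> v) \<le> ennreal B" if "mi_order \<gamma> \<le> 1" for \<gamma> :: "'n \<Rightarrow> nat"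
    by (rule Linf_norm_le[OF holder_bd_continuous_on[OF le[OF that] b] o]) (rule holder_bdD(1)[OF le[OF that]])
  then show "holder_norm 1 b \<Omega> v \<le> of_nat (card {\<gamma> :: 'n \<Rightarrow> nat. mi_order \<gamma> \<le> 1}) * ennreal B
           + of_nat (card {\<gamma> :: 'n \<Rightarrow> nat. mi_order \<gamma> = 1}) * ennreal B"
    unfolding holder_norm_def using holder_seminorm_le[OF one]
    by (intro add_mono sum_bounded_above) auto
qed

text \<open>The seminorm is finite by definition of the space; the supremum is finite because the
  continuous extension lives on the compact closure.\<close>

lemma holder_space_0_imp_holder_bd:
  fixes f :: "real^'n \<Rightarrow> real"
  assumes f: "f \<in> holder_space 0 a \<Omega>" and o: "open \<Omega>" "bounded \<Omega>"
  shows "holder_norm 0 a \<Omega> f < \<infinity>"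
    and "holder_bd a (enn2real (holder_norm 0 a \<Omega> f)) \<Omega> f"
proof -
  let ?N = "holder_norm 0 a \<Omega> f"
  have set0: "{\<gamma> :: 'n \<Rightarrow> nat. mi_order \<gamma> \<le> 0} = {\<lambda>_. 0}" "{\<gamma> :: 'n \<Rightarrow> nat. mi_order \<gamma> = 0} = {\<lambda>_. 0}"
    by (auto simp: mi_order_eq_0_iff)
  have N: "?N = Linf_norm \<Omega> f + holder_seminorm a \<Omega> f"
    unfolding holder_norm_def set0 by (simp add: mi_deriv_zero)
  have c: "continuous_on \<Omega> f" using f by (simp add: holder_space_def)
  have z: "mi_order (\<lambda>_::'n. 0) = 0" by (simp add: mi_order_def)
  then have s: "holder_seminorm a \<Omega> f < \<infinity>" and "\<exists>g. continuous_extension \<Omega> f g"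
    using f unfolding holder_space_def by (auto dest!: spec[of _ "\<lambda>_::'n. 0"] simp: mi_deriv_zero)
  then obtain g where g: "continuous_on (closure \<Omega>) g" "\<And>x. x \<in> \<Omega> \<Longrightarrow> g x = f x"
    unfolding continuous_extension_def by blast
  have "bounded (g ` closure \<Omega>)"
    using o(2) by (intro compact_imp_bounded compact_continuous_image g(1)) (simp add: compact_closure)
  then obtain B where B: "\<And>x. x \<in> closure \<Omega> \<Longrightarrow> norm (g x) \<le> B" unfolding bounded_iff by blast
  have "\<bar>f x\<bar> \<le> B" if "x \<in> \<Omega>" for x using B[of x] g(2)[OF that] closure_subset that by auto
  then have "Linf_norm \<Omega> f \<le> ennreal B" by (rule Linf_norm_le[OF c o(1)])
  then have "Linf_norm \<Omega> f < \<infinity>" by (rule le_less_trans) simp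
  then show fin: "?N < \<infinity>" using s by (simp add: N)
  \<comment> \<open>\<open>enn2real\<close> sends infinity to 0, so finiteness has to come
    first.\<close>
  then have eN: "?N = ennreal (enn2real ?N)" by simp
  show "holder_bd a (enn2real ?N) \<Omega> f"
  proof (rule holder_bdI)
    fix x assume "x \<in> \<Omega>"
    then have "ennreal \<bar>f x\<bar> \<le> ?N" unfolding N using le_Linf_norm[OF c o(1)] by (simp add: add_increasing2)
    then show "\<bar>f x\<bar> \<le> enn2real ?N" by (subst (asm) eN) simp
  next
    fix x y assume xy: "x \<in> \<Omega>" "y \<in> \<Omega>"
    show "\<bar>f x - f y\<bar> \<le> enn2real ?N * norm (x - y) powr a"
    proof (cases "x = y")
      case False
      have "ennreal (\<bar>f x - f y\<bar> / norm (x - y) powr a) \<le> holder_seminorm a \<Omega> f"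
        unfolding holder_seminorm_def by (rule SUP_upper2[of "(x, y)"]) (use xy False in auto)
      also have "\<dots> \<le> ?N" unfolding N by simp
      finally have "ennreal (\<bar>f x - f y\<bar> / norm (x - y) powr a) \<le> ennreal (enn2real ?N)" using eN by simp
      then have "\<bar>f x - f y\<bar> / norm (x - y) powr a \<le> enn2real ?N" by simp
      then show ?thesis using False by (simp add: pos_divide_le_eq)
    qed simp
  qed
qed

section \<open>Assembly of the corrector and the solution for the remaining data\<close>

theorem theorem2p2:
  fixes \<Omega> :: "(real ^ 'n) set" and \<alpha> :: real
  assumes "bounded_Ck_domain 2 \<Omega>" and "0 < \<alpha>" and "\<alpha> < 1"
  shows "\<exists>C :: real \<Rightarrow> real. \<forall>f \<in> holder_space 0 \<alpha> \<Omega>.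
           (LINT x:\<Omega>|lebesgue. f x) = 0 \<longrightarrow>
           (\<exists>u :: real ^ 'n \<Rightarrow> real ^ 'n.
              (\<forall>x\<in>\<Omega>. divergence u x = f x) \<and> zero_on_boundary \<Omega> u \<and>
              (\<forall>\<beta>. 0 < \<beta> \<and> \<beta> < \<alpha> \<longrightarrow>
                 u \<in> holder_space_vec 1 \<beta> \<Omega> \<and>
                 holder_norm_vec 1 \<beta> \<Omega> u \<le> ennreal (C \<beta>) * holder_norm 0 \<alpha> \<Omega> f))"
proof -
  have o: "open \<Omega>" "connected \<Omega>" "\<Omega> \<noteq> {}" "bounded \<Omega>" and bd: "Ck_boundary 2 \<Omega>"
    using assms(1) by (auto simp: bounded_Ck_domain_def)
  have a: "0 < \<alpha>" "\<alpha> \<le> 1" using assms by auto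
  have chart: "\<exists>r e \<rho> d\<rho> L. boundary_chart \<Omega> x r e \<rho> d\<rho> L" if "x \<in> frontier \<Omega>" for x
    by (rule boundary_chart_exists[OF bd that])
  then have charts: "\<forall>x\<in>frontier \<Omega>. \<exists>r e \<rho> d\<rho> L. boundary_chart \<Omega> x r e \<rho> d\<rho> L" by (rule ballI)
  have tr: "\<exists>s \<zeta>0 r. transportable \<Omega> x s \<zeta>0 r" if x: "x \<in> closure \<Omega>" for x
  proof (cases "x \<in> \<Omega>")
    case True
    obtain R where R: "0 < R" "cball x R \<subseteq> \<Omega>"
      using open_contains_cball_eq[OF o(1), THEN spec, THEN iffD1, OF True] by (elim exE conjE)
    have "transportable \<Omega> x (R / 3) 0 (R / 3)"
      by (rule transportable_interior[OF R(2)]) (use R(1) in auto)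
    then show ?thesis by blast
  next
    case False
    then have f: "x \<in> frontier \<Omega>" using x o(1) by (simp add: frontier_def interior_open)
    obtain r e \<rho> d\<rho> L where "boundary_chart \<Omega> x r e \<rho> d\<rho> L" using chart[OF f] by blast
    then show ?thesis using transportable_boundary o(1) f by blast
  qed
  then have trs: "\<forall>x\<in>closure \<Omega>. \<exists>s \<zeta>0 r. transportable \<Omega> x s \<zeta>0 r" by (rule ballI)
  obtain C0 where C0: "0 \<le> C0" and corr: "\<forall>f M. 0 \<le> M \<longrightarrow> holder_bd \<alpha> M UNIV f \<longrightarrow>
    (\<exists>u G. (\<forall>x. x \<notin> \<Omega> \<longrightarrow> u x = 0) \<and> continuous_on UNIV u \<and>
      (\<forall>i. C1_holder \<alpha> (C0 * M) \<Omega> (\<lambda>x. u x $ i)) \<and> holder_bd \<alpha> (C0 * M) UNIV G \<and>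
      (\<forall>x\<in>\<Omega>. divergence u x = G x) \<and> (\<forall>x\<in>frontier \<Omega>. G x = f x) \<and>
      ((\<lambda>x. if x \<in> \<Omega> then G x else 0) has_integral 0) UNIV)"
    using boundary_correction[OF a o(1,4) charts] by (elim exE conjE)
  obtain C1 where C1: "\<forall>b. 0 < b \<and> b < \<alpha> \<longrightarrow> 0 \<le> C1 b" and sol: "\<forall>g M. 0 \<le> M \<longrightarrow> holder_bd \<alpha> M UNIV g \<longrightarrow>
     (\<forall>y. y \<notin> \<Omega> \<longrightarrow> g y = 0) \<longrightarrow> integral UNIV g = 0 \<longrightarrow> (\<exists>u. div_solution \<Omega> \<alpha> C1 M u g)"
    using solution_zero_boundary_data[OF a o trs] by (elim exE conjE)
  define n1 where "n1 = card {\<gamma> :: 'n \<Rightarrow> nat. mi_order \<gamma> \<le> 1}"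
  define n2 where "n2 = card {\<gamma> :: 'n \<Rightarrow> nat. mi_order \<gamma> = 1}"
  \<comment> \<open>\<open>2 * C0\<close> is the corrector with its exponent lowered from \<alpha>
    to \<open>b\<close>; the data left over have size \<open>(1 + C0) * M\<close> and are solved
    with constant \<open>C1 b\<close>.\<close>
  define B where "B b = 2 * C0 + C1 b * (1 + C0)" for b
  \<comment> \<open>\<open>n\<close> components, the norm of each being a sum of \<open>n1\<close>
    suprema and \<open>n2\<close> seminorms.\<close>
  define C where "C b = real CARD('n) * (real (n1 + n2) * B b)" for b
  show ?thesis
  proof (intro exI[of _ C] ballI impI)
    fix f assume f: "f \<in> holder_space 0 \<alpha> \<Omega>" and int0: "(LINT x:\<Omega>|lebesgue. f x) = 0"
    define M where "M = enn2real (holder_norm 0 \<alpha> \<Omega> f)"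
    have M: "0 \<le> M" by (simp add: M_def)
    have MN: "ennreal M = holder_norm 0 \<alpha> \<Omega> f"
      using holder_space_0_imp_holder_bd(1)[OF f o(1,4)] by (simp add: M_def)
    have fh: "holder_bd \<alpha> M \<Omega> f"
      unfolding M_def by (rule holder_space_0_imp_holder_bd(2)[OF f o(1,4)])
    obtain F where F: "holder_bd \<alpha> M UNIV F" "\<And>x. x \<in> \<Omega> \<Longrightarrow> F x = f x"
      using holder_bd_extension[OF fh a M o(3)] by blast
    obtain u0 G where u0z: "\<forall>x. x \<notin> \<Omega> \<longrightarrow> u0 x = 0" and u0c: "continuous_on UNIV u0"
      and u0: "\<forall>i. C1_holder \<alpha> (C0 * M) \<Omega> (\<lambda>x. u0 x $ i)" and Gh: "holder_bd \<alpha> (C0 * M) UNIV G"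
      and u0d: "\<forall>x\<in>\<Omega>. divergence u0 x = G x" and Gf: "\<forall>x\<in>frontier \<Omega>. G x = F x"
      and GI: "((\<lambda>x. if x \<in> \<Omega> then G x else 0) has_integral 0) UNIV"
      using corr[rule_format, OF M F(1)] by (elim exE conjE)
    \<comment> \<open>\<open>F\<close> and \<open>G\<close> agree on the frontier, so cutting off
      outside \<Omega> keeps the Hoelder bound.\<close>
    define g where "g x = (if x \<in> \<Omega> then F x - G x else 0)" for x
    have gh: "holder_bd \<alpha> (M + C0 * M) UNIV g"
      unfolding g_def
      by (rule holder_bd_zero_extension[OF holder_bd_diff[OF F(1) Gh] a(1)]) (use M C0 Gf in auto)
    have gI: "integral UNIV g = 0"
    proof -
      \<comment> \<open>The Lebesgue integral of a non-integrable function is 0 by default; once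
        integrability is secured, \<open>int0\<close> becomes a statement about
        \<open>has_integral\<close>.\<close>
      have "f absolutely_integrable_on \<Omega>"
      proof (rule measurable_bounded_by_integrable_imp_absolutely_integrable)
        show "f \<in> borel_measurable (lebesgue_on \<Omega>)"
          using holder_bd_continuous_on[OF fh a(1)] o(1) by (intro continuous_imp_measurable_on_sets_lebesgue) auto
        show "(\<lambda>x. M) integrable_on \<Omega>"
          using o by (intro integrable_on_const lmeasurable_open)
        show "\<Omega> \<in> sets lebesgue" using o(1) by auto
        show "norm (f x) \<le> M" if "x \<in> \<Omega>" for x using holder_bdD(1)[OF fh that] by simp
      qed
      from set_lebesgue_integral_eq_integral[OF this] int0
      have "(f has_integral 0) \<Omega>" by (simp add: has_integral_integrable_integral)
      then have "((\<lambda>x. if x \<in> \<Omega> then f x else 0) has_integral 0) UNIV" by (simp add: has_integral_restrict_UNIV)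
      from has_integral_diff[OF this GI]
      have "((\<lambda>x. (if x \<in> \<Omega> then f x else 0) - (if x \<in> \<Omega> then G x else 0)) has_integral 0) UNIV" by simp
      moreover have "(\<lambda>x. (if x \<in> \<Omega> then f x else 0) - (if x \<in> \<Omega> then G x else 0)) = g"
        using F(2) by (auto simp: g_def fun_eq_iff)
      ultimately show ?thesis by (simp add: integral_unique)
    qed
    have M1: "0 \<le> M + C0 * M" using M C0 by simp
    obtain w where w: "div_solution \<Omega> \<alpha> C1 (M + C0 * M) w g"
      using sol[rule_format, OF M1 gh _ gI] by (auto simp: g_def)
    note wd = div_solutionD[OF w]
    have half: "0 < \<alpha> / 2" "\<alpha> / 2 < \<alpha>" using a by auto
    define u where "u x = u0 x + w x" for x
    have C1h: "C1_holder b (B b * M) \<Omega> (\<lambda>x. u x $ i)" if b: "0 < b" "b < \<alpha>" for b i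
    proof -
      have "C1_holder b (2 * (C0 * M)) \<Omega> (\<lambda>x. u0 x $ i)"
        by (rule C1_holder_exponent_mono[OF u0[rule_format]]) (use b C0 M in auto)
      from C1_holder_add[OF this C1_holder_subset[OF wd(2)[OF b, of i] subset_UNIV]]
      show ?thesis by (simp add: u_def B_def algebra_simps)
    qed
    have "divergence u x = f x" if x: "x \<in> \<Omega>" for x
    proof -
      have "divergence u x = divergence u0 x + divergence w x"
        using partial_deriv_add[OF u0[rule_format] C1_holder_subset[OF wd(2)[OF half] subset_UNIV] x]
        by (simp add: u_def divergence_def sum.distrib)
      then show ?thesis using u0d wd(3)[of x] x F(2)[OF x] by (simp add: g_def)
    qed
    moreover have "zero_on_boundary \<Omega> u"
    proof -
      have wc: "continuous_on UNIV w"
        by (rule holder_bd_componentwise_continuous[OF C1_holderD(1)[OF wd(2)[OF half]] half(1)])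
      have uz: "u x = 0" if "x \<notin> \<Omega>" for x using u0z wd(1) that by (simp add: u_def)
      have "continuous_on (closure \<Omega>) u"
        unfolding u_def by (intro continuous_on_add continuous_on_subset[OF u0c] continuous_on_subset[OF wc]) auto
      moreover have "u x = 0" if "x \<in> frontier \<Omega>" for x
        using that o(1) by (intro uz) (simp add: frontier_def interior_open)
      ultimately show ?thesis
        unfolding zero_on_boundary_def continuous_extension_def by blast
    qed
    moreover have "u \<in> holder_space_vec 1 b \<Omega> \<and> holder_norm_vec 1 b \<Omega> u \<le> ennreal (C b) * holder_norm 0 \<alpha> \<Omega> f"
      if b: "0 < b \<and> b < \<alpha>" for b
    proof
      show "u \<in> holder_space_vec 1 b \<Omega>"
        unfolding holder_space_vec_def using C1_holder_imp_holder_space(1)[OF C1h] b o(1) by blast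
      have B: "0 \<le> B b" using C0 C1 b by (simp add: B_def)
      have "holder_norm 1 b \<Omega> (\<lambda>x. u x $ j) \<le> ennreal (real (n1 + n2) * (B b * M))" for j
      proof -
        have "holder_norm 1 b \<Omega> (\<lambda>x. u x $ j) \<le> of_nat n1 * ennreal (B b * M) + of_nat n2 * ennreal (B b * M)"
          unfolding n1_def n2_def using b o(1) by (intro C1_holder_imp_holder_space(2)[OF C1h]) auto
        also have "\<dots> = ennreal (real (n1 + n2) * (B b * M))"
          using B M by (simp add: distrib_right[symmetric] ennreal_mult ennreal_of_nat_eq_real_of_nat ennreal_plus[symmetric] del: ennreal_plus)
        finally show ?thesis .
      qed
      then have "holder_norm_vec 1 b \<Omega> u \<le> of_nat CARD('n) * ennreal (real (n1 + n2) * (B b * M))"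
        unfolding holder_norm_vec_def by (intro sum_bounded_above)
      also have "\<dots> = ennreal (C b) * ennreal M"
        using B M by (simp add: C_def ennreal_of_nat_eq_real_of_nat ennreal_mult[symmetric] mult_ac)
      finally show "holder_norm_vec 1 b \<Omega> u \<le> ennreal (C b) * holder_norm 0 \<alpha> \<Omega> f" by (simp add: MN)
    qed
    ultimately show "\<exists>u :: real ^ 'n \<Rightarrow> real ^ 'n.
              (\<forall>x\<in>\<Omega>. divergence u x = f x) \<and> zero_on_boundary \<Omega> u \<and>
              (\<forall>\<beta>. 0 < \<beta> \<and> \<beta> < \<alpha> \<longrightarrow>
                 u \<in> holder_space_vec 1 \<beta> \<Omega> \<and>
                 holder_norm_vec 1 \<beta> \<Omega> u \<le> ennreal (C \<beta>) * holder_norm 0 \<alpha> \<Omega> f)"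
      by blast
  qed
qed

end
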